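(* Let $X\subset\mathbb{R}^2$ be a dominated self-affine set satisfying the weak bounded neighborhood condition such that $\dim_{\mathrm H}(X)\ge1$ and $\dim_{\mathrm H}(\mathrm{proj}_{V^\perp}(X))=1$ for all $V\in X_F$. Then $$\dim_{\mathrm A}(X)=1+\max_{x\in X,\ V\in X_F}\dim_{\mathrm H}(X\cap(V+x))=1+\max_{x\in X,\ V\in\mathbb{RP}^1\setminus Y_F}\dim_{\mathrm A}(X\cap(V+x));$$ in particular both maxima exist.
   Context: A self-affine set $X\subset\mathbb{R}^2$ is the unique non-empty compact set with $X=\bigcup_{i=1}^N\varphi_i(X)$ for a given finite tuple of contractive affine maps $\varphi_i(x)=A_ix+b_i$, $A_i\in GL_2(\mathbb{R})$, $b_i\in\mathbb{R}^2$; $X$ always comes with such a tuple. $\Sigma_n=\{1,\dots,N\}^n$, $\Sigma_*=\bigcup_{n\in\mathbb{N}}\Sigma_n$. For $\mathtt{i}=i_1\cdots i_n\in\Sigma_n$: $|\mathtt i|=n$, $\varphi_{\mathtt i}=\varphi_{i_1}\circ\cdots\circ\varphi_{i_n}$, $A_{\mathtt i}=A_{i_1}\cdots A_{i_n}$, $\mathtt i^-=i_1\cdots i_{n-1}$ (empty word with identity matrix if $n=1$), $\overleftarrow{\mathtt i}=i_n\cdots i_1$, and $A^{-1}_{\overleftarrow{\mathtt i}}=(A_{\overleftarrow{\mathtt i}})^{-1}=A_{i_1}^{-1}\cdots A_{i_n}^{-1}$. $\alpha_1(A)\ge\alpha_2(A)$ are the singular values of $A$. $X$ is dominated if there are $C>0$,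 $0<\tau<1$ with $\alpha_2(A_{\mathtt i})\le C\tau^{|\mathtt i|}\alpha_1(A_{\mathtt i})$ for all $\mathtt i\in\Sigma_*$. $X$ satisfies the weak bounded neighborhood condition (WBNC) if $\sup_{x\in X,\,r>0}\#\Phi(x,r)<\infty$, where $\Phi(x,r)=\{\varphi_{\mathtt i}:\alpha_2(A_{\mathtt i})\le r<\alpha_2(A_{\mathtt i^-})\text{ and }\varphi_{\mathtt i}(X)\cap B(x,r)\ne\emptyset\}$ is a set of maps (so coinciding maps are counted once). $\mathbb{RP}^1$ is the set of lines through the origin in $\mathbb{R}^2$, with the angle metric. The forward and backward Furstenberg directions are $Y_F=\{\mathrm{im}(A)\in\mathbb{RP}^1:A\in\overline{\{cA_{\mathtt i}:c\in\mathbb{R},\mathtt i\in\Sigma_*\}}\text{ has rank one}\}$ and $X_F=\{\mathrm{im}(A)\in\mathbb{RP}^1:A\in\overline{\{cA^{-1}_{\overleftarrow{\mathtt i}}:c\in\mathbb{R},\mathtt i\in\Sigma_*\}}\text{ has rank one}\}$. $\mathrm{proj}_{V^\perp}$ is the orthogonal projection onto the orthogonal complement of $V$. $\dim_{\mathrm H}$ is the Hausdorff dimension, and $\dim_{\mathrm A}(E)$ is the Assouad dimension: the infimum of $s>0$ for which there is $C>0$ with $N_r(E\cap B(x,R))\le C(R/r)^s$ for all $x\in E$, $0<r<R$, where $N_r$ is the least number of closed $r$-balls needed to cover. *)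

theory Defs
  imports "HOL-Analysis.Analysis"
begin

section \<open>Hausdorff and Assouad dimension\<close>

text \<open>
  Covers are countable families (finite ones are padded with the empty set). Since
  \<open>0 powr 0 = 0\<close> in HOL, the premeasure is only meaningful for \<open>s > 0\<close>; this is the only range used
  in the definition of the dimension, and omitting \<open>s = 0\<close> does not change the infimum.
\<close>

definition hausdorff_premeasure :: "real \<Rightarrow> real \<Rightarrow> 'a::metric_space set \<Rightarrow> ennreal" where
  "hausdorff_premeasure s \<delta> E =
     (INF U \<in> {U :: nat \<Rightarrow> 'a set. E \<subseteq> (\<Union>i. U i) \<and> (\<forall>i. bounded (U i) \<and> diameter (U i) \<le> \<delta>)}.
        \<Sum>i. ennreal (diameter (U i) powr s))"

definition hausdorff_measure :: "real \<Rightarrow> 'a::metric_space set \<Rightarrow> ennreal" where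
  "hausdorff_measure s E = (SUP \<delta> \<in> {0<..}. hausdorff_premeasure s \<delta> E)"

definition hausdorff_dim :: "'a::metric_space set \<Rightarrow> ereal" where
  "hausdorff_dim E = Inf {ereal s |s. s > 0 \<and> hausdorff_measure s E = 0}"

text \<open>The infimum of the empty set is \<open>\<infinity>\<close> in \<open>enat\<close>, so this is \<open>\<infinity>\<close> if there is no finite cover.\<close>

definition covering_number :: "real \<Rightarrow> 'a::metric_space set \<Rightarrow> enat" where
  "covering_number r S = (INF F \<in> {F. finite F \<and> S \<subseteq> (\<Union>c\<in>F. cball c r)}. enat (card F))"

definition assouad_dim :: "'a::metric_space set \<Rightarrow> ereal" where
  "assouad_dim E = Inf {ereal s |s. s > 0 \<and>
     (\<exists>C>0. \<forall>x\<in>E. \<forall>r R. 0 < r \<and> r < R \<longrightarrow>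
        ereal_of_enat (covering_number r (E \<inter> cball x R)) \<le> ereal (C * (R / r) powr s))}"


section \<open>Lines, projections and singular values\<close>

definition RP1 :: "(real^2) set set" where
  "RP1 = {V. subspace V \<and> dim V = 1}"

definition orth_proj :: "'a::euclidean_space set \<Rightarrow> 'a \<Rightarrow> 'a" where
  "orth_proj W x = (THE y. y \<in> W \<and> x - y \<in> W\<^sup>\<bottom>)"

text \<open>
  The singular values of \<open>M\<close> are the square roots of the eigenvalues of \<open>M\<^sup>T M\<close>. If this matrix has
  only one eigenvalue, it has multiplicity two, so \<open>\<alpha>1 M = \<alpha>2 M\<close>, as it should be.
\<close>

definition singular_values :: "real^2^2 \<Rightarrow> real set" where
  "singular_values M = {sqrt l |l. \<exists>v. v \<noteq> 0 \<and> (transpose M ** M) *v v = l *\<^sub>R v}"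

definition \<alpha>1 :: "real^2^2 \<Rightarrow> real" where
  "\<alpha>1 M = Max (singular_values M)"

definition \<alpha>2 :: "real^2^2 \<Rightarrow> real" where
  "\<alpha>2 M = Min (singular_values M)"


section \<open>Planar self-affine sets\<close>

text \<open>
  A tuple of affine maps is given by its length \<open>N\<close> and by families \<open>A\<close> and \<open>b\<close>, of which only the
  values at the indices \<open>1, \<dots>, N\<close> matter.
\<close>

definition affine_map :: "(nat \<Rightarrow> real^2^2) \<Rightarrow> (nat \<Rightarrow> real^2) \<Rightarrow> nat \<Rightarrow> real^2 \<Rightarrow> real^2" where
  "affine_map A b i x = A i *v x + b i"

definition self_affine_set ::
  "nat \<Rightarrow> (nat \<Rightarrow> real^2^2) \<Rightarrow> (nat \<Rightarrow> real^2) \<Rightarrow> (real^2) set \<Rightarrow> bool" where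
  "self_affine_set N A b X \<longleftrightarrow>
     (\<forall>i\<in>{1..N}. invertible (A i) \<and> (\<exists>\<rho><1. \<rho>-lipschitz_on UNIV (affine_map A b i))) \<and>
     compact X \<and> X \<noteq> {} \<and> X = (\<Union>i\<in>{1..N}. affine_map A b i ` X)"

text \<open>The finite words of positive length; the empty word only occurs as \<open>butlast [i]\<close>.\<close>

definition words :: "nat \<Rightarrow> nat list set" where
  "words N = {w. w \<noteq> [] \<and> set w \<subseteq> {1..N}}"

definition word_matrix :: "(nat \<Rightarrow> real^2^2) \<Rightarrow> nat list \<Rightarrow> real^2^2" where
  "word_matrix A w = foldr (\<lambda>i M. A i ** M) w (mat 1)"

definition word_map ::
  "(nat \<Rightarrow> real^2^2) \<Rightarrow> (nat \<Rightarrow> real^2) \<Rightarrow> nat list \<Rightarrow> real^2 \<Rightarrow> real^2" where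
  "word_map A b w = foldr (\<lambda>i f. affine_map A b i \<circ> f) w id"

definition dominated :: "nat \<Rightarrow> (nat \<Rightarrow> real^2^2) \<Rightarrow> bool" where
  "dominated N A \<longleftrightarrow>
     (\<exists>C \<tau>. C > 0 \<and> 0 < \<tau> \<and> \<tau> < 1 \<and>
        (\<forall>w\<in>words N. \<alpha>2 (word_matrix A w) \<le> C * \<tau> ^ length w * \<alpha>1 (word_matrix A w)))"

text \<open>A set of maps rather than of words, so that coinciding maps are counted once.\<close>

definition neighborhood_maps ::
  "nat \<Rightarrow> (nat \<Rightarrow> real^2^2) \<Rightarrow> (nat \<Rightarrow> real^2) \<Rightarrow> (real^2) set \<Rightarrow> real^2 \<Rightarrow> real
     \<Rightarrow> (real^2 \<Rightarrow> real^2) set" where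
  "neighborhood_maps N A b X x r =
     {word_map A b w |w. w \<in> words N \<and>
        \<alpha>2 (word_matrix A w) \<le> r \<and> r < \<alpha>2 (word_matrix A (butlast w)) \<and>
        word_map A b w ` X \<inter> cball x r \<noteq> {}}"

definition weak_bounded_neighborhood ::
  "nat \<Rightarrow> (nat \<Rightarrow> real^2^2) \<Rightarrow> (nat \<Rightarrow> real^2) \<Rightarrow> (real^2) set \<Rightarrow> bool" where
  "weak_bounded_neighborhood N A b X \<longleftrightarrow>
     (\<exists>K::nat. \<forall>x\<in>X. \<forall>r>0.
        finite (neighborhood_maps N A b X x r) \<and> card (neighborhood_maps N A b X x r) \<le> K)"

definition forward_furstenberg :: "nat \<Rightarrow> (nat \<Rightarrow> real^2^2) \<Rightarrow> (real^2) set set" where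
  "forward_furstenberg N A =
     {range ((*v) M) |M. rank M = 1 \<and>
        M \<in> closure {c *\<^sub>R word_matrix A w |c w. w \<in> words N}}"

definition backward_furstenberg :: "nat \<Rightarrow> (nat \<Rightarrow> real^2^2) \<Rightarrow> (real^2) set set" where
  "backward_furstenberg N A =
     {range ((*v) M) |M. rank M = 1 \<and>
        M \<in> closure {c *\<^sub>R matrix_inv (word_matrix A (rev w)) |c w. w \<in> words N}}"

definition slice :: "(real^2) set \<Rightarrow> (real^2) set \<Rightarrow> real^2 \<Rightarrow> (real^2) set" where
  "slice X V x = X \<inter> (\<lambda>v. v + x) ` V"

definition is_maximum :: "'a::order set \<Rightarrow> 'a \<Rightarrow> bool" where
  "is_maximum S m \<longleftrightarrow> m \<in> S \<and> (\<forall>s\<in>S. s \<le> m)"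

end

theory Submission
  imports Defs
begin

text \<open>
  Write \<open>A_w\<close>, \<open>\<phi>_w\<close> for the matrix and the map of a word \<open>w\<close>. By the weak bounded neighborhood
  condition, a ball \<open>B(y, R)\<close> meets only boundedly many cylinders \<open>\<phi>_w(X)\<close> with \<open>\<alpha>2 (A_w)\<close> comparable
  to \<open>R\<close>. Pulled back by \<open>\<phi>_w\<close>, the ball becomes a neighbourhood of width about \<open>R / \<alpha>1 (A_w)\<close> of a
  piece of line whose direction, the one that \<open>A_w\<close> contracts most, is close to a backward Furstenberg
  direction; by domination the width tends to \<open>0\<close> with \<open>R\<close>. So at small scales \<open>X\<close> looks like
  boundedly many copies of a slice times a projection of \<open>X\<close>, and the projection has dimension \<open>1\<close>.
  Both inequalities make this precise by counting balls.

  Upper bound (\<open>assouad_dim_le_slice\<close>). If every slice in a backward Furstenberg direction had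
  dimension less than \<open>dim_A X - 1\<close>, compactness would give finitely many covers of slices, with
  \<open>\<Sum>r\<^sup>s\<close> small for some \<open>s < dim_A X - 1\<close>, such that every thin strip of \<open>X\<close> in nearly such a
  direction is covered by one of them. The map \<open>\<phi>_w\<close> sends the part of the strip in a ball of radius \<open>r\<close>
  to a set whose part in \<open>B(y, R)\<close> lies in a rectangle with sides \<open>R\<close> and \<open>r R\<close>, which is covered by
  about \<open>1 / r\<close> balls of radius \<open>r R\<close>. Hence \<open>B(y, R)\<close> is covered by balls of relative radii \<open>r\<close> with
  \<open>\<Sum>r\<^bsup>1+s\<^esup> \<le> 1\<close>, and iterating this cover (\<open>assouad_dim_leI\<close>) gives \<open>dim_A X \<le> 1 + s\<close>, a
  contradiction. Thus some slice attains at least \<open>dim_A X - 1\<close>, which is why the maxima exist.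

  Lower bound (\<open>assouad_dim_ge_slice\<close>). Take a slice in a direction that is not a forward Furstenberg
  direction. On such a direction \<open>A_w\<^sup>-\<^sup>1\<close> expands by \<open>1 / \<alpha>2 (A_w)\<close> up to a constant, so a ball of the
  slice that needs many balls can be blown up to unit size: there are about \<open>\<epsilon>\<^bsup>-s\<^esup>\<close> points of \<open>X\<close> on a
  line, \<open>\<epsilon>\<close>-separated (\<open>slice_microset\<close>). A map \<open>\<phi>_j\<close> that contracts this line, with
  \<open>\<alpha>2 (A_j) / \<alpha>1 (A_j)\<close> about \<open>\<epsilon>\<close>, sends the cylinders of size \<open>\<epsilon>\<close> around these points to almost
  parallel strips with sides \<open>\<alpha>2 (A_j)\<close> and \<open>\<epsilon> \<alpha>2 (A_j)\<close>, which are disjoint at the scale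
  \<open>\<epsilon> \<alpha>2 (A_j)\<close>. Each of them needs about \<open>\<epsilon>\<^bsup>-t\<^esup>\<close> balls of this radius for any \<open>t < 1\<close>, because of the
  projections; the constant is uniform in the direction by a Baire category argument
  (\<open>uniform_projection_count\<close>).

  The linear algebra rests on one consequence of domination: \<open>\<alpha>1 (A_u A_v)\<close> is at least a constant times
  \<open>\<alpha>1 (A_u) \<alpha>1 (A_v)\<close> (\<open>almost_multiplicative\<close>). It implies in particular that no backward Furstenberg
  direction is a forward one (\<open>backward_not_forward\<close>), so the slices of the upper bound are among those
  of the lower bound. As \<open>dim_H \<le> dim_A\<close> for bounded sets, the inequalities close up to the equalities
  of the theorem.
\<close>

section \<open>Singular values in the plane\<close>

text \<open>
  The rotation by a right angle; \<open>perp u \<bullet> v\<close> is the area form of the plane.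
\<close>

definition perp :: "real^2 \<Rightarrow> real^2" where
  "perp v = vector [- v$2, v$1]"

lemma perp_nth [simp]: "perp v $ 1 = - v$2" "perp v $ 2 = v$1"
  by (simp_all add: perp_def)

lemma inner_real2: "(u::real^2) \<bullet> v = u$1 * v$1 + u$2 * v$2"
  by (simp add: inner_vec_def sum_2)

lemma norm_real2: "(norm (u::real^2))\<^sup>2 = (u$1)\<^sup>2 + (u$2)\<^sup>2"
  unfolding power2_norm_eq_inner inner_real2 by (simp add: power2_eq_square)

lemma perp_simps [simp]: "norm (perp v) = norm v" "v \<bullet> perp v = 0" "perp v \<bullet> v = 0"
  "perp (perp v) = - v" "perp 0 = 0" "perp v = 0 \<longleftrightarrow> v = 0"
proof -
  have "(norm (perp v))\<^sup>2 = (norm v)\<^sup>2" by (simp add: norm_real2)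
  then show "norm (perp v) = norm v" by simp
qed (auto simp: inner_real2 vec_eq_iff forall_2)

lemma perp_scaleR: "perp (c *\<^sub>R v) = c *\<^sub>R perp v"
  by (simp add: vec_eq_iff forall_2)

lemma mat_vec_nth2: "((M::real^2^2) *v v) $ i = M$i$1 * v$1 + M$i$2 * v$2"
  by (simp add: matrix_vector_mult_def sum_2)

lemma det_mult_perp: "perp (M *v u) \<bullet> (M *v v) = det M * (perp u \<bullet> v)" for M :: "real^2^2"
  by (simp add: inner_real2 mat_vec_nth2 det_2 algebra_simps)

lemma perp_decomp:
  assumes "norm f = 1"
  shows "v = (f \<bullet> v) *\<^sub>R f + (perp f \<bullet> v) *\<^sub>R perp f"
    and "(norm v)\<^sup>2 = (f \<bullet> v)\<^sup>2 + (perp f \<bullet> v)\<^sup>2"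
proof -
  have 1: "(f$1)\<^sup>2 + (f$2)\<^sup>2 = 1" using assms norm_real2[of f] by simp
  have "v$1 = v$1 * ((f$1)\<^sup>2 + (f$2)\<^sup>2)" "v$2 = v$2 * ((f$1)\<^sup>2 + (f$2)\<^sup>2)" by (simp_all add: 1)
  then show "v = (f \<bullet> v) *\<^sub>R f + (perp f \<bullet> v) *\<^sub>R perp f"
    by (simp add: vec_eq_iff forall_2 inner_real2 power2_eq_square algebra_simps)
  have "(norm v)\<^sup>2 = (norm v)\<^sup>2 * ((f$1)\<^sup>2 + (f$2)\<^sup>2)" by (simp add: 1)
  then show "(norm v)\<^sup>2 = (f \<bullet> v)\<^sup>2 + (perp f \<bullet> v)\<^sup>2"
    unfolding norm_real2 inner_real2 by (simp add: power2_eq_square algebra_simps)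
qed

lemma unit_vector_parallel:
  assumes "norm f = 1" "perp f \<bullet> v = 0"
  shows "v = (f \<bullet> v) *\<^sub>R f"
  using perp_decomp(1)[OF assms(1), of v] assms(2) by simp

text \<open>
  Up to a factor this is the inverse of \<open>M\<close>, but it also exists for singular \<open>M\<close> and is linear in \<open>M\<close>,
  so that it can be used for limits of multiples of inverses.
\<close>

definition adjugate :: "real^2^2 \<Rightarrow> real^2^2" where
  "adjugate M = vector [vector [M$2$2, - M$1$2], vector [- M$2$1, M$1$1]]"

lemma adjugate_nth [simp]:
  "adjugate M $ 1 $ 1 = M$2$2" "adjugate M $ 1 $ 2 = - M$1$2"
  "adjugate M $ 2 $ 1 = - M$2$1" "adjugate M $ 2 $ 2 = M$1$1"
  by (simp_all add: adjugate_def)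

lemma mult_adjugate: "M *v (adjugate M *v v) = det M *\<^sub>R v" "adjugate M *v (M *v v) = det M *\<^sub>R v"
  by (simp_all add: vec_eq_iff forall_2 mat_vec_nth2 det_2 algebra_simps)

lemma matrix_inv_eq_adjugate:
  assumes "det M \<noteq> 0"
  shows "matrix_inv M = (1 / det M) *\<^sub>R adjugate M"
proof -
  let ?I = "(1 / det M) *\<^sub>R adjugate M"
  have 1: "M ** ?I = mat 1" "?I ** M = mat 1"
    using assms by (simp_all add: vec_eq_iff forall_2 matrix_matrix_mult_def sum_2 mat_def det_2
        diff_divide_distrib[symmetric] mult.commute)
  then have "M ** matrix_inv M = mat 1 \<and> matrix_inv M ** M = mat 1"
    unfolding matrix_inv_def by (rule someI[of "\<lambda>A'. M ** A' = mat 1 \<and> A' ** M = mat 1", OF conjI])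
  then have "matrix_inv M = matrix_inv M ** (M ** ?I)" using 1 by simp
  also have "\<dots> = ?I" using \<open>M ** matrix_inv M = mat 1 \<and> _\<close> by (simp only: matrix_mul_assoc matrix_mul_lid)
  finally show ?thesis .
qed

text \<open>
  Otherwise the norm would increase to first order when \<open>f\<close> is turned towards \<open>\<plusminus> perp f\<close>.
\<close>

lemma norm_max_orthogonal:
  fixes M :: "real^2^2"
  assumes f: "norm f = 1" and max: "\<And>v. norm v = 1 \<Longrightarrow> norm (M *v v) \<le> norm (M *v f)"
  shows "(M *v f) \<bullet> (M *v perp f) = 0"
proof (rule ccontr)
  let ?p = "(norm (M *v f))\<^sup>2" and ?q = "(norm (M *v perp f))\<^sup>2" and ?r = "(M *v f) \<bullet> (M *v perp f)"
  assume r: "?r \<noteq> 0"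
  have q: "?q \<le> ?p" using max[of "perp f"] f by (simp add: power_mono)
  define d where "d = ?p - ?q"
  define t where "t = 1 / (d + 1)"
  have "d \<ge> 0" using q unfolding d_def by linarith
  then have t: "t > 0" "t * (?p - ?q) < 2"
    unfolding d_def[symmetric] t_def by (simp_all add: pos_divide_less_eq)
  define v where "v = f + (t * ?r) *\<^sub>R perp f"
  have nv: "(norm v)\<^sup>2 = 1 + (t * ?r)\<^sup>2"
    using f by (subst perp_decomp(2)[OF f]) (simp add: v_def inner_add_right dot_square_norm)
  then have v0: "v \<noteq> 0" by (auto simp: add_nonneg_eq_0_iff)
  have hom: "norm (M *v v) \<le> norm (M *v f) * norm v"
  proof -
    have "norm (M *v (v /\<^sub>R norm v)) \<le> norm (M *v f)" using v0 by (intro max) simp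
    then show ?thesis using v0 by (simp add: matrix_vector_mult_scaleR field_simps)
  qed
  have "(norm (M *v v))\<^sup>2 \<le> ?p * (1 + (t * ?r)\<^sup>2)"
    using power_mono[OF hom, of 2] by (simp add: power_mult_distrib nv)
  moreover have "(norm (M *v v))\<^sup>2 = ?p + 2 * t * ?r\<^sup>2 + (t * ?r)\<^sup>2 * ?q"
    unfolding power2_norm_eq_inner
    by (simp add: v_def matrix_vector_right_distrib matrix_vector_mult_scaleR inner_add_left
        inner_add_right inner_commute power2_eq_square algebra_simps)
  ultimately have "2 * (t * ?r\<^sup>2) \<le> (t * (?p - ?q)) * (t * ?r\<^sup>2)"
    by (simp add: power2_eq_square algebra_simps)
  moreover have "t * ?r\<^sup>2 > 0" using t r by simp
  ultimately have "2 \<le> t * (?p - ?q)" by (simp only: mult_le_cancel_right_pos)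
  then show False using t by simp
qed

text \<open>
  A unit vector \<open>f\<close> that maximises \<open>norm (M *v f)\<close> and its orthogonal complement are eigenvectors of
  \<open>M\<^sup>T M\<close>, by \<open>norm_max_orthogonal\<close>. This makes \<open>\<alpha>1\<close> the operator norm.
\<close>

lemma singular_values_basis:
  fixes M :: "real^2^2"
  obtains f where "norm f = 1" "(M *v f) \<bullet> (M *v perp f) = 0"
    "\<alpha>1 M = norm (M *v f)" "\<alpha>2 M = norm (M *v perp f)" "\<And>v. norm (M *v v) \<le> norm (M *v f) * norm v"
proof -
  have "compact (sphere (0::real^2) 1)" "sphere (0::real^2) 1 \<noteq> {}" by auto
  moreover have "continuous_on (sphere 0 1) (\<lambda>v. norm (M *v v))"
    by (intro continuous_intros linear_continuous_on matrix_vector_mul_bounded_linear)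
  ultimately obtain f where f: "norm f = 1" and fm: "\<And>v. norm v = 1 \<Longrightarrow> norm (M *v v) \<le> norm (M *v f)"
    using continuous_attains_sup[of "sphere 0 1" "\<lambda>v. norm (M *v v)"] by auto
  have orth: "(M *v f) \<bullet> (M *v perp f) = 0" by (rule norm_max_orthogonal[OF f fm])
  let ?S = "transpose M ** M"
  have S: "x \<bullet> (?S *v y) = (M *v x) \<bullet> (M *v y)" for x y
    by (metis dot_lmul_matrix inner_commute matrix_vector_mul_assoc transpose_matrix_vector)
  have eig: "?S *v f = (norm (M *v f))\<^sup>2 *\<^sub>R f" "?S *v perp f = (norm (M *v perp f))\<^sup>2 *\<^sub>R perp f"
  proof -
    show "?S *v f = (norm (M *v f))\<^sup>2 *\<^sub>R f"
      by (subst perp_decomp(1)[OF f]) (simp add: S orth inner_commute[of _ "M *v f"] dot_square_norm)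
    show "?S *v perp f = (norm (M *v perp f))\<^sup>2 *\<^sub>R perp f"
      by (subst perp_decomp(1)[OF f]) (simp add: S orth dot_square_norm)
  qed
  have "singular_values M = {norm (M *v f), norm (M *v perp f)}"
  proof (intro equalityI subsetI)
    fix x assume "x \<in> singular_values M"
    then obtain l v where x: "x = sqrt l" and v: "v \<noteq> 0" "?S *v v = l *\<^sub>R v"
      by (auto simp: singular_values_def)
    have 1: "f \<bullet> (?S *v v) = (norm (M *v f))\<^sup>2 * (f \<bullet> v)"
      using arg_cong[OF eig(1), of "\<lambda>z. v \<bullet> z"] by (simp add: S inner_commute)
    have 2: "perp f \<bullet> (?S *v v) = (norm (M *v perp f))\<^sup>2 * (perp f \<bullet> v)"
      using arg_cong[OF eig(2), of "\<lambda>z. v \<bullet> z"] by (simp add: S inner_commute)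
    have "f \<bullet> v \<noteq> 0 \<or> perp f \<bullet> v \<noteq> 0" using v(1) perp_decomp(1)[OF f, of v] by auto
    then have "l = (norm (M *v f))\<^sup>2 \<or> l = (norm (M *v perp f))\<^sup>2"
      using 1 2 v(2) by auto
    then show "x \<in> {norm (M *v f), norm (M *v perp f)}" using x by auto
  next
    fix x assume "x \<in> {norm (M *v f), norm (M *v perp f)}"
    moreover have "f \<noteq> 0" "perp f \<noteq> 0" using f by auto
    moreover have "norm z = sqrt ((norm z)\<^sup>2)" for z :: "real^2" by simp
    ultimately show "x \<in> singular_values M" unfolding singular_values_def using eig by blast
  qed
  moreover have "norm (M *v perp f) \<le> norm (M *v f)" using fm f by simp
  ultimately have "\<alpha>1 M = norm (M *v f)" "\<alpha>2 M = norm (M *v perp f)"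
    by (simp_all add: \<alpha>1_def \<alpha>2_def)
  moreover have "norm (M *v v) \<le> norm (M *v f) * norm v" for v
  proof (cases "v = 0")
    case False
    have "norm (M *v (v /\<^sub>R norm v)) \<le> norm (M *v f)" using False by (intro fm) simp
    then show ?thesis using False by (simp add: matrix_vector_mult_scaleR field_simps)
  qed simp
  ultimately show ?thesis using that f orth by blast
qed

lemma \<alpha>1_nonneg [simp]: "0 \<le> \<alpha>1 M" and \<alpha>2_nonneg [simp]: "0 \<le> \<alpha>2 M"
  and norm_le_\<alpha>1: "norm (M *v v) \<le> \<alpha>1 M * norm v"
  and \<alpha>1_mult_\<alpha>2: "\<alpha>1 M * \<alpha>2 M = \<bar>det M\<bar>"
  and \<alpha>_sumsq: "(\<alpha>1 M)\<^sup>2 + (\<alpha>2 M)\<^sup>2 = (norm M)\<^sup>2"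
  and \<alpha>2_le_\<alpha>1: "\<alpha>2 M \<le> \<alpha>1 M"
proof -
  obtain f where f: "norm f = 1" and o: "(M *v f) \<bullet> (M *v perp f) = 0" and a:
    "\<alpha>1 M = norm (M *v f)" "\<alpha>2 M = norm (M *v perp f)" and le: "\<And>v. norm (M *v v) \<le> norm (M *v f) * norm v"
    using singular_values_basis by blast
  show "0 \<le> \<alpha>1 M" "0 \<le> \<alpha>2 M" "norm (M *v v) \<le> \<alpha>1 M * norm v" using a le by auto
  show "\<alpha>2 M \<le> \<alpha>1 M" using a le[of "perp f"] f by simp
  have "perp (M *v f) \<bullet> (M *v perp f) = det M" using f
    by (simp add: det_mult_perp dot_square_norm)
  moreover have "\<bar>perp p \<bullet> q\<bar> = norm p * norm q" if "p \<bullet> q = 0" for p q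
  proof -
    have "(norm p * norm q)\<^sup>2 = (p \<bullet> q)\<^sup>2 + (perp p \<bullet> q)\<^sup>2"
      unfolding power_mult_distrib norm_real2 inner_real2 by (simp add: power2_eq_square algebra_simps)
    then have "(norm p * norm q)\<^sup>2 = \<bar>perp p \<bullet> q\<bar>\<^sup>2" using that by simp
    then show ?thesis by (metis abs_ge_zero mult_nonneg_nonneg norm_ge_zero power2_eq_iff_nonneg)
  qed
  ultimately show "\<alpha>1 M * \<alpha>2 M = \<bar>det M\<bar>" using o a by metis
  have 1: "(f$1)\<^sup>2 + (f$2)\<^sup>2 = 1" using f norm_real2[of f] by simp
  have "(norm M)\<^sup>2 = (norm (M$1))\<^sup>2 + (norm (M$2))\<^sup>2"
    by (simp add: power2_norm_eq_inner inner_vec_def sum_2)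
  also have "\<dots> = ((norm (M$1))\<^sup>2 + (norm (M$2))\<^sup>2) * ((f$1)\<^sup>2 + (f$2)\<^sup>2)" by (simp add: 1)
  also have "\<dots> = (norm (M *v f))\<^sup>2 + (norm (M *v perp f))\<^sup>2"
    unfolding norm_real2 mat_vec_nth2 perp_nth by (simp add: power2_eq_square algebra_simps)
  finally show "(\<alpha>1 M)\<^sup>2 + (\<alpha>2 M)\<^sup>2 = (norm M)\<^sup>2" by (simp only: a)
qed

lemma singular_value_decomposition:
  fixes M :: "real^2^2"
  obtains f e e' where "norm f = 1" "norm e = 1" "e' = perp e \<or> e' = - perp e"
    "\<forall>v. e \<bullet> (M *v v) = \<alpha>1 M * (f \<bullet> v)" "\<forall>v. e' \<bullet> (M *v v) = \<alpha>2 M * (perp f \<bullet> v)"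
    "norm (M *v perp f) = \<alpha>2 M"
proof -
  obtain f where f: "norm f = 1" and o: "(M *v f) \<bullet> (M *v perp f) = 0" and a:
    "\<alpha>1 M = norm (M *v f)" "\<alpha>2 M = norm (M *v perp f)" and le: "\<And>v. norm (M *v v) \<le> norm (M *v f) * norm v"
    using singular_values_basis by blast
  define e where "e = (if \<alpha>1 M = 0 then axis 1 1 else (M *v f) /\<^sub>R norm (M *v f))"
  have e: "norm e = 1" "M *v f = \<alpha>1 M *\<^sub>R e"
    unfolding e_def using a by auto
  have "e \<bullet> (M *v perp f) = 0"
  proof (cases "\<alpha>1 M = 0")
    case True
    then have "M *v v = 0" for v using le a by simp
    then show ?thesis by simp
  next
    case False
    then show ?thesis using o e by simp
  qed
  then have ee: "e \<bullet> (M *v perp f) = 0" .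
  define p where "p = perp e \<bullet> (M *v perp f)"
  have p: "M *v perp f = p *\<^sub>R perp e"
    using perp_decomp(1)[OF e(1), of "M *v perp f"] ee by (simp add: p_def)
  then have pa: "\<bar>p\<bar> = \<alpha>2 M" using a e by simp
  define e' where "e' = (if p \<ge> 0 then perp e else - perp e)"
  have e': "norm e' = 1" "e \<bullet> e' = 0" "M *v perp f = \<alpha>2 M *\<^sub>R e'"
    using p pa e by (auto simp: e'_def simp flip: scaleR_minus_left)
  have dec: "M *v v = (f \<bullet> v) *\<^sub>R (\<alpha>1 M *\<^sub>R e) + (perp f \<bullet> v) *\<^sub>R (\<alpha>2 M *\<^sub>R e')" for v
    unfolding e(2)[symmetric] e'(3)[symmetric] matrix_vector_mult_scaleR[symmetric]
      matrix_vector_right_distrib[symmetric] using perp_decomp(1)[OF f, of v] by metis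
  show ?thesis
  proof (rule that[of f e e']; (intro allI)?)
    show "e' = perp e \<or> e' = - perp e" by (simp add: e'_def)
    show "e \<bullet> (M *v v) = \<alpha>1 M * (f \<bullet> v)" for v using e(1) e'(2) by (simp add: dec inner_add_right dot_square_norm)
    show "e' \<bullet> (M *v v) = \<alpha>2 M * (perp f \<bullet> v)" for v using e'(1,2)
      by (simp add: dec inner_add_right dot_square_norm inner_commute[of e'])
  qed (use f e e' in auto)
qed

text \<open>
  An explicit formula, from which the continuity of \<open>\<alpha>1\<close> can be read off.
\<close>

lemma \<alpha>1_formula:
  "\<alpha>1 M = (sqrt ((norm M)\<^sup>2 + 2 * \<bar>det M\<bar>) + sqrt ((norm M)\<^sup>2 - 2 * \<bar>det M\<bar>)) / 2"
proof -
  have "(norm M)\<^sup>2 + 2 * \<bar>det M\<bar> = (\<alpha>1 M + \<alpha>2 M)\<^sup>2" "(norm M)\<^sup>2 - 2 * \<bar>det M\<bar> = (\<alpha>1 M - \<alpha>2 M)\<^sup>2"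
    using \<alpha>1_mult_\<alpha>2[of M] \<alpha>_sumsq[of M] by (simp_all add: power2_sum power2_diff)
  then show ?thesis using \<alpha>2_le_\<alpha>1[of M] by simp
qed

lemma continuous_on_\<alpha>1 [continuous_intros]:
  "continuous_on S g \<Longrightarrow> continuous_on S (\<lambda>x. \<alpha>1 (g x))"
  unfolding \<alpha>1_formula det_2 by (intro continuous_intros) auto

lemma \<alpha>1_le_norm: "\<alpha>1 M \<le> norm M" and norm_le_2\<alpha>1: "norm M \<le> 2 * \<alpha>1 M"
proof -
  have "(\<alpha>1 M)\<^sup>2 \<le> (norm M)\<^sup>2" using \<alpha>_sumsq[of M] by (metis le_add_same_cancel1 zero_le_power2)
  then show "\<alpha>1 M \<le> norm M" by (meson norm_ge_zero power2_le_imp_le)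
  have "(norm M)\<^sup>2 \<le> (\<alpha>1 M)\<^sup>2 + (\<alpha>1 M)\<^sup>2" using \<alpha>_sumsq[of M] power_mono[OF \<alpha>2_le_\<alpha>1[of M] \<alpha>2_nonneg, of 2] by linarith
  also have "\<dots> \<le> (2 * \<alpha>1 M)\<^sup>2" by (simp add: power_mult_distrib)
  finally show "norm M \<le> 2 * \<alpha>1 M" using \<alpha>1_nonneg[of M] by (auto intro: power2_le_imp_le)
qed

lemma \<alpha>1_leI: "(\<And>v. norm v = 1 \<Longrightarrow> norm (M *v v) \<le> c) \<Longrightarrow> \<alpha>1 M \<le> c"
  using singular_values_basis[of M] by metis

lemma \<alpha>1_mult_le: "\<alpha>1 (M ** K) \<le> \<alpha>1 M * \<alpha>1 K"
proof (rule \<alpha>1_leI)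
  fix v :: "real^2" assume "norm v = 1"
  then show "norm ((M ** K) *v v) \<le> \<alpha>1 M * \<alpha>1 K"
    using norm_le_\<alpha>1[of M "K *v v"] mult_left_mono[OF norm_le_\<alpha>1[of K v] \<alpha>1_nonneg[of M]]
    by (simp add: matrix_vector_mul_assoc[symmetric])
qed

lemma \<alpha>1_eq_0_iff: "\<alpha>1 M = 0 \<longleftrightarrow> M = 0"
  proof
  assume "M = 0"
  then show "\<alpha>1 M = 0" using \<alpha>1_le_norm[of M] \<alpha>1_nonneg[of M] norm_zero by (metis order_antisym)
qed (use norm_le_2\<alpha>1[of M] in simp)

lemma det_scaleR2: "det (c *\<^sub>R M) = c\<^sup>2 * det M" for M :: "real^2^2"
  by (simp add: det_2 power2_eq_square algebra_simps)

lemma \<alpha>1_scaleR: "\<alpha>1 (c *\<^sub>R M) = \<bar>c\<bar> * \<alpha>1 M"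
proof -
  have "(norm (c *\<^sub>R M))\<^sup>2 + 2 * \<bar>det (c *\<^sub>R M)\<bar> = c\<^sup>2 * ((norm M)\<^sup>2 + 2 * \<bar>det M\<bar>)"
    "(norm (c *\<^sub>R M))\<^sup>2 - 2 * \<bar>det (c *\<^sub>R M)\<bar> = c\<^sup>2 * ((norm M)\<^sup>2 - 2 * \<bar>det M\<bar>)"
    by (simp_all add: det_scaleR2 abs_mult power_mult_distrib algebra_simps)
  then show ?thesis unfolding \<alpha>1_formula by (simp only: real_sqrt_mult real_sqrt_abs) (simp add: algebra_simps)
qed

lemma \<alpha>1_mat1 [simp]: "\<alpha>1 (mat 1) = 1" "\<alpha>2 (mat 1) = 1"
proof -
  obtain f where "norm f = 1" "\<alpha>1 (mat 1) = norm (mat 1 *v f)" "\<alpha>2 (mat 1) = norm (mat 1 *v perp f)"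
    using singular_values_basis[of "mat 1"] by metis
  then show "\<alpha>1 (mat 1) = 1" "\<alpha>2 (mat 1) = 1" by auto
qed

lemma \<alpha>2_le_norm: "\<alpha>2 M * norm v \<le> norm (M *v v)"
proof -
  obtain f e e' where s: "norm f = 1" "norm e = 1" "e' = perp e \<or> e' = - perp e"
    "\<forall>v. e \<bullet> (M *v v) = \<alpha>1 M * (f \<bullet> v)" "\<forall>v. e' \<bullet> (M *v v) = \<alpha>2 M * (perp f \<bullet> v)"
    using singular_value_decomposition by metis
  have "(\<alpha>2 M * norm v)\<^sup>2 = (\<alpha>2 M)\<^sup>2 * (f \<bullet> v)\<^sup>2 + (\<alpha>2 M)\<^sup>2 * (perp f \<bullet> v)\<^sup>2"
    unfolding power_mult_distrib perp_decomp(2)[OF s(1), of v] by (rule distrib_left)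
  also have "\<dots> \<le> (\<alpha>1 M)\<^sup>2 * (f \<bullet> v)\<^sup>2 + (\<alpha>2 M)\<^sup>2 * (perp f \<bullet> v)\<^sup>2"
    by (simp add: mult_right_mono power_mono \<alpha>2_le_\<alpha>1)
  also have "\<dots> = (e \<bullet> (M *v v))\<^sup>2 + (e' \<bullet> (M *v v))\<^sup>2" by (simp only: s(4,5) power_mult_distrib)
  also have "\<dots> = (norm (M *v v))\<^sup>2" using perp_decomp(2)[OF s(2), of "M *v v"] s(3) by auto
  finally show ?thesis by (rule power2_le_imp_le) simp
qed

lemma \<alpha>2_pos: "det M \<noteq> 0 \<Longrightarrow> 0 < \<alpha>2 M" and \<alpha>1_pos: "det M \<noteq> 0 \<Longrightarrow> 0 < \<alpha>1 M"
proof -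
  assume "det M \<noteq> 0"
  then have "\<alpha>1 M * \<alpha>2 M > 0" by (simp add: \<alpha>1_mult_\<alpha>2)
  then show "0 < \<alpha>2 M" "0 < \<alpha>1 M" using \<alpha>1_nonneg[of M] \<alpha>2_nonneg[of M]
    unfolding zero_less_mult_iff by linarith+
qed

lemma \<alpha>2_mult_ge: "\<alpha>2 M * \<alpha>2 K \<le> \<alpha>2 (M ** K)"
proof -
  obtain f where f: "norm f = 1" "\<alpha>2 (M ** K) = norm ((M ** K) *v perp f)"
    using singular_values_basis[of "M ** K"] by metis
  then show ?thesis
    using \<alpha>2_le_norm[of M "K *v perp f"] mult_left_mono[OF \<alpha>2_le_norm[of K "perp f"] \<alpha>2_nonneg[of M]]
    by (simp add: matrix_vector_mul_assoc[symmetric])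
qed

lemma \<alpha>1_mult_ge: "\<alpha>1 M * \<alpha>2 K \<le> \<alpha>1 (M ** K)" "\<alpha>2 M * \<alpha>1 K \<le> \<alpha>1 (M ** K)"
proof -
  obtain f where f: "norm f = 1" "\<alpha>1 K = norm (K *v f)" using singular_values_basis[of K] by metis
  have "\<alpha>2 M * \<alpha>1 K \<le> norm ((M ** K) *v f)"
    using \<alpha>2_le_norm[of M "K *v f"] f by (simp add: matrix_vector_mul_assoc[symmetric])
  then show "\<alpha>2 M * \<alpha>1 K \<le> \<alpha>1 (M ** K)" using norm_le_\<alpha>1[of "M ** K" f] f by simp
  show "\<alpha>1 M * \<alpha>2 K \<le> \<alpha>1 (M ** K)"
  proof (cases "\<alpha>2 K = 0")
    case False
    then have k: "det K \<noteq> 0" using \<alpha>1_mult_\<alpha>2[of K] \<alpha>2_le_\<alpha>1[of K] \<alpha>2_nonneg[of K]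
      by (metis abs_eq_0_iff mult_eq_0_iff order_antisym)
    obtain g where g: "norm g = 1" "\<alpha>1 M = norm (M *v g)" using singular_values_basis[of M] by metis
    define h where "h = (1 / det K) *\<^sub>R (adjugate K *v g)"
    have h: "K *v h = g" using k by (simp add: h_def mult_adjugate matrix_vector_mult_scaleR)
    have "\<alpha>2 K * norm h \<le> 1" using \<alpha>2_le_norm[of K h] h g by simp
    then have "\<alpha>1 M * (\<alpha>2 K * norm h) \<le> \<alpha>1 (M ** K) * norm h"
      using norm_le_\<alpha>1[of "M ** K" h] h g mult_left_mono[of "\<alpha>2 K * norm h" 1 "\<alpha>1 M"]
      by (simp add: matrix_vector_mul_assoc[symmetric])
    moreover have "norm h > 0" using h g by auto
    ultimately show ?thesis by (metis mult.assoc mult_le_cancel_right_pos)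
  qed simp
qed

section \<open>Products of matrices with uniform exponential growth\<close>

definition mprod :: "(real^2^2) list \<Rightarrow> real^2^2" where
  "mprod ms = foldr (**) ms (mat 1)"

lemma mprod_simps [simp]: "mprod [] = mat 1" "mprod (M # ms) = M ** mprod ms"
  by (simp_all add: mprod_def)

lemma mprod_append [simp]: "mprod (us @ vs) = mprod us ** mprod vs"
  by (induction us) (simp_all add: matrix_mul_assoc)

text \<open>
  Split \<open>B v\<close> along \<open>B x\<close> and its orthogonal complement: the orthogonal component is controlled by the
  area form, hence by \<open>det B\<close>.
\<close>

lemma \<alpha>1_mult_le_orbit:
  assumes "B *v x \<noteq> 0"
  shows "\<alpha>1 (A ** B) \<le> \<alpha>1 B * (norm (A *v (B *v x)) / norm (B *v x))
            + \<alpha>1 A * (\<bar>det B\<bar> * norm x / norm (B *v x))"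
proof (rule \<alpha>1_leI)
  fix v :: "real^2" assume v: "norm v = 1"
  define g where "g = (B *v x) /\<^sub>R norm (B *v x)"
  have g: "norm g = 1" using assms by (simp add: g_def)
  have "\<bar>g \<bullet> (B *v v)\<bar> \<le> \<alpha>1 B"
    using Cauchy_Schwarz_ineq2[of g "B *v v"] norm_le_\<alpha>1[of B v] v g by simp
  moreover have Ag: "norm (A *v g) = norm (A *v (B *v x)) / norm (B *v x)"
    by (simp add: g_def matrix_vector_mult_scaleR divide_inverse mult.commute)
  ultimately have 1: "norm ((g \<bullet> (B *v v)) *\<^sub>R (A *v g)) \<le> \<alpha>1 B * (norm (A *v (B *v x)) / norm (B *v x))"
    by (simp add: mult_right_mono divide_right_mono)
  have "\<bar>perp x \<bullet> v\<bar> \<le> norm x" using Cauchy_Schwarz_ineq2[of "perp x" v] v by simp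
  then have "\<bar>det B\<bar> * \<bar>perp x \<bullet> v\<bar> / norm (B *v x) \<le> \<bar>det B\<bar> * norm x / norm (B *v x)"
    by (simp add: mult_left_mono divide_right_mono)
  moreover have "\<bar>perp g \<bullet> (B *v v)\<bar> = \<bar>det B\<bar> * \<bar>perp x \<bullet> v\<bar> / norm (B *v x)"
    by (simp add: g_def perp_scaleR det_mult_perp abs_mult divide_inverse mult_ac)
  moreover have "norm (A *v perp g) \<le> \<alpha>1 A" using norm_le_\<alpha>1[of A "perp g"] g by simp
  ultimately have "norm ((perp g \<bullet> (B *v v)) *\<^sub>R (A *v perp g)) \<le> (\<bar>det B\<bar> * norm x / norm (B *v x)) * \<alpha>1 A"
    unfolding norm_scaleR by (intro mult_mono) auto
  moreover have "(A ** B) *v v = (g \<bullet> (B *v v)) *\<^sub>R (A *v g) + (perp g \<bullet> (B *v v)) *\<^sub>R (A *v perp g)"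
    unfolding matrix_vector_mult_scaleR[symmetric] matrix_vector_right_distrib[symmetric]
      perp_decomp(1)[OF g, of "B *v v", symmetric] by (simp add: matrix_vector_mul_assoc)
  ultimately show "norm ((A ** B) *v v) \<le> \<alpha>1 B * (norm (A *v (B *v x)) / norm (B *v x))
            + \<alpha>1 A * (\<bar>det B\<bar> * norm x / norm (B *v x))"
    using 1 by (simp add: mult.commute[of "\<alpha>1 A"] norm_triangle_mono)
qed

text \<open>
  After division by \<open>\<surd>\<bar>det A_i\<bar>\<close>, domination becomes exponential growth of the norms of all products: if
  \<open>\<bar>det M\<bar> = 1\<close>, then \<open>(\<alpha>1 M)\<^sup>2 = \<alpha>1 M / \<alpha>2 M\<close>.
\<close>

locale unimodular_growth =
  fixes \<G> :: "(real^2^2) set" and L c l :: real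
  assumes unimodular: "M \<in> \<G> \<Longrightarrow> \<bar>det M\<bar> = 1"
    and bounded: "M \<in> \<G> \<Longrightarrow> \<alpha>1 M \<le> L"
    and L1: "1 \<le> L" and c: "c > 0" and l: "l > 1"
    and growth: "set ms \<subseteq> \<G> \<Longrightarrow> c * l ^ length ms \<le> \<alpha>1 (mprod ms)"
begin

lemma mprod_unimodular: "set ms \<subseteq> \<G> \<Longrightarrow> \<bar>det (mprod ms)\<bar> = 1"
  by (induction ms) (auto simp: det_mul abs_mult unimodular)

lemma mprod_det_nz: "set ms \<subseteq> \<G> \<Longrightarrow> det (mprod ms) \<noteq> 0"
  using mprod_unimodular by force

lemma \<alpha>2_unimodular: "\<bar>det M\<bar> = 1 \<Longrightarrow> \<alpha>2 M = 1 / \<alpha>1 M"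
  using \<alpha>1_mult_\<alpha>2[of M] by (metis mult_zero_left nonzero_mult_div_cancel_left zero_neq_one)

lemma norm_ge_generator: "M \<in> \<G> \<Longrightarrow> norm v / L \<le> norm (M *v v)"
proof -
  assume M: "M \<in> \<G>"
  have "1 / L \<le> \<alpha>2 M"
    using bounded[OF M] \<alpha>2_unimodular[OF unimodular[OF M]] \<alpha>1_pos[of M] unimodular[OF M]
    by (auto intro!: divide_left_mono mult_pos_pos simp: L1 order.strict_trans2[OF zero_less_one])
  then have "1 / L * norm v \<le> \<alpha>2 M * norm v" by (rule mult_right_mono) simp
  with \<alpha>2_le_norm[of M v] show ?thesis by simp
qed

lemma norm_le_generator: "M \<in> \<G> \<Longrightarrow> norm (M *v v) \<le> L * norm v"
  using norm_le_\<alpha>1[of M v] mult_right_mono[OF bounded[of M], of "norm v"] by simp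

lemma mprod_nz:
  assumes "set ms \<subseteq> \<G>" "v \<noteq> 0"
  shows "mprod ms *v v \<noteq> 0"
proof -
  have "0 < \<alpha>2 (mprod ms) * norm v" using \<alpha>2_pos[OF mprod_det_nz[OF assms(1)]] assms(2) by simp
  then show ?thesis using \<alpha>2_le_norm[of "mprod ms" v] by auto
qed

lemma mprod_solve:
  assumes "set ms \<subseteq> \<G>"
  obtains y where "mprod ms *v y = x"
  using mult_adjugate(1)[of "mprod ms" "(1 / det (mprod ms)) *\<^sub>R x"] mprod_det_nz[OF assms] that by simp

lemma norm_mprod_ge:
  "set ms \<subseteq> \<G> \<Longrightarrow> norm v / L ^ length ms \<le> norm (mprod ms *v v)"
proof (induction ms)
  case (Cons M ms)
  have "norm v / L ^ length (M # ms) = (norm v / L ^ length ms) / L" by (simp add: field_simps)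
  also have "\<dots> \<le> norm (mprod ms *v v) / L" using Cons L1 by (intro divide_right_mono) auto
  also have "\<dots> \<le> norm (mprod (M # ms) *v v)"
    using norm_ge_generator[of M "mprod ms *v v"] Cons by (simp add: matrix_vector_mul_assoc)
  finally show ?case .
qed simp

text \<open>
  A product is not much larger than what it does to the orbit of a single vector. This is
  \<open>\<alpha>1_mult_le_orbit\<close>, iterated: divided by the length of the current vector of the orbit, the norm grows
  at each step at most by a multiple of \<open>norm y\<close> divided by the square of that length.
\<close>

lemma \<alpha>1_mprod_le_orbit_sum:
  assumes "y \<noteq> 0" "set ms \<subseteq> \<G>"
  shows "\<alpha>1 (mprod ms) \<le> L\<^sup>2 * norm (mprod ms *v y) * norm y
           * (\<Sum>j\<le>length ms. 1 / (norm (mprod (drop j ms) *v y))\<^sup>2)"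
  using assms(2)
proof (induction ms)
  case Nil
  have "1 \<le> L\<^sup>2" using L1 by simp
  then show ?case using assms(1) by (simp add: power2_eq_square)
next
  case (Cons M ms)
  let ?P = "mprod ms" and ?S = "\<Sum>j\<le>length ms. 1 / (norm (mprod (drop j ms) *v y))\<^sup>2"
  have M: "M \<in> \<G>" and ms: "set ms \<subseteq> \<G>" using Cons.prems by auto
  define p q n where "p = norm (?P *v y)" and "q = norm (M *v (?P *v y))" and "n = norm y"
  have nz: "?P *v y \<noteq> 0" "mprod (M # ms) *v y \<noteq> 0"
    using mprod_nz[OF ms assms(1)] mprod_nz[OF Cons.prems assms(1)] by blast+
  then have pos: "p > 0" "q > 0" "n > 0" using assms(1)
    by (auto simp: p_def q_def n_def matrix_vector_mul_assoc)
  have "\<alpha>1 (M ** ?P) \<le> \<alpha>1 ?P * (q / p) + \<alpha>1 M * (1 * n / p)"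
    using \<alpha>1_mult_le_orbit[OF nz(1), of M] mprod_unimodular[OF ms] by (simp add: p_def q_def n_def)
  also have "\<dots> \<le> (L\<^sup>2 * p * n * ?S) * (q / p) + L * (1 * n / p)"
    using Cons.IH[OF ms] pos bounded[OF M] unfolding p_def[symmetric] n_def[symmetric]
    by (intro add_mono mult_right_mono) auto
  also have "(L\<^sup>2 * p * n * ?S) * (q / p) = L\<^sup>2 * q * n * ?S" using pos by simp
  also have "L * (1 * n / p) \<le> L\<^sup>2 * q * n * (1 / q\<^sup>2)"
  proof -
    have "q \<le> L * p" using norm_le_generator[OF M] by (simp add: p_def q_def)
    then have "1 / p \<le> L / q" using pos by (simp add: field_simps)
    then have "(L * n) * (1 / p) \<le> (L * n) * (L / q)" using pos L1 by (intro mult_left_mono) auto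
    then show ?thesis using pos by (simp add: power2_eq_square field_simps)
  qed
  finally have "\<alpha>1 (M ** ?P) \<le> L\<^sup>2 * q * n * (1 / q\<^sup>2 + ?S)" by (simp add: algebra_simps)
  also have "1 / q\<^sup>2 + ?S = (\<Sum>j\<le>length (M # ms). 1 / (norm (mprod (drop j (M # ms)) *v y))\<^sup>2)"
    unfolding length_Cons by (subst sum.atMost_Suc_shift) (simp add: q_def matrix_vector_mul_assoc)
  finally show ?case by (simp add: q_def n_def matrix_vector_mul_assoc)
qed

text \<open>
  If a vector were contracted by a very small factor both in forward and in backward time, then along
  a shortest piece of orbit with this property all lengths would be at least those at the two ends, up to
  the factor \<open>L\<close>. So \<open>\<alpha>1_mprod_le_orbit_sum\<close> would bound the norm of a long product linearly in its
  length, against the exponential growth.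
\<close>

lemma no_two_sided_contraction:
  obtains \<epsilon> where "\<epsilon> > 0"
    "\<forall>us vs x y. set us \<subseteq> \<G> \<and> set vs \<subseteq> \<G> \<and> x \<noteq> 0 \<and> mprod vs *v y = x \<longrightarrow>
       \<epsilon> * norm x < norm (mprod us *v x) \<or> \<epsilon> * norm x < norm y"
proof -
  have "(\<lambda>n. L ^ 4 * (real n / l ^ n + 1 / l ^ n)) \<longlonglongrightarrow> L ^ 4 * (0 + 0)"
    using l by (intro tendsto_intros lim_n_over_pown LIMSEQ_inverse_realpow_zero[unfolded inverse_eq_divide]) auto
  then have "eventually (\<lambda>n. L ^ 4 * (real n / l ^ n + 1 / l ^ n) < c) sequentially"
    using order_tendstoD(2)[of _ "L ^ 4 * (0 + 0)" sequentially c] c by simp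
  then obtain n0 where n0: "\<And>n. n \<ge> n0 \<Longrightarrow> L ^ 4 * (real n / l ^ n + 1 / l ^ n) < c"
    by (auto simp: eventually_sequentially)
  have n0': "L ^ 4 * (real n + 1) < c * l ^ n" if "n \<ge> n0" for n
    using n0[OF that] l by (simp add: field_simps)
  \<comment> \<open>A product of \<open>n\<close> matrices contracts at most by \<open>L ^ n\<close>, so the factor \<open>\<epsilon>\<close> forces length above \<open>n0\<close>.\<close>
  define \<epsilon> where "\<epsilon> = 1 / (2 * L ^ n0)"
  have Lp: "L ^ n > 0" for n using L1 by (intro zero_less_power) simp
  have \<epsilon>: "\<epsilon> > 0" "\<epsilon> < 1" "\<epsilon> * L ^ n0 < 1"
    using Lp[of n0] one_le_power[OF L1, of n0] by (simp_all add: \<epsilon>_def field_simps)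
  have "False" if "set us \<subseteq> \<G>" "set vs \<subseteq> \<G>" "x \<noteq> 0" "mprod vs *v y = x"
      "norm (mprod us *v x) \<le> \<epsilon> * norm x" "norm y \<le> \<epsilon> * norm x" for us vs x y
    using that
  proof (induction "length us + length vs" arbitrary: us vs y rule: less_induct)
    case less
    note us = less.prems(1) and vs = less.prems(2) and x = less.prems(3) and y = less.prems(4)
    have xy: "\<epsilon> * norm x < norm x" using \<epsilon> x by simp
    have une: "us \<noteq> []" using less.prems(5) xy by auto
    have vne: "vs \<noteq> []" using less.prems(6) y xy by auto
    have y0: "y \<noteq> 0" using x y by auto
    let ?w = "us @ vs" and ?h = "\<epsilon> * norm x"
    have h: "?h > 0" using \<epsilon> x by simp
    have hL: "?h / L \<le> ?h" using h L1 divide_left_mono[of 1 L ?h] by simp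
    have fwd: "?h < norm (mprod (drop j us) *v x)" if "j \<noteq> 0" for j
    proof (rule ccontr)
      assume "\<not> ?thesis"
      then show False
        using less.hyps[of "drop j us" vs y] set_drop_subset[of j us] less.prems une that by auto
    qed
    have bwd: "?h < norm (mprod (drop j vs) *v y)" if "j < length vs" for j
    proof (rule ccontr)
      assume "\<not> ?thesis"
      moreover have "mprod (take j vs) *v (mprod (drop j vs) *v y) = x"
        unfolding matrix_vector_mul_assoc mprod_append[symmetric] using y by simp
      ultimately show False
        using less.hyps[of us "take j vs" "mprod (drop j vs) *v y"] set_take_subset[of j vs] less.prems that
        by auto
    qed
    have ge: "?h / L \<le> norm (mprod (drop j ?w) *v y)" for j
    proof -
      consider "j = 0" | "j \<noteq> 0" "j < length us" | "j \<ge> length us" "j < length ?w" | "j \<ge> length ?w" by linarith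
      then show ?thesis
      proof cases
        case 1
        have "?h / L \<le> norm (mprod (drop 1 us) *v x) / L" using fwd[of 1] L1 by (intro divide_right_mono) auto
        also have "\<dots> \<le> norm (hd us *v (mprod (drop 1 us) *v x))"
          using une us by (intro norm_ge_generator) auto
        also have "hd us *v (mprod (drop 1 us) *v x) = mprod us *v x"
          using une by (cases us) (simp_all add: matrix_vector_mul_assoc)
        finally show ?thesis using 1 y by (simp add: matrix_vector_mul_assoc[symmetric])
      next
        case 2
        then show ?thesis using fwd[of j] y hL by (simp add: matrix_vector_mul_assoc[symmetric])
      next
        case 3
        then have "?h < norm (mprod (drop (j - length us) vs) *v y)" by (intro bwd) simp
        then show ?thesis using 3 hL by simp
      next
        case 4
        let ?k = "length vs - 1"
        have "drop ?k vs = [last vs]" using vne by (metis append_butlast_last_id append_eq_conv_conj length_butlast)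
        then have "?h < norm (last vs *v y)" using bwd[of ?k] vne by simp
        also have "\<dots> \<le> L * norm y" using vne vs by (intro norm_le_generator) auto
        finally show ?thesis using 4 L1 by (simp add: field_simps)
      qed
    qed
    let ?n = "length ?w"
    have "(\<Sum>j\<le>?n. 1 / (norm (mprod (drop j ?w) *v y))\<^sup>2) \<le> (\<Sum>j\<le>?n. 1 / (?h / L)\<^sup>2)"
    proof (intro sum_mono divide_left_mono power_mono ge mult_pos_pos zero_less_power)
      have "0 < ?h / L" using h L1 by simp
      then show "0 < norm (mprod (drop j ?w) *v y)" "0 < ?h / L" "0 \<le> ?h / L" for j
        using ge[of j] by (linarith+)
    qed simp
    then have sum: "(\<Sum>j\<le>?n. 1 / (norm (mprod (drop j ?w) *v y))\<^sup>2) \<le> (real ?n + 1) * (L\<^sup>2 / ?h\<^sup>2)"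
      by (simp add: power_divide add.commute add.left_commute)
    have "c * l ^ ?n \<le> \<alpha>1 (mprod ?w)" using us vs by (intro growth) auto
    also have "\<dots> \<le> L\<^sup>2 * norm (mprod ?w *v y) * norm y * (\<Sum>j\<le>?n. 1 / (norm (mprod (drop j ?w) *v y))\<^sup>2)"
      using us vs y0 by (intro \<alpha>1_mprod_le_orbit_sum) auto
    also have "\<dots> \<le> L\<^sup>2 * ?h * ?h * ((real ?n + 1) * (L\<^sup>2 / ?h\<^sup>2))"
      using less.prems(4,5,6) h sum
      by (intro mult_mono) (auto simp: matrix_vector_mul_assoc[symmetric] intro!: sum_nonneg)
    also have "\<dots> = L ^ 4 * (real ?n + 1)"
    proof -
      have "\<epsilon> \<noteq> 0" "norm x \<noteq> 0" using \<epsilon> x by auto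
      then show ?thesis by (simp add: power2_eq_square power4_eq_xxxx)
    qed
    finally have "?n < n0" using n0'[of ?n] by linarith
    then have "length us \<le> n0" by simp
    then have "L ^ length us \<le> L ^ n0" using L1 by (intro power_increasing)
    moreover have "norm x / L ^ length us \<le> \<epsilon> * norm x"
      using norm_mprod_ge[OF us, of x] less.prems(5) by linarith
    then have "norm x \<le> (\<epsilon> * L ^ length us) * norm x" using Lp[of "length us"] by (simp add: field_simps)
    then have "1 \<le> \<epsilon> * L ^ length us" using x by simp
    ultimately show False using \<epsilon> mult_left_mono[of "L ^ length us" "L ^ n0" \<epsilon>] by linarith
  qed
  then show ?thesis using that[of \<epsilon>] \<epsilon> by (meson not_less)
qed

text \<open>
  Let \<open>x\<close> be the unit vector that \<open>us\<close> contracts most, and let \<open>vs\<close> map \<open>y\<close> to \<open>x\<close>. If the product of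
  \<open>us\<close> is large, \<open>x\<close> is strongly contracted in forward time, so by \<open>no_two_sided_contraction\<close> its
  backward orbit stays away from \<open>0\<close>. Inserting this in \<open>\<alpha>1_mprod_le_orbit_sum\<close> shows first that the
  backward orbit grows exponentially and then that \<open>norm y\<close> is comparable to the norm of the product of
  \<open>vs\<close>. Because areas are preserved, a unit vector orthogonal to \<open>y\<close> is mapped by \<open>vs\<close> to a vector
  whose component orthogonal to \<open>x\<close> has length \<open>norm y\<close>; this is the component that \<open>us\<close> expands most.
\<close>

lemma \<alpha>1_mprod_almost_multiplicative:
  obtains d where "d > 0" "\<forall>us vs. set us \<subseteq> \<G> \<and> set vs \<subseteq> \<G> \<longrightarrow>
     d * \<alpha>1 (mprod us) * \<alpha>1 (mprod vs) \<le> \<alpha>1 (mprod us ** mprod vs)"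
proof -
  obtain \<epsilon> where \<epsilon>: "\<epsilon> > 0" and dip: "\<forall>us vs x y. set us \<subseteq> \<G> \<and> set vs \<subseteq> \<G> \<and> x \<noteq> 0 \<and> mprod vs *v y = x \<longrightarrow>
       \<epsilon> * norm x < norm (mprod us *v x) \<or> \<epsilon> * norm x < norm y"
    by (rule no_two_sided_contraction)
  let ?m = "sqrt l"
  have m: "?m > 1" using l by simp
  have "(\<lambda>n. real n / ?m ^ n + 1 / ?m ^ n) \<longlonglongrightarrow> 0 + 0"
    using m by (intro tendsto_intros lim_n_over_pown LIMSEQ_inverse_realpow_zero[unfolded inverse_eq_divide]) auto
  then have "Bseq (\<lambda>n. real n / ?m ^ n + 1 / ?m ^ n)" by (intro convergent_imp_Bseq) (auto simp: convergent_def)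
  then obtain B where B: "B > 0" "\<And>n. norm (real n / ?m ^ n + 1 / ?m ^ n) \<le> B" by (auto elim: BseqE)
  \<comment> \<open>Half of the exponential growth absorbs the linear factor from the first use of the orbit sum.\<close>
  have lin: "real n + 1 \<le> B * ?m ^ n" for n
  proof -
    have "real n / ?m ^ n + 1 / ?m ^ n \<le> B" using B(2)[of n] by simp
    then have "(real n + 1) / ?m ^ n \<le> B" by (simp add: add_divide_distrib)
    then show ?thesis using m by (subst (asm) pos_divide_le_eq) auto
  qed
  define K where "K = (L\<^sup>2 * B / (\<epsilon>\<^sup>2 * c))\<^sup>2"
  define S where "S = (\<Sum>j. K * (1 / l) ^ j)"
  have summ: "summable (\<lambda>j. K * (1 / l) ^ j)" using l by (intro summable_mult summable_geometric) auto
  have K: "K > 0" using L1 B \<epsilon> c by (auto simp: K_def)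
  have S: "S > 0" unfolding S_def using summ K l by (intro suminf_pos) auto
  define d where "d = min (\<epsilon>\<^sup>2) (1 / (L\<^sup>2 * S))"
  have d: "d > 0" using \<epsilon> S L1 by (auto simp: d_def)
  have "d * \<alpha>1 (mprod us) * \<alpha>1 (mprod vs) \<le> \<alpha>1 (mprod us ** mprod vs)"
    if us: "set us \<subseteq> \<G>" and vs: "set vs \<subseteq> \<G>" for us vs
  proof -
    let ?a = "\<alpha>1 (mprod us)" and ?b = "\<alpha>1 (mprod vs)"
    have ab: "?a > 0" "?b > 0" using \<alpha>1_pos mprod_det_nz us vs by blast+
    show ?thesis
    proof (cases "?a < 1 / \<epsilon>")
      case True
      have "\<epsilon> * ?a < 1" using True \<epsilon> by (simp add: field_simps)
      then have "(\<epsilon> * ?a)\<^sup>2 \<le> 1\<^sup>2" using ab \<epsilon> by (intro power_mono) auto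
      then have "\<epsilon>\<^sup>2 * ?a \<le> 1 / ?a" using ab by (simp add: field_simps power2_eq_square)
      moreover have "d * ?a \<le> \<epsilon>\<^sup>2 * ?a" using ab by (intro mult_right_mono) (auto simp: d_def)
      ultimately have "d * ?a \<le> 1 / ?a" by linarith
      then have "d * ?a * ?b \<le> (1 / ?a) * ?b" using ab by (intro mult_right_mono) auto
      also have "1 / ?a = \<alpha>2 (mprod us)" using \<alpha>2_unimodular mprod_unimodular us by simp
      finally show ?thesis using \<alpha>1_mult_ge(2)[of "mprod us" "mprod vs"] by linarith
    next
      case False
      obtain f e e' where f: "norm f = 1" "norm e = 1" "e' = perp e \<or> e' = - perp e"
        "\<forall>v. e \<bullet> (mprod us *v v) = ?a * (f \<bullet> v)" "norm (mprod us *v perp f) = \<alpha>2 (mprod us)"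
        using singular_value_decomposition by metis
      define x where "x = perp f"
      have x: "norm x = 1" "x \<noteq> 0" using f by (auto simp: x_def)
      have "1 / ?a \<le> \<epsilon>" using False \<epsilon> ab by (simp add: field_simps)
      then have xs: "norm (mprod us *v x) \<le> \<epsilon> * norm x"
        using f(5) x \<alpha>2_unimodular[OF mprod_unimodular[OF us]] by (simp add: x_def)
      obtain y where y: "mprod vs *v y = x" using mprod_solve[OF vs] by blast
      have y0: "y \<noteq> 0" using y x by auto
      define h where "h = (\<lambda>j. norm (mprod (drop j vs) *v y))"
      have tk: "mprod (take j vs) *v (mprod (drop j vs) *v y) = x" for j
        unfolding matrix_vector_mul_assoc mprod_append[symmetric] using y by simp
      have h\<epsilon>: "h j > \<epsilon>" for j
        using dip[rule_format, of us "take j vs" x "mprod (drop j vs) *v y"] us vs x xs tk[of j]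
          set_take_subset[of j vs] by (auto simp: h_def)
      have orb: "\<alpha>1 (mprod (take k vs)) \<le> L\<^sup>2 * h k * (\<Sum>j\<le>k. 1 / (h j)\<^sup>2)" if k: "k \<le> length vs" for k
      proof -
        let ?z = "mprod (drop k vs) *v y"
        have "mprod (drop j (take k vs)) *v ?z = mprod (drop j vs) *v y" if "j \<le> k" for j
        proof -
          have "drop j (take k vs) @ drop k vs = drop j vs"
            using that k by (metis append_take_drop_id diff_is_0_eq drop0 drop_append length_take min.absorb2)
          then show ?thesis unfolding matrix_vector_mul_assoc mprod_append[symmetric] by simp
        qed
        moreover have "?z \<noteq> 0" using mprod_nz y0 vs set_drop_subset[of k vs] by blast
        ultimately show ?thesis
          using \<alpha>1_mprod_le_orbit_sum[of ?z "take k vs"] k vs set_take_subset[of k vs]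
          by (simp add: tk x h_def)
      qed
      have hj: "1 / (h k)\<^sup>2 \<le> K * (1 / l) ^ k" if k: "k \<le> length vs" for k
      proof -
        have "set (take k vs) \<subseteq> \<G>" using vs set_take_subset[of k vs] by blast
        then have "c * l ^ k \<le> \<alpha>1 (mprod (take k vs))" using growth[of "take k vs"] k by simp
        also have "\<dots> \<le> L\<^sup>2 * h k * (\<Sum>j\<le>k. 1 / (h j)\<^sup>2)" by (rule orb[OF k])
        also have "\<dots> \<le> L\<^sup>2 * h k * (\<Sum>j\<le>k. 1 / \<epsilon>\<^sup>2)"
          using \<epsilon> order.strict_trans[OF \<epsilon> h\<epsilon>] less_imp_le[OF h\<epsilon>]
          by (intro mult_left_mono sum_mono divide_left_mono power_mono mult_pos_pos zero_less_power)
            (auto simp: less_imp_le)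
        also have "\<dots> = L\<^sup>2 * h k / \<epsilon>\<^sup>2 * (real k + 1)" by simp
        also have "\<dots> \<le> L\<^sup>2 * h k / \<epsilon>\<^sup>2 * (B * ?m ^ k)"
          by (intro mult_left_mono lin) (simp add: h_def)
        finally have "c * l ^ k \<le> (L\<^sup>2 * h k / \<epsilon>\<^sup>2 * B) * ?m ^ k" by (simp add: mult_ac)
        moreover have "l ^ k = ?m ^ k * ?m ^ k"
          using l by (simp add: power_mult_distrib[symmetric])
        ultimately have "(c * ?m ^ k) * ?m ^ k \<le> (L\<^sup>2 * h k / \<epsilon>\<^sup>2 * B) * ?m ^ k" by (simp add: mult_ac)
        then have "c * ?m ^ k \<le> L\<^sup>2 * h k / \<epsilon>\<^sup>2 * B" using m by (subst (asm) mult_le_cancel_right_pos) auto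
        moreover have hk: "h k > 0" using h\<epsilon>[of k] \<epsilon> by simp
        ultimately have "1 / h k \<le> (L\<^sup>2 * B / (\<epsilon>\<^sup>2 * c)) * (1 / ?m ^ k)"
          using c \<epsilon> m by (simp add: field_simps)
        then have "(1 / h k)\<^sup>2 \<le> ((L\<^sup>2 * B / (\<epsilon>\<^sup>2 * c)) * (1 / ?m ^ k))\<^sup>2"
          using hk by (intro power_mono) auto
        also have "\<dots> = K * (1 / (?m ^ k)\<^sup>2)" by (simp add: K_def power_mult_distrib power_divide)
        also have "(?m ^ k)\<^sup>2 = l ^ k" using \<open>l ^ k = _\<close> by (simp add: power2_eq_square)
        finally show ?thesis by (simp add: power_divide)
      qed
      have "?b \<le> L\<^sup>2 * h (length vs) * (\<Sum>j\<le>length vs. 1 / (h j)\<^sup>2)" using orb[of "length vs"] by simp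
      also have "(\<Sum>j\<le>length vs. 1 / (h j)\<^sup>2) \<le> (\<Sum>j\<le>length vs. K * (1 / l) ^ j)"
        by (intro sum_mono hj) simp
      also have "\<dots> \<le> S" unfolding S_def using K l by (intro sum_le_suminf summ) auto
      finally have "?b \<le> L\<^sup>2 * norm y * S" by (simp add: h_def mult_left_mono)
      then have "(1 / (L\<^sup>2 * S)) * ?b \<le> norm y" using S L1 by (simp add: field_simps)
      moreover have "d * ?b \<le> (1 / (L\<^sup>2 * S)) * ?b" using ab by (intro mult_right_mono) (auto simp: d_def)
      ultimately have yb: "d * ?b \<le> norm y" by linarith
      define z where "z = perp y /\<^sub>R norm y"
      have z: "norm z = 1" using y0 by (simp add: z_def)
      have "f \<bullet> (mprod vs *v z) = perp (mprod vs *v z) \<bullet> x" by (simp add: x_def inner_real2)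
      also have "\<dots> = det (mprod vs) * (perp z \<bullet> y)" unfolding y[symmetric] det_mult_perp by simp
      also have "perp z \<bullet> y = - norm y"
        using y0 by (simp add: z_def perp_scaleR dot_square_norm power2_eq_square)
      finally have "\<bar>f \<bullet> (mprod vs *v z)\<bar> = norm y" using mprod_unimodular[OF vs] by (simp add: abs_mult)
      then have "?a * norm y = \<bar>e \<bullet> (mprod us *v (mprod vs *v z))\<bar>" using f(4) ab by (simp add: abs_mult)
      also have "\<dots> \<le> norm ((mprod us ** mprod vs) *v z)"
        using Cauchy_Schwarz_ineq2[of e "mprod us *v (mprod vs *v z)"] f(2) by (simp add: matrix_vector_mul_assoc)
      also have "\<dots> \<le> \<alpha>1 (mprod us ** mprod vs)" using norm_le_\<alpha>1[of "mprod us ** mprod vs" z] z by simp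
      finally have "?a * norm y \<le> \<alpha>1 (mprod us ** mprod vs)" .
      moreover have "?a * (d * ?b) \<le> ?a * norm y" using mult_left_mono[OF yb] by simp
      moreover have "d * ?a * ?b = ?a * (d * ?b)" by simp
      ultimately show ?thesis by linarith
    qed
  qed
  then show ?thesis using that d by blast
qed

end

section \<open>Covering numbers, Assouad and Hausdorff dimension\<close>

lemma covering_number_le_iff:
  "ereal_of_enat (covering_number r S) \<le> ereal n \<longleftrightarrow>
     (\<exists>F. finite F \<and> S \<subseteq> (\<Union>c\<in>F. cball c r) \<and> real (card F) \<le> n)"
proof
  let ?A = "{F. finite F \<and> S \<subseteq> (\<Union>c\<in>F. cball c r)}" and ?f = "\<lambda>F :: 'a set. enat (card F)"
  assume le: "ereal_of_enat (covering_number r S) \<le> ereal n"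
  have "?A \<noteq> {}"
  proof
    assume e: "?A = {}"
    have "covering_number r S = \<infinity>" unfolding covering_number_def e by (simp add: top_enat_def)
    with le show False by simp
  qed
  then obtain G where "?f G \<in> ?f ` ?A" by blast
  then have "(LEAST x. x \<in> ?f ` ?A) \<in> ?f ` ?A" by (rule LeastI)
  then have "covering_number r S \<in> ?f ` ?A"
    using \<open>?A \<noteq> {}\<close> unfolding covering_number_def Inf_enat_def by (simp only: image_is_empty if_False)
  then obtain F where "F \<in> ?A" "covering_number r S = enat (card F)" by auto
  with le show "\<exists>F. finite F \<and> S \<subseteq> (\<Union>c\<in>F. cball c r) \<and> real (card F) \<le> n" by (intro exI[of _ F]) auto
next
  assume "\<exists>F. finite F \<and> S \<subseteq> (\<Union>c\<in>F. cball c r) \<and> real (card F) \<le> n"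
  then obtain F where F: "finite F" "S \<subseteq> (\<Union>c\<in>F. cball c r)" "real (card F) \<le> n" by auto
  then have "covering_number r S \<le> enat (card F)" unfolding covering_number_def by (intro INF_lower) simp
  then have "ereal_of_enat (covering_number r S) \<le> ereal_of_enat (enat (card F))"
    by (simp only: ereal_of_enat_le_iff)
  also have "\<dots> \<le> ereal n" using F by simp
  finally show "ereal_of_enat (covering_number r S) \<le> ereal n" .
qed

lemma finite_centered_cover:
  fixes E :: "'a::heine_borel set"
  assumes "bounded E" "e > 0"
  obtains F where "finite F" "F \<subseteq> E" "E \<subseteq> (\<Union>z\<in>F. cball z e)"
proof -
  have "compact (closure E)" using assms by (simp add: compact_closure)
  moreover have "closure E \<subseteq> (\<Union>z\<in>E. ball z e)"
    using assms(2) by (auto simp: closure_approachable dist_commute)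
  ultimately obtain F where "F \<subseteq> E" "finite F" "closure E \<subseteq> (\<Union>z\<in>F. ball z e)"
    using compactE_image[of "closure E" E "\<lambda>z. ball z e"] by auto
  moreover have "E \<subseteq> closure E" by (rule closure_subset)
  ultimately show ?thesis using that[of F] by (meson UN_mono ball_subset_cball order.trans order_refl)
qed

text \<open>
  A cover of \<open>S\<close> by balls with centres in \<open>E\<close>. The radii are measured in units of \<open>R\<close>; the lower bound
  \<open>m\<close> for them makes an iterated construction stop, the upper bound \<open>1/2\<close> makes it progress.
\<close>

definition relative_cover ::
  "'a::metric_space set \<Rightarrow> real \<Rightarrow> real \<Rightarrow> real \<Rightarrow> real \<Rightarrow> 'a set \<Rightarrow> bool" where
  "relative_cover E m s R v S \<longleftrightarrow> (\<exists>P. finite P \<and> P \<subseteq> E \<times> {m..1/2} \<and>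
     S \<subseteq> (\<Union>(z, \<rho>)\<in>P. cball z (\<rho> * R)) \<and> (\<Sum>(z, \<rho>)\<in>P. \<rho> powr s) \<le> v)"

text \<open>
  A bound for the Assouad dimension from a cover of relative size. The cover of a ball by smaller balls
  centred in the set can be iterated in each of the smaller balls, until the radii are comparable to the
  given \<open>r\<close>; as the sum of the \<open>s\<close>-th powers of the relative radii is at most \<open>1\<close>, the bound
  \<open>const * (R / r) powr s\<close> reproduces itself.
\<close>

lemma assouad_dim_leI:
  fixes E :: "'a::heine_borel set"
  assumes bE: "bounded E" and s: "s > 0" and R0: "R0 > 0" and m: "0 < m" "m \<le> 1"
    and cov: "\<And>y R. y \<in> E \<Longrightarrow> 0 < R \<Longrightarrow> R < R0 \<Longrightarrow>
       relative_cover E m s R 1 (E \<inter> cball y R)"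
  shows "assouad_dim E \<le> ereal s"
proof -
  \<comment> \<open>The iteration stops at radii in \<open>{m * r<..r}\<close>; the constant \<open>C\<close> makes the bound at least \<open>1\<close> there.\<close>
  define C where "C = m powr (- s)"
  have C: "C \<ge> 1" using m s unfolding C_def by (simp add: ge_one_powr_ge_zero powr_minus_divide powr_le1 le_divide_eq)
  have local: "\<exists>F. finite F \<and> E \<inter> cball y R \<subseteq> (\<Union>c\<in>F. cball c r) \<and> real (card F) \<le> C * (R / r) powr s"
    if "y \<in> E" "m * r < R" "R < R0" "r > 0" "R \<le> 2 ^ k * r" for y R r k
    using that
  proof (induction k arbitrary: y R rule: nat_less_induct)
    case (1 k)
    note IH = 1(1)[rule_format] and y = 1(2) and R = 1(3,4) and r = 1(5) and k = 1(6)
    have Rp: "R > 0" using m R r by (meson dual_order.strict_trans mult_pos_pos)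
    show ?case
    proof (cases "R \<le> r")
      case True
      have "1 = m powr (-s) * m powr s" using m by (simp add: powr_add[symmetric])
      also have "\<dots> \<le> C * (R / r) powr s"
        unfolding C_def using m R r s by (intro mult_left_mono powr_mono2) (auto simp: field_simps)
      finally show ?thesis using True by (intro exI[of _ "{y}"]) auto
    next
      case False
      then obtain j where j: "k = Suc j" using k by (cases k) auto
      obtain P where P: "finite P" "P \<subseteq> E \<times> {m..1/2}" "E \<inter> cball y R \<subseteq> (\<Union>(z, \<rho>)\<in>P. cball z (\<rho> * R))"
        "(\<Sum>(z, \<rho>)\<in>P. \<rho> powr s) \<le> 1"
        using cov[OF y Rp R(2)] unfolding relative_cover_def by blast
      have "\<exists>F. finite F \<and> E \<inter> cball z (\<rho> * R) \<subseteq> (\<Union>c\<in>F. cball c r) \<and> real (card F) \<le> C * (\<rho> * R / r) powr s"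
        if "(z, \<rho>) \<in> P" for z \<rho>
      proof (rule IH[of j])
        have \<rho>: "m \<le> \<rho>" "\<rho> \<le> 1/2" "z \<in> E" using P(2) that by auto
        show "j < k" "z \<in> E" "r > 0" using j \<rho> r by auto
        have "m * r < m * R" using False m by simp
        also have "\<dots> \<le> \<rho> * R" using \<rho> Rp by (intro mult_right_mono) auto
        finally show "m * r < \<rho> * R" .
        have half: "\<rho> * R \<le> 1/2 * R" using \<rho> Rp by (intro mult_right_mono) auto
        then show "\<rho> * R < R0" using Rp R by linarith
        show "\<rho> * R \<le> 2 ^ j * r" using half k j by simp
      qed
      then obtain G where G: "\<And>z \<rho>. (z, \<rho>) \<in> P \<Longrightarrow> finite (G (z, \<rho>))"
        "\<And>z \<rho>. (z, \<rho>) \<in> P \<Longrightarrow> E \<inter> cball z (\<rho> * R) \<subseteq> (\<Union>c\<in>G (z, \<rho>). cball c r)"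
        "\<And>z \<rho>. (z, \<rho>) \<in> P \<Longrightarrow> real (card (G (z, \<rho>))) \<le> C * (\<rho> * R / r) powr s"
        by (metis (no_types) old.prod.case)
      let ?F = "\<Union>p\<in>P. G p"
      have "real (card ?F) \<le> (\<Sum>p\<in>P. real (card (G p)))"
        unfolding of_nat_sum[symmetric] of_nat_le_iff using P(1) by (rule card_UN_le)
      also have "\<dots> \<le> (\<Sum>p\<in>P. C * (R / r) powr s * (case p of (z, \<rho>) \<Rightarrow> \<rho> powr s))"
      proof (rule sum_mono)
        fix p assume p: "p \<in> P"
        obtain z \<rho> where pz: "p = (z, \<rho>)" by (cases p)
        have "\<rho> \<ge> m" using p pz P(2) by auto
        then have "(\<rho> * R / r) powr s = \<rho> powr s * (R / r) powr s"
          using m Rp r by (subst powr_mult[symmetric]) auto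
        then show "real (card (G p)) \<le> C * (R / r) powr s * (case p of (z, \<rho>) \<Rightarrow> \<rho> powr s)"
          using G(3)[of z \<rho>] p pz by (simp add: mult_ac)
      qed
      also have "\<dots> = C * (R / r) powr s * (\<Sum>(z, \<rho>)\<in>P. \<rho> powr s)" by (simp add: sum_distrib_left)
      also have "\<dots> \<le> C * (R / r) powr s * 1" using P(4) C by (intro mult_left_mono) auto
      finally have "real (card ?F) \<le> C * (R / r) powr s" by simp
      moreover have "finite ?F" using P(1) G(1) by auto
      moreover have "E \<inter> cball y R \<subseteq> (\<Union>c\<in>?F. cball c r)"
      proof
        fix x assume x: "x \<in> E \<inter> cball y R"
        then obtain z \<rho> where z: "(z, \<rho>) \<in> P" "x \<in> cball z (\<rho> * R)" using P(3) by blast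
        then have "x \<in> (\<Union>c\<in>G (z, \<rho>). cball c r)" using G(2)[OF z(1)] x by blast
        then show "x \<in> (\<Union>c\<in>?F. cball c r)" using z(1) by blast
      qed
      ultimately show ?thesis by blast
    qed
  qed
  define R1 where "R1 = R0 / 2"
  have R1: "0 < R1" "R1 < R0" using R0 by (simp_all add: R1_def)
  obtain F0 where F0: "finite F0" "F0 \<subseteq> E" "E \<subseteq> (\<Union>z\<in>F0. cball z R1)"
    using finite_centered_cover[OF bE R1(1)] by blast
  define M where "M = real (card F0) + 1"
  have M: "M \<ge> 1" by (simp add: M_def)
  have pow2: "\<exists>k. R \<le> 2 ^ k * r" if "r > 0" for R r :: real
    using real_arch_pow[of 2 "R / r"] that by (auto simp: field_simps intro: less_imp_le)
  have "\<exists>F. finite F \<and> E \<inter> cball x R \<subseteq> (\<Union>c\<in>F. cball c r) \<and> real (card F) \<le> (M * C) * (R / r) powr s"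
    if x: "x \<in> E" and rR: "0 < r" "r < R" for x r R
  proof -
    have mr: "m * r \<le> r" using m rR by simp
    have ge1: "1 \<le> (R / r) powr s" using rR s by (intro ge_one_powr_ge_zero) (auto simp: field_simps)
    consider "R < R0" | "R \<ge> R0" "r \<ge> R1" | "R \<ge> R0" "r < R1" by linarith
    then show ?thesis
    proof cases
      case 1
      obtain F where F: "finite F" "E \<inter> cball x R \<subseteq> (\<Union>c\<in>F. cball c r)" "real (card F) \<le> C * (R / r) powr s"
        using local[of x r R] pow2[OF rR(1), of R] x rR mr 1 by force
      have "C * (R / r) powr s \<le> (M * C) * (R / r) powr s" using M C by (intro mult_right_mono) auto
      then show ?thesis using F by (intro exI[of _ F]) linarith
    next
      case 2
      have "E \<inter> cball x R \<subseteq> (\<Union>c\<in>F0. cball c r)" using F0(3) subset_cball[OF 2(2)] by blast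
      moreover have "real (card F0) \<le> (M * C) * (R / r) powr s"
      proof -
        have "real (card F0) \<le> M * 1 * 1" by (simp add: M_def)
        also have "M * 1 * 1 \<le> (M * C) * (R / r) powr s" using M C ge1 by (intro mult_mono) auto
        finally show ?thesis .
      qed
      ultimately show ?thesis using F0 by blast
    next
      case 3
      have "\<forall>z\<in>F0. \<exists>F. finite F \<and> E \<inter> cball z R1 \<subseteq> (\<Union>c\<in>F. cball c r) \<and> real (card F) \<le> C * (R1 / r) powr s"
        using local[of _ r R1] pow2[OF rR(1), of R1] F0(2) rR mr 3 R1 by (meson order.strict_trans1 subsetD)
      then obtain G where G: "\<forall>z\<in>F0. finite (G z) \<and> E \<inter> cball z R1 \<subseteq> (\<Union>c\<in>G z. cball c r) \<and>
          real (card (G z)) \<le> C * (R1 / r) powr s" by metis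
      let ?F = "\<Union>z\<in>F0. G z"
      have "real (card ?F) \<le> (\<Sum>z\<in>F0. real (card (G z)))"
        unfolding of_nat_sum[symmetric] of_nat_le_iff using F0(1) by (rule card_UN_le)
      also have "\<dots> \<le> (\<Sum>z\<in>F0. C * (R1 / r) powr s)" using G by (intro sum_mono) auto
      also have "\<dots> = real (card F0) * (C * (R1 / r) powr s)" by simp
      also have "\<dots> \<le> M * (C * (R / r) powr s)"
        using C M R1 3 rR s by (intro mult_mono powr_mono2 divide_right_mono) (auto simp: M_def)
      finally have "real (card ?F) \<le> (M * C) * (R / r) powr s" by simp
      moreover have "E \<inter> cball x R \<subseteq> (\<Union>c\<in>?F. cball c r)"
      proof
        fix p assume p: "p \<in> E \<inter> cball x R"
        then obtain z where z: "z \<in> F0" "p \<in> cball z R1" using F0(3) by blast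
        then have "p \<in> (\<Union>c\<in>G z. cball c r)" using G p by blast
        then show "p \<in> (\<Union>c\<in>?F. cball c r)" using z by blast
      qed
      ultimately show ?thesis using F0(1) G by (intro exI[of _ ?F]) auto
    qed
  qed
  then have "\<forall>x\<in>E. \<forall>r R. 0 < r \<and> r < R \<longrightarrow>
      ereal_of_enat (covering_number r (E \<inter> cball x R)) \<le> ereal ((M * C) * (R / r) powr s)"
    unfolding covering_number_le_iff by blast
  moreover have "M * C > 0" using M C by simp
  ultimately show ?thesis unfolding assouad_dim_def using s by (intro Inf_lower) blast
qed

text \<open>
  The contrapositive of \<open>assouad_dim_leI\<close> for covers by balls of equal radii, given by maximal separated
  sets. The ratio \<open>\<delta>\<close> is fixed while the ball can be taken as small as desired.
\<close>

lemma separated_set_of_assouad_dim: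
  fixes E :: "'a::heine_borel set"
  assumes bE: "bounded E" and E: "E \<noteq> {}" and s: "ereal s < assouad_dim E" and \<delta>: "0 < \<delta>" "\<delta> \<le> 1/2" and R0: "R0 > 0"
  obtains y R Z where "y \<in> E" "0 < R" "R < R0" "finite Z" "Z \<subseteq> E \<inter> cball y R"
    "\<forall>z\<in>Z. \<forall>w\<in>Z. z \<noteq> w \<longrightarrow> \<delta> * R < dist z w" "\<delta> powr (- s) \<le> real (card Z)"
proof (cases "s > 0")
  case False
  obtain y where "y \<in> E" using E by blast
  moreover have "\<delta> powr (-s) \<le> \<delta> powr 0" using False \<delta> by (intro powr_mono') auto
  ultimately show ?thesis using that[of y "R0 / 2" "{y}"] R0 \<delta> by auto
next
  case True
  have "\<exists>y R Z. y \<in> E \<and> 0 < R \<and> R < R0 \<and> finite Z \<and> Z \<subseteq> E \<inter> cball y R \<and>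
    (\<forall>z\<in>Z. \<forall>w\<in>Z. z \<noteq> w \<longrightarrow> \<delta> * R < dist z w) \<and> \<delta> powr (- s) \<le> real (card Z)"
  proof (rule ccontr)
    assume no: "\<not> ?thesis"
    have "assouad_dim E \<le> ereal s"
    proof (rule assouad_dim_leI[OF bE True R0 \<delta>(1)])
      show "\<delta> \<le> 1" using \<delta> by simp
      fix y R assume y: "y \<in> E" and R: "0 < R" "R < R0"
      define \<S> where "\<S> = {Z. finite Z \<and> Z \<subseteq> E \<inter> cball y R \<and> (\<forall>z\<in>Z. \<forall>w\<in>Z. z \<noteq> w \<longrightarrow> \<delta> * R < dist z w)}"
      have small: "real (card Z) < \<delta> powr (-s)" if "Z \<in> \<S>" for Z
      proof (rule ccontr)
        assume "\<not> ?thesis"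
        then have "\<delta> powr (-s) \<le> real (card Z)" by simp
        moreover note that[unfolded \<S>_def mem_Collect_eq]
        ultimately have "y \<in> E \<and> 0 < R \<and> R < R0 \<and> finite Z \<and> Z \<subseteq> E \<inter> cball y R \<and>
          (\<forall>z\<in>Z. \<forall>w\<in>Z. z \<noteq> w \<longrightarrow> \<delta> * R < dist z w) \<and> \<delta> powr (- s) \<le> real (card Z)"
          using y R by (intro conjI) auto
        then show False using no[unfolded not_ex, rule_format, of y R Z] by (rule notE[rotated])
      qed
      then have "card Z \<le> nat \<lceil>\<delta> powr (-s)\<rceil>" if "Z \<in> \<S>" for Z
        using that by (metis le_nat_iff less_imp_le of_nat_ceiling of_nat_le_iff order.trans real_nat_ceiling_ge)
      moreover have "{} \<in> \<S>" by (simp add: \<S>_def)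
      ultimately obtain Z where Z: "Z \<in> \<S>" "\<forall>Z'\<in>\<S>. card Z' \<le> card Z"
        using ex_has_greatest_nat[of "\<lambda>Z. Z \<in> \<S>" "{}" card] by (metis less_Suc_eq_le)
      have Zp: "finite Z" "Z \<subseteq> E" using Z(1) by (auto simp: \<S>_def)
      have covZ: "E \<inter> cball y R \<subseteq> (\<Union>z\<in>Z. cball z (\<delta> * R))"
      proof (rule ccontr)
        assume "\<not> ?thesis"
        then obtain x where x: "x \<in> E \<inter> cball y R" "x \<notin> (\<Union>z\<in>Z. cball z (\<delta> * R))" by blast
        then have "\<forall>z\<in>Z. \<delta> * R < dist z x" by (simp add: not_le)
        note x = x(1) this
        have "insert x Z \<in> \<S>" using Z(1) x by (auto simp: \<S>_def dist_commute)
        moreover have "x \<notin> Z"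
        proof
          assume "x \<in> Z"
          then have "\<delta> * R < dist x x" using x(2) by blast
          then show False using mult_pos_pos[OF \<delta>(1) R(1)] by simp
        qed
        ultimately show False using Z(2) Zp(1) by force
      qed
      have "(\<Sum>(z, \<rho>)\<in>Z \<times> {\<delta>}. \<rho> powr s) = (\<Sum>z\<in>Z. \<delta> powr s)"
        by (simp add: sum.cartesian_product[symmetric])
      also have "\<dots> = real (card Z) * \<delta> powr s" by simp
      also have "\<dots> \<le> \<delta> powr (-s) * \<delta> powr s" using small[OF Z(1)] by (intro mult_right_mono) auto
      also have "\<dots> = 1" using \<delta> by (simp add: powr_add[symmetric])
      finally show "relative_cover E \<delta> s R 1 (E \<inter> cball y R)"
        unfolding relative_cover_def
      proof (intro exI[of _ "Z \<times> {\<delta>}"] conjI)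
        have "(\<Union>(z, \<rho>)\<in>Z \<times> {\<delta>}. cball z (\<rho> * R)) = (\<Union>z\<in>Z. cball z (\<delta> * R))" by auto
        then show "E \<inter> cball y R \<subseteq> (\<Union>(z, \<rho>)\<in>Z \<times> {\<delta>}. cball z (\<rho> * R))" using covZ by simp
      qed (use Zp \<delta> in auto)
    qed
    then show False using s by simp
  qed
  then show ?thesis using that by blast
qed

lemma assouad_dim_nonneg: "0 \<le> assouad_dim E"
  unfolding assouad_dim_def by (intro Inf_greatest) auto

lemma hausdorff_measure_zeroI:
  fixes E :: "'a::metric_space set"
  assumes s: "s > 0"
    and cov: "\<And>\<epsilon>. \<epsilon> > 0 \<Longrightarrow> \<exists>F r. finite F \<and> 0 < r \<and> r \<le> \<epsilon> \<and> E \<subseteq> (\<Union>c\<in>F. cball c r) \<and> real (card F) * r powr s \<le> \<epsilon>"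
  shows "hausdorff_measure s E = 0"
proof -
  have bound: "hausdorff_premeasure s \<delta> E \<le> 0 + ennreal \<eta>" if \<delta>: "\<delta> > 0" and \<eta>: "\<eta> > 0" for \<delta> \<eta>
  proof -
    define \<epsilon> where "\<epsilon> = min (\<delta> / 2) (\<eta> / 2 powr s)"
    have "\<epsilon> > 0" using \<delta> \<eta> by (simp add: \<epsilon>_def)
    then obtain F r where F: "finite F" "0 < r" "r \<le> \<epsilon>" "E \<subseteq> (\<Union>c\<in>F. cball c r)" "real (card F) * r powr s \<le> \<epsilon>"
      using cov by meson
    obtain h where h: "bij_betw h {0..<card F} F" using ex_bij_betw_nat_finite[OF F(1)] by blast
    define U where "U i = (if i < card F then cball (h i) r else {})" for i
    have diam: "diameter (U i) \<le> 2 * r" for i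
    proof (cases "i < card F")
      case True
      have "dist x y \<le> 2 * r" if "x \<in> cball (h i) r" "y \<in> cball (h i) r" for x y
        using that dist_triangle3[of x y "h i"] by simp
      then show ?thesis using True F(2) by (auto simp: U_def diameter_def intro!: cSUP_least)
    qed (use F(2) in \<open>simp add: U_def\<close>)
    have "E \<subseteq> (\<Union>i. U i)"
    proof
      fix x assume "x \<in> E"
      then obtain c where c: "c \<in> F" "x \<in> cball c r" using F(4) by blast
      then obtain i where "i < card F" "h i = c" using h unfolding bij_betw_def by (metis atLeastLessThan_iff imageE)
      then show "x \<in> (\<Union>i. U i)" using c by (auto simp: U_def)
    qed
    moreover have "bounded (U i)" "diameter (U i) \<le> \<delta>" for i
      using diam[of i] F(3) by (auto simp: U_def \<epsilon>_def split: if_splits)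
    ultimately have "hausdorff_premeasure s \<delta> E \<le> (\<Sum>i. ennreal (diameter (U i) powr s))"
      unfolding hausdorff_premeasure_def by (intro INF_lower) auto
    also have "\<dots> = (\<Sum>i<card F. ennreal (diameter (U i) powr s))"
      by (rule suminf_finite) (auto simp: U_def)
    also have "\<dots> \<le> (\<Sum>i<card F. ennreal ((2 * r) powr s))"
      using diam s \<open>\<And>i. bounded (U i)\<close> by (intro sum_mono ennreal_leI powr_mono2 diameter_ge_0) auto
    also have "\<dots> = ennreal (real (card F) * (2 * r) powr s)"
      by (simp add: ennreal_mult' ennreal_of_nat_eq_real_of_nat)
    also have "\<dots> \<le> ennreal \<eta>"
    proof (rule ennreal_leI)
      have "real (card F) * (2 * r) powr s = 2 powr s * (real (card F) * r powr s)"
        using F by (simp add: powr_mult)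
      also have "\<dots> \<le> 2 powr s * (\<eta> / 2 powr s)" using F(5) by (intro mult_left_mono) (auto simp: \<epsilon>_def)
      finally show "real (card F) * (2 * r) powr s \<le> \<eta>" by simp
    qed
    finally show ?thesis by simp
  qed
  have "hausdorff_premeasure s \<delta> E \<le> 0" if "\<delta> > 0" for \<delta>
  proof (rule ennreal_le_epsilon)
    fix e :: real assume "0 < e"
    then show "hausdorff_premeasure s \<delta> E \<le> 0 + ennreal e" by (rule bound[OF that])
  qed
  then show ?thesis unfolding hausdorff_measure_def
    by (metis SUP_least greaterThan_iff le_zero_eq)
qed

lemma hausdorff_dim_leI: "s > 0 \<Longrightarrow> hausdorff_measure s E = 0 \<Longrightarrow> hausdorff_dim E \<le> ereal s"
  unfolding hausdorff_dim_def by (intro Inf_lower) auto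

lemma hausdorff_dim_le_assouad_dim:
  fixes E :: "'a::metric_space set"
  assumes "bounded E"
  shows "hausdorff_dim E \<le> assouad_dim E"
  unfolding assouad_dim_def
proof (rule Inf_greatest)
  fix u assume "u \<in> {ereal s |s. s > 0 \<and> (\<exists>C>0. \<forall>x\<in>E. \<forall>r R. 0 < r \<and> r < R \<longrightarrow>
        ereal_of_enat (covering_number r (E \<inter> cball x R)) \<le> ereal (C * (R / r) powr s))}"
  then obtain s C where u: "u = ereal s" and s: "s > 0" and C: "C > 0" and
    cov: "\<forall>x\<in>E. \<forall>r R. 0 < r \<and> r < R \<longrightarrow> (\<exists>F. finite F \<and> E \<inter> cball x R \<subseteq> (\<Union>c\<in>F. cball c r) \<and> real (card F) \<le> C * (R / r) powr s)"
    unfolding covering_number_le_iff by auto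
  show "hausdorff_dim E \<le> u"
  proof (rule ereal_le_epsilon2)
    fix e :: real assume e: "e > 0"
    have "hausdorff_measure (s + e) E = 0"
    proof (rule hausdorff_measure_zeroI)
      show "s + e > 0" using s e by simp
      fix \<epsilon> :: real assume \<epsilon>: "\<epsilon> > 0"
      show "\<exists>F r. finite F \<and> 0 < r \<and> r \<le> \<epsilon> \<and> E \<subseteq> (\<Union>c\<in>F. cball c r) \<and> real (card F) * r powr (s + e) \<le> \<epsilon>"
      proof (cases "E = {}")
        case True
        then show ?thesis using \<epsilon> by (intro exI[of _ "{}"] exI[of _ \<epsilon>]) auto
      next
        case False
        then obtain x where x: "x \<in> E" by blast
        obtain R' where R': "\<forall>y\<in>E. dist x y \<le> R'" using assms unfolding bounded_any_center[of E x] by blast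
        define R where "R = max R' 1"
        have R: "R > 0" "E \<subseteq> cball x R" using R' by (auto simp: R_def subset_iff)
        let ?K = "C * R powr s"
        have K: "?K > 0" using C R by simp
        define r where "r = Min {\<epsilon>, R / 2, (\<epsilon> / ?K) powr (1 / e)}"
        have r: "r > 0" "r \<le> \<epsilon>" "r < R" "r \<le> (\<epsilon> / ?K) powr (1 / e)"
          using \<epsilon> R K by (auto simp: r_def min_less_iff_disj)
        obtain F where F: "finite F" "E \<inter> cball x R \<subseteq> (\<Union>c\<in>F. cball c r)" "real (card F) \<le> C * (R / r) powr s"
          using cov[rule_format, OF x, of r R] r by auto
        have "real (card F) * r powr (s + e) \<le> C * (R / r) powr s * r powr (s + e)"
          using F by (intro mult_right_mono) auto
        also have "\<dots> = ?K * r powr e" using r R by (simp add: powr_divide powr_add)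
        also have "\<dots> \<le> ?K * ((\<epsilon> / ?K) powr (1 / e)) powr e"
          using r K e by (intro mult_left_mono powr_mono2) auto
        also have "\<dots> = \<epsilon>" using e \<epsilon> C R by (simp add: powr_powr)
        finally show ?thesis using F R r by (intro exI[of _ F] exI[of _ r]) auto
      qed
    qed
    then show "hausdorff_dim E \<le> u + ereal e" using hausdorff_dim_leI[of "s + e" E] s e u by simp
  qed
qed

text \<open>
  The sets of a cover with small \<open>\<Sum>diameter\<^sup>s\<close> can be enlarged to open balls, with a summable loss, so
  that compactness leaves finitely many of them.
\<close>

lemma compact_cover_of_hausdorff_dim:
  fixes E :: "'a::metric_space set"
  assumes "compact E" "hausdorff_dim E < t"
  obtains s where "s > 0" "ereal s < t" "\<forall>\<epsilon>>0. \<exists>F. finite F \<and> (\<forall>(c, r)\<in>F. 0 < r \<and> r \<le> \<epsilon>) \<and>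
     E \<subseteq> (\<Union>(c, r)\<in>F. ball c r) \<and> (\<Sum>(c, r)\<in>F. r powr s) \<le> \<epsilon>"
proof -
  obtain s where s: "s > 0" "ereal s < t" "hausdorff_measure s E = 0"
    using assms(2) unfolding hausdorff_dim_def Inf_less_iff by auto
  have "\<exists>F. finite F \<and> (\<forall>(c, r)\<in>F. 0 < r \<and> r \<le> \<epsilon>) \<and>
     E \<subseteq> (\<Union>(c, r)\<in>F. ball c r) \<and> (\<Sum>(c, r)\<in>F. r powr s) \<le> \<epsilon>" if \<epsilon>: "\<epsilon> > 0" for \<epsilon>
  proof -
    define \<delta> where "\<delta> = (\<epsilon> powr s / 2) powr (1 / s)"
    have \<delta>: "\<delta> > 0" "\<delta> powr s = \<epsilon> powr s / 2" using \<epsilon> s by (simp_all add: \<delta>_def powr_powr)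
    have "hausdorff_premeasure s \<delta> E \<le> hausdorff_measure s E"
      unfolding hausdorff_measure_def using \<delta> by (intro SUP_upper) auto
    then have "hausdorff_premeasure s \<delta> E < ennreal (\<epsilon> / 2)" using s(3) \<epsilon> by simp
    then obtain U where U: "E \<subseteq> (\<Union>i. U i)" "\<And>i. bounded (U i)" "\<And>i. diameter (U i) \<le> \<delta>"
      and sumU: "(\<Sum>i. ennreal (diameter (U i) powr s)) < ennreal (\<epsilon> / 2)"
      unfolding hausdorff_premeasure_def INF_less_iff by blast
    let ?d = "\<lambda>i::nat. diameter (U i)"
    have d0: "?d i \<ge> 0" for i using U(2) by (rule diameter_ge_0)
    have summ: "summable (\<lambda>i. ?d i powr s)"
      using sumU by (intro summable_suminf_not_top) (auto simp: less_top[symmetric] intro!: order.strict_trans[OF sumU])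
    have "ennreal (\<Sum>i. ?d i powr s) < ennreal (\<epsilon> / 2)"
      using sumU summ by (subst (asm) suminf_ennreal2) auto
    then have sumd: "(\<Sum>i. ?d i powr s) < \<epsilon> / 2"
      using \<epsilon> suminf_nonneg[OF summ] by (simp add: ennreal_less_iff)
    define \<eta> where "\<eta> i = min (\<epsilon> / 2) (\<epsilon> powr s / 2) * (1 / 2) ^ Suc i" for i
    have \<eta>0: "\<eta> i > 0" for i using \<epsilon> by (simp add: \<eta>_def)
    have \<eta>1: "\<eta> i \<le> \<epsilon> powr s / 2" for i
    proof -
      have "\<eta> i \<le> (\<epsilon> powr s / 2) * 1" unfolding \<eta>_def using \<epsilon> by (intro mult_mono power_le_one) auto
      then show ?thesis by simp
    qed
    have \<eta>2: "\<eta> i \<le> \<epsilon> / 2 * (1 / 2) ^ Suc i" for i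
      unfolding \<eta>_def by (intro mult_right_mono) auto
    \<comment> \<open>The radius is chosen such that passing from the diameter to it costs exactly \<open>\<eta> i\<close> in the sum.\<close>
    define r where "r i = (?d i powr s + \<eta> i) powr (1 / s)" for i
    have rs: "r i powr s = ?d i powr s + \<eta> i" for i
      using s \<eta>0[of i] by (simp add: r_def powr_powr add_nonneg_nonneg less_imp_le)
    have "?d i powr s + \<eta> i > 0" for i using \<eta>0[of i] by (intro add_nonneg_pos) auto
    then have r0: "r i > 0" for i using less_imp_neq[of 0 "?d i powr s + \<eta> i"] by (simp add: r_def)
    have dr: "?d i < r i" for i
    proof -
      have "?d i powr s < r i powr s" using \<eta>0[of i] rs by simp
      then show ?thesis using r0[of i] s powr_mono2[of s "r i" "?d i"] by (meson less_imp_le not_less)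
    qed
    have r\<epsilon>: "r i \<le> \<epsilon>" for i
    proof -
      have "?d i powr s \<le> \<delta> powr s" using d0 U(3) s by (intro powr_mono2) auto
      then have "r i powr s \<le> \<epsilon> powr s" using \<eta>1[of i] rs \<delta> by simp
      then show ?thesis using powr_less_mono2[of s \<epsilon> "r i"] s \<epsilon> by (meson less_imp_le not_less)
    qed
    define c where "c i = (SOME x. x \<in> U i)" for i
    have Ub: "U i \<subseteq> ball (c i) (r i)" for i
    proof
      fix x assume x: "x \<in> U i"
      then have "c i \<in> U i" unfolding c_def by (rule someI)
      then have "dist (c i) x \<le> ?d i" using x U(2) by (intro diameter_bounded_bound)
      then show "x \<in> ball (c i) (r i)" using dr[of i] by simp
    qed
    have "E \<subseteq> (\<Union>i\<in>UNIV. ball (c i) (r i))" using U(1) Ub by blast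
    then obtain I where I: "finite I" "E \<subseteq> (\<Union>i\<in>I. ball (c i) (r i))"
      using compactE_image[OF assms(1), of UNIV "\<lambda>i. ball (c i) (r i)"] by auto
    let ?F = "(\<lambda>i. (c i, r i)) ` I"
    have "(\<Sum>(c, r)\<in>?F. r powr s) \<le> (\<Sum>i\<in>I. r i powr s)"
      using sum_image_le[OF I(1), of "\<lambda>(c, r). r powr s" "\<lambda>i. (c i, r i)"] by (simp add: comp_def)
    also have "\<dots> \<le> (\<Sum>i\<in>I. ?d i powr s) + (\<Sum>i\<in>I. \<epsilon> / 2 * (1 / 2) ^ Suc i)"
      unfolding rs sum.distrib using \<eta>2 by (intro add_left_mono sum_mono)
    also have "(\<Sum>i\<in>I. ?d i powr s) \<le> (\<Sum>i. ?d i powr s)" using I by (intro sum_le_suminf summ) auto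
    also have "(\<Sum>i\<in>I. \<epsilon> / 2 * (1 / 2) ^ Suc i) \<le> (\<Sum>i. \<epsilon> / 2 * (1 / 2) ^ Suc i)"
      using I \<epsilon> power_half_series by (intro sum_le_suminf summable_mult) (auto simp: sums_iff)
    also have "(\<Sum>i. \<epsilon> / 2 * (1 / 2) ^ Suc i) = \<epsilon> / 2"
      using power_half_series by (subst suminf_mult) (auto simp: sums_iff)
    finally have "(\<Sum>(c, r)\<in>?F. r powr s) \<le> \<epsilon>" using sumd by linarith
    then show ?thesis using I r0 r\<epsilon> by (intro exI[of _ ?F]) auto
  qed
  then show ?thesis using that[of s] s by blast
qed

section \<open>Words\<close>

lemma word_matrix_simps [simp]:
  "word_matrix A [] = mat 1" "word_matrix A (i # w) = A i ** word_matrix A w"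
  "word_matrix A (u @ v) = word_matrix A u ** word_matrix A v"
proof -
  show 1: "word_matrix A [] = mat 1" and 2: "word_matrix A (i # w) = A i ** word_matrix A w" for i w
    by (simp_all add: word_matrix_def)
  show "word_matrix A (u @ v) = word_matrix A u ** word_matrix A v"
    by (induction u) (simp_all add: 1 2 matrix_mul_assoc)
qed

lemma word_map_simps [simp]:
  "word_map A b [] x = x" "word_map A b (i # w) x = A i *v word_map A b w x + b i"
  by (simp_all add: word_map_def affine_map_def)

lemma word_map_append [simp]: "word_map A b (u @ v) x = word_map A b u (word_map A b v x)"
  by (induction u) simp_all

lemma word_map_diff: "word_map A b w x - word_map A b w y = word_matrix A w *v (x - y)"
proof (induction w)
  case (Cons i w)
  have "word_map A b (i # w) x - word_map A b (i # w) y = A i *v (word_map A b w x - word_map A b w y)"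
    by (simp add: matrix_vector_mult_diff_distrib)
  then show ?case using Cons by (simp add: matrix_vector_mul_assoc)
qed simp

lemma subset_range_word: "set ms \<subseteq> g ` S \<Longrightarrow> \<exists>w. set w \<subseteq> S \<and> ms = map g w"
proof (induction ms)
  case (Cons m ms)
  then obtain w i where "set w \<subseteq> S" "ms = map g w" "i \<in> S" "m = g i" by auto
  then show ?case by (intro exI[of _ "i # w"]) auto
qed simp

lemma mprod_normalized:
  "mprod (map (\<lambda>i. (1 / sqrt \<bar>det (A i)\<bar>) *\<^sub>R A i) w) =
     (1 / sqrt \<bar>det (word_matrix A w)\<bar>) *\<^sub>R word_matrix A w"
  by (induction w)
    (simp_all add: det_mul abs_mult real_sqrt_mult scalar_matrix_assoc[symmetric] matrix_scalar_ac mult.commute)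

locale dominated_ifs =
  fixes N :: nat and A :: "nat \<Rightarrow> real^2^2" and b :: "nat \<Rightarrow> real^2" and X :: "(real^2) set"
  assumes SA: "self_affine_set N A b X" and dom: "dominated N A"
begin

abbreviation W where "W \<equiv> word_matrix A"
abbreviation \<phi> where "\<phi> \<equiv> word_map A b"
definition all_words :: "nat list set" where "all_words = {w. set w \<subseteq> {1..N}}"

lemma all_words_simps [simp]: "[] \<in> all_words" "i # w \<in> all_words \<longleftrightarrow> i \<in> {1..N} \<and> w \<in> all_words"
  "u @ v \<in> all_words \<longleftrightarrow> u \<in> all_words \<and> v \<in> all_words"
  by (auto simp: all_words_def)

lemma words_iff: "w \<in> words N \<longleftrightarrow> w \<noteq> [] \<and> w \<in> all_words"
  by (auto simp: words_def all_words_def)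

lemma det_A: "i \<in> {1..N} \<Longrightarrow> det (A i) \<noteq> 0"
  using SA by (auto simp: self_affine_set_def invertible_det_nz)

lemma det_W: "w \<in> all_words \<Longrightarrow> det (W w) \<noteq> 0"
  by (induction w) (use det_A in \<open>auto simp: det_mul\<close>)

lemma W_pos: "w \<in> all_words \<Longrightarrow> 0 < \<alpha>1 (W w)" "w \<in> all_words \<Longrightarrow> 0 < \<alpha>2 (W w)"
  using \<alpha>1_pos \<alpha>2_pos det_W by blast+

lemma compact_X: "compact X" and X_nonempty: "X \<noteq> {}"
  and X_eq: "X = (\<Union>i\<in>{1..N}. affine_map A b i ` X)"
  using SA unfolding self_affine_set_def by blast+

lemma \<phi>_mem: "w \<in> all_words \<Longrightarrow> x \<in> X \<Longrightarrow> \<phi> w x \<in> X"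
proof (induction w)
  case (Cons i w)
  then have "affine_map A b i (\<phi> w x) \<in> (\<Union>i\<in>{1..N}. affine_map A b i ` X)" by auto
  then have "affine_map A b i (\<phi> w x) \<in> X" by (simp only: X_eq[symmetric])
  then show ?case by (simp add: affine_map_def)
qed simp

lemma \<phi>_extend:
  assumes "x \<in> \<phi> w ` X"
  obtains i where "i \<in> {1..N}" "x \<in> \<phi> (w @ [i]) ` X"
proof -
  obtain y where y: "y \<in> X" "x = \<phi> w y" using assms by auto
  then obtain i z where "i \<in> {1..N}" "z \<in> X" "y = affine_map A b i z" using X_eq by blast
  then show ?thesis using that[of i] y by (auto simp: affine_map_def)
qed

lemma ex_word_of_length:
  assumes "x \<in> X"
  shows "\<exists>w\<in>all_words. length w = k \<and> x \<in> \<phi> w ` X"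
proof (induction k)
  case 0
  then show ?case using assms by (intro bexI[of _ "[]"]) (auto simp: image_iff)
next
  case (Suc k)
  then obtain w where w: "w \<in> all_words" "length w = k" "x \<in> \<phi> w ` X" by blast
  moreover obtain i where "i \<in> {1..N}" "x \<in> \<phi> (w @ [i]) ` X" using \<phi>_extend[OF w(3)] by blast
  ultimately show ?case using w by (intro bexI[of _ "w @ [i]"]) auto
qed

lemma N_pos: "1 \<in> {1..N}"
proof -
  obtain x where "x \<in> X" using X_nonempty by blast
  then obtain i where "i \<in> {1..N}" using X_eq by blast
  then show ?thesis by simp
qed

text \<open>
  Take the first prefix of a coding of \<open>x\<close> on which \<open>g\<close> drops to \<open>R\<close>.
\<close>

lemma stopping_word:
  assumes x: "x \<in> X" and g0: "R < g []" and gk: "\<And>w. w \<in> all_words \<Longrightarrow> length w = k \<Longrightarrow> g w \<le> (R::real)"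
  obtains w where "w \<in> words N" "x \<in> \<phi> w ` X" "g w \<le> R" "R < g (butlast w)"
proof -
  obtain w where w: "w \<in> all_words" "length w = k" "x \<in> \<phi> w ` X" using ex_word_of_length[OF x] by blast
  define j where "j = (LEAST j. g (take j w) \<le> R)"
  have ex: "g (take k w) \<le> R" using gk w by simp
  have j: "g (take j w) \<le> R" "\<And>i. i < j \<Longrightarrow> R < g (take i w)" "j \<le> k"
    unfolding j_def using LeastI[of "\<lambda>j. g (take j w) \<le> R", OF ex] not_less_Least[of _ "\<lambda>j. g (take j w) \<le> R"]
      Least_le[of "\<lambda>j. g (take j w) \<le> R", OF ex] by (auto simp: not_le)
  have j0: "j \<noteq> 0" using j(1) g0 by (cases j) auto
  have split: "w = take j w @ drop j w" by simp
  have aw: "take j w \<in> all_words" "drop j w \<in> all_words" using w(1) split by (metis all_words_simps(3))+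
  show ?thesis
  proof (rule that[of "take j w"])
    show "take j w \<in> words N" using aw j0 j(3) w(2) by (auto simp: words_iff)
    obtain y where "y \<in> X" "x = \<phi> w y" using w(3) by auto
    then show "x \<in> \<phi> (take j w) ` X"
      using aw \<phi>_mem[of "drop j w" y] word_map_append[of A b "take j w" "drop j w" y] by auto
    have "butlast (take j w) = take (j - 1) w" using j(3) w(2) by (simp add: butlast_take)
    then show "R < g (butlast (take j w))" using j(2)[of "j - 1"] j0 by simp
  qed (rule j(1))
qed

lemma contraction_rate:
  obtains \<theta> where "0 < \<theta>" "\<theta> < 1" "\<forall>w\<in>all_words. \<alpha>1 (W w) \<le> \<theta> ^ length w"
proof -
  have lt1: "\<alpha>1 (A i) < 1" if i: "i \<in> {1..N}" for i
  proof -
    obtain \<rho> where \<rho>: "\<rho> < 1" "\<rho>-lipschitz_on UNIV (affine_map A b i)" using SA i unfolding self_affine_set_def by blast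
    have "\<alpha>1 (A i) \<le> \<rho>"
    proof (rule \<alpha>1_leI)
      fix v :: "real^2" assume "norm v = 1"
      then show "norm (A i *v v) \<le> \<rho>"
        using lipschitz_onD[OF \<rho>(2), of v 0] by (simp add: affine_map_def dist_norm)
    qed
    then show ?thesis using \<rho> by simp
  qed
  define \<theta> where "\<theta> = Max (insert (1/2) ((\<lambda>i. \<alpha>1 (A i)) ` {1..N}))"
  have "1/2 \<le> \<theta>" unfolding \<theta>_def by (rule Max_ge) auto
  moreover have "\<theta> < 1" unfolding \<theta>_def using lt1 by simp
  moreover have "\<alpha>1 (A i) \<le> \<theta>" if "i \<in> {1..N}" for i unfolding \<theta>_def using that by (intro Max_ge) auto
  ultimately have \<theta>: "1/2 \<le> \<theta>" "\<theta> < 1" "\<And>i. i \<in> {1..N} \<Longrightarrow> \<alpha>1 (A i) \<le> \<theta>" by blast+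
  have "\<alpha>1 (W w) \<le> \<theta> ^ length w" if "w \<in> all_words" for w
    using that
  proof (induction w)
    case (Cons i w)
    have "\<alpha>1 (W (i # w)) \<le> \<alpha>1 (A i) * \<alpha>1 (W w)" by (simp add: \<alpha>1_mult_le)
    also have "\<dots> \<le> \<theta> * \<theta> ^ length w" using Cons \<theta> by (intro mult_mono) auto
    finally show ?case by simp
  qed simp
  then show ?thesis using that[of \<theta>] \<theta> by auto
qed

lemma \<alpha>1_W_le_1: "w \<in> all_words \<Longrightarrow> \<alpha>1 (W w) \<le> 1"
  using contraction_rate by (metis less_imp_le order.trans power_le_one)

lemma small_words: "R > 0 \<Longrightarrow> \<exists>k. \<forall>w\<in>all_words. length w = k \<longrightarrow> \<alpha>1 (W w) \<le> R"
proof -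
  assume R: "R > 0"
  obtain \<theta> where \<theta>: "0 < \<theta>" "\<theta> < 1" "\<forall>w\<in>all_words. \<alpha>1 (W w) \<le> \<theta> ^ length w" by (rule contraction_rate)
  obtain k where "\<theta> ^ k < R" using real_arch_pow_inv[OF R \<theta>(2)] by blast
  then show ?thesis using \<theta>(3) by (intro exI[of _ k]) force
qed

lemma letter_bound:
  obtains L where "L \<ge> 1" "\<forall>i\<in>{1..N}. 1 / L \<le> \<alpha>2 (A i)"
proof -
  define m where "m = Min (insert 1 ((\<lambda>i. \<alpha>2 (A i)) ` {1..N}))"
  have "0 < m" unfolding m_def using \<alpha>2_pos[OF det_A] by simp
  moreover have "m \<le> 1" unfolding m_def by (rule Min_le) auto
  moreover have "m \<le> \<alpha>2 (A i)" if "i \<in> {1..N}" for i unfolding m_def using that by (intro Min_le) auto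
  ultimately have m: "0 < m" "m \<le> 1" "\<And>i. i \<in> {1..N} \<Longrightarrow> m \<le> \<alpha>2 (A i)" by blast+
  then show ?thesis using that[of "1 / m"] by auto
qed

lemma domination:
  obtains C \<tau> where "C \<ge> 1" "0 < \<tau>" "\<tau> < 1" "\<forall>w\<in>all_words. \<alpha>2 (W w) \<le> C * \<tau> ^ length w * \<alpha>1 (W w)"
proof -
  obtain C \<tau> where C: "C > 0" "0 < \<tau>" "\<tau> < 1"
    and d: "\<forall>w\<in>words N. \<alpha>2 (W w) \<le> C * \<tau> ^ length w * \<alpha>1 (W w)"
    using dom unfolding dominated_def by blast
  have "\<alpha>2 (W w) \<le> max C 1 * \<tau> ^ length w * \<alpha>1 (W w)" if w: "w \<in> all_words" for w
  proof (cases "w = []")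
    case False
    then have "\<alpha>2 (W w) \<le> C * \<tau> ^ length w * \<alpha>1 (W w)" using d w words_iff by blast
    also have "\<dots> \<le> max C 1 * \<tau> ^ length w * \<alpha>1 (W w)" using C by (intro mult_right_mono) auto
    finally show ?thesis .
  qed simp
  then show ?thesis using that[of "max C 1" \<tau>] C by auto
qed

text \<open>
  The inequality is homogeneous, so it suffices to prove it for the normalised matrices.
\<close>

lemma almost_multiplicative:
  obtains c where "0 < c" "\<forall>u\<in>all_words. \<forall>v\<in>all_words. c * \<alpha>1 (W u) * \<alpha>1 (W v) \<le> \<alpha>1 (W u ** W v)"
proof -
  obtain C \<tau> where C: "C \<ge> 1" "0 < \<tau>" "\<tau> < 1"
    and d: "\<forall>w\<in>all_words. \<alpha>2 (W w) \<le> C * \<tau> ^ length w * \<alpha>1 (W w)" by (rule domination)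
  define g where "g = (\<lambda>i. (1 / sqrt \<bar>det (A i)\<bar>) *\<^sub>R A i)"
  have gW: "\<alpha>1 (mprod (map g w)) = \<alpha>1 (W w) / sqrt \<bar>det (W w)\<bar>" for w
    unfolding g_def mprod_normalized by (simp add: \<alpha>1_scaleR)
  define L where "L = Max (insert 1 ((\<lambda>i. \<alpha>1 (g i)) ` {1..N}))"
  interpret U: unimodular_growth "g ` {1..N}" L "sqrt (1 / C)" "sqrt (1 / \<tau>)"
  proof
    show "\<bar>det M\<bar> = 1" if "M \<in> g ` {1..N}" for M
      using that det_A by (auto simp: g_def det_scaleR2 abs_mult power_divide)
    show "\<alpha>1 M \<le> L" if "M \<in> g ` {1..N}" for M using that unfolding L_def by (intro Max_ge) auto
    show "1 \<le> L" unfolding L_def by (intro Max_ge) auto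
    show "0 < sqrt (1 / C)" "1 < sqrt (1 / \<tau>)" using C by auto
    fix ms assume "set ms \<subseteq> g ` {1..N}"
    then obtain w where w: "set w \<subseteq> {1..N}" "ms = map g w" using subset_range_word by metis
    then have wa: "w \<in> all_words" by (simp add: all_words_def)
    have p: "\<alpha>1 (W w) > 0" "\<alpha>2 (W w) > 0" using W_pos wa by auto
    have "sqrt (1 / C) * sqrt (1 / \<tau>) ^ length ms = sqrt ((1 / C) * (1 / \<tau>) ^ length w)"
      using w by (simp only: real_sqrt_mult real_sqrt_power length_map)
    also have "\<dots> \<le> sqrt (\<alpha>1 (W w) / \<alpha>2 (W w))"
      using d[rule_format, OF wa] p C by (intro real_sqrt_le_mono) (simp add: field_simps)
    also have "\<alpha>1 (W w) / \<alpha>2 (W w) = (\<alpha>1 (W w))\<^sup>2 / \<bar>det (W w)\<bar>"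
      using p by (simp add: \<alpha>1_mult_\<alpha>2[symmetric] power2_eq_square)
    also have "sqrt \<dots> = \<alpha>1 (mprod ms)" unfolding w(2) gW using p by (simp add: real_sqrt_divide)
    finally show "sqrt (1 / C) * sqrt (1 / \<tau>) ^ length ms \<le> \<alpha>1 (mprod ms)" .
  qed
  obtain c where c: "c > 0" "\<forall>us vs. set us \<subseteq> g ` {1..N} \<and> set vs \<subseteq> g ` {1..N} \<longrightarrow>
     c * \<alpha>1 (mprod us) * \<alpha>1 (mprod vs) \<le> \<alpha>1 (mprod us ** mprod vs)"
    by (rule U.\<alpha>1_mprod_almost_multiplicative)
  have "c * \<alpha>1 (W u) * \<alpha>1 (W v) \<le> \<alpha>1 (W u ** W v)" if u: "u \<in> all_words" and v: "v \<in> all_words" for u v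
  proof -
    have uv: "set (map g u) \<subseteq> g ` {1..N}" "set (map g v) \<subseteq> g ` {1..N}" using u v by (auto simp: all_words_def)
    have "\<alpha>1 (mprod (map g u) ** mprod (map g v)) = \<alpha>1 (W (u @ v)) / sqrt \<bar>det (W (u @ v))\<bar>"
      using gW[of "u @ v"] by simp
    also have "sqrt \<bar>det (W (u @ v))\<bar> = sqrt \<bar>det (W u)\<bar> * sqrt \<bar>det (W v)\<bar>"
      by (simp add: det_mul abs_mult real_sqrt_mult)
    finally have "c * (\<alpha>1 (W u) / sqrt \<bar>det (W u)\<bar>) * (\<alpha>1 (W v) / sqrt \<bar>det (W v)\<bar>)
        \<le> \<alpha>1 (W u ** W v) / (sqrt \<bar>det (W u)\<bar> * sqrt \<bar>det (W v)\<bar>)"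
      using c(2)[rule_format, of "map g u" "map g v"] uv by (simp add: gW)
    moreover have "sqrt \<bar>det (W u)\<bar> * sqrt \<bar>det (W v)\<bar> > 0" using det_W u v by simp
    ultimately show ?thesis by (simp add: divide_le_cancel)
  qed
  then show ?thesis using that c(1) by blast
qed

lemma \<alpha>2_submultiplicative:
  obtains c where "0 < c" "\<forall>u\<in>all_words. \<forall>v\<in>all_words. \<alpha>2 (W u ** W v) \<le> c * \<alpha>2 (W u) * \<alpha>2 (W v)"
proof -
  obtain c where c: "0 < c" "\<forall>u\<in>all_words. \<forall>v\<in>all_words. c * \<alpha>1 (W u) * \<alpha>1 (W v) \<le> \<alpha>1 (W u ** W v)"
    by (rule almost_multiplicative)
  have "\<alpha>2 (W u ** W v) \<le> (1 / c) * \<alpha>2 (W u) * \<alpha>2 (W v)" if u: "u \<in> all_words" and v: "v \<in> all_words" for u v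
  proof -
    have p: "\<alpha>1 (W u) * \<alpha>1 (W v) > 0" using W_pos u v by simp
    have "(c * \<alpha>1 (W u) * \<alpha>1 (W v)) * \<alpha>2 (W u ** W v) \<le> \<alpha>1 (W u ** W v) * \<alpha>2 (W u ** W v)"
      using c(2) u v by (intro mult_right_mono) auto
    also have "\<dots> = \<bar>det (W u)\<bar> * \<bar>det (W v)\<bar>" unfolding \<alpha>1_mult_\<alpha>2 by (simp add: det_mul abs_mult)
    also have "\<dots> = (\<alpha>1 (W u) * \<alpha>1 (W v)) * (\<alpha>2 (W u) * \<alpha>2 (W v))" unfolding \<alpha>1_mult_\<alpha>2[symmetric] by simp
    finally have "(\<alpha>1 (W u) * \<alpha>1 (W v)) * (c * \<alpha>2 (W u ** W v)) \<le> (\<alpha>1 (W u) * \<alpha>1 (W v)) * (\<alpha>2 (W u) * \<alpha>2 (W v))"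
      by (simp add: mult_ac)
    then have "c * \<alpha>2 (W u ** W v) \<le> \<alpha>2 (W u) * \<alpha>2 (W v)" using p by (simp only: mult_le_cancel_left_pos)
    then show ?thesis using c(1) by (simp add: field_simps)
  qed
  then show ?thesis using that[of "1 / c"] c(1) by auto
qed

end

section \<open>Furstenberg directions\<close>

lemma perp_minus: "perp (- v) = - perp v"
  by (simp add: vec_eq_iff forall_2)

lemma RP1_unit:
  assumes "V \<in> RP1"
  obtains p where "norm p = 1" "V = span {p}"
proof -
  have V: "subspace V" "dim V = 1" using assms by (auto simp: RP1_def)
  obtain B where B: "B \<subseteq> V" "independent B" "V \<subseteq> span B" "card B = dim V" using basis_exists by blast
  then obtain q where q: "B = {q}" using V(2) by (auto simp: card_1_singleton_iff)
  have q0: "q \<noteq> 0" using B(2) q by (auto simp: dependent_zero)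
  have Vq: "V = span {q}" using B V q by (metis span_minimal subset_antisym)
  have "span {q} = span {q /\<^sub>R norm q}"
  proof (rule subset_antisym; rule span_minimal; (rule subspace_span)?)
    show "{q /\<^sub>R norm q} \<subseteq> span {q}" by (simp add: span_mul span_base)
    have "q = norm q *\<^sub>R (q /\<^sub>R norm q)" using q0 by simp
    then show "{q} \<subseteq> span {q /\<^sub>R norm q}" by (metis empty_subsetI insert_subset singletonI span_base span_mul)
  qed
  then show ?thesis using that[of "q /\<^sub>R norm q"] q0 Vq by simp
qed

lemma span_in_RP1: "p \<noteq> 0 \<Longrightarrow> span {p} \<in> RP1"
  by (simp add: RP1_def)

lemma mem_span_perp: "norm n = 1 \<Longrightarrow> v \<in> span {perp n} \<longleftrightarrow> n \<bullet> v = 0"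
proof
  assume n: "norm n = 1" and "n \<bullet> v = 0"
  then have "v = (perp n \<bullet> v) *\<^sub>R perp n" using perp_decomp(1)[OF n, of v] by simp
  then show "v \<in> span {perp n}" by (metis insertI1 span_base span_mul)
qed (auto simp: span_singleton)

lemma slice_perp:
  assumes "norm n = 1"
  shows "slice X (span {perp n}) x = {z \<in> X. n \<bullet> (z - x) = 0}"
proof -
  have "z \<in> (\<lambda>v. v + x) ` span {perp n} \<longleftrightarrow> z - x \<in> span {perp n}" for z
    by (auto simp: image_iff intro: bexI[of _ "z - x"])
  then show ?thesis using mem_span_perp[OF assms] by (auto simp: slice_def)
qed

lemma orth_proj_perp:
  assumes n: "norm n = 1"
  shows "orth_proj ((span {perp n})\<^sup>\<bottom>) x = (n \<bullet> x) *\<^sub>R n"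
proof -
  have V: "y \<in> (span {perp n})\<^sup>\<bottom> \<longleftrightarrow> perp n \<bullet> y = 0" for y
    by (auto simp: orthogonal_comp_def orthogonal_def span_singleton inner_commute)
  have VV: "y \<in> (span {perp n})\<^sup>\<bottom>\<^sup>\<bottom> \<longleftrightarrow> n \<bullet> y = 0" for y
  proof
    assume "y \<in> (span {perp n})\<^sup>\<bottom>\<^sup>\<bottom>"
    moreover have "n \<in> (span {perp n})\<^sup>\<bottom>" by (simp add: V)
    ultimately show "n \<bullet> y = 0" by (auto simp: orthogonal_comp_def[of "_\<^sup>\<bottom>"] orthogonal_def)
  next
    assume y: "n \<bullet> y = 0"
    have "z \<bullet> y = 0" if "z \<in> (span {perp n})\<^sup>\<bottom>" for z
    proof -
      have "z = (n \<bullet> z) *\<^sub>R n" using unit_vector_parallel[OF n] that V by blast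
      then show ?thesis using y by (metis inner_scaleR_left mult_zero_right)
    qed
    then show "y \<in> (span {perp n})\<^sup>\<bottom>\<^sup>\<bottom>" by (auto simp: orthogonal_comp_def[of "_\<^sup>\<bottom>"] orthogonal_def)
  qed
  show ?thesis unfolding orth_proj_def V VV
  proof (rule the_equality)
    show "perp n \<bullet> ((n \<bullet> x) *\<^sub>R n) = 0 \<and> n \<bullet> (x - (n \<bullet> x) *\<^sub>R n) = 0"
      using n by (simp add: inner_diff_right dot_square_norm)
    fix y assume y: "perp n \<bullet> y = 0 \<and> n \<bullet> (x - y) = 0"
    then have "y = (n \<bullet> y) *\<^sub>R n" using unit_vector_parallel[OF n] by blast
    then show "y = (n \<bullet> x) *\<^sub>R n" using y by (simp add: inner_diff_right)
  qed
qed

text \<open>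
  As \<open>B\<close> kills \<open>perp n\<close>, it is the rank one matrix \<open>e n\<^sup>T\<close> with \<open>e = B n\<close>.
\<close>

lemma singular_form:
  assumes "norm n = 1" "B *v perp n = 0" "B \<noteq> 0"
  shows "B *v v = (n \<bullet> v) *\<^sub>R (B *v n)" "B *v n \<noteq> 0" "\<alpha>1 B = norm (B *v n)"
proof -
  show 1: "B *v v = (n \<bullet> v) *\<^sub>R (B *v n)" for v
    using assms(2) perp_decomp(1)[OF assms(1), of v]
    by (metis add.right_neutral matrix_vector_mult_scaleR matrix_vector_right_distrib scaleR_zero_right)
  show "B *v n \<noteq> 0"
  proof
    assume "B *v n = 0"
    then have "B *v v = 0" for v using 1[of v] by simp
    then show False using assms(3) by (metis matrix_eq matrix_vector_mult_0)
  qed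
  show "\<alpha>1 B = norm (B *v n)"
  proof (rule antisym)
    show "\<alpha>1 B \<le> norm (B *v n)"
    proof (rule \<alpha>1_leI)
      fix v :: "real^2" assume "norm v = 1"
      then have "\<bar>n \<bullet> v\<bar> * norm (B *v n) \<le> 1 * norm (B *v n)"
        using Cauchy_Schwarz_ineq2[of n v] assms(1) by (intro mult_right_mono) auto
      then show "norm (B *v v) \<le> norm (B *v n)" by (subst 1) simp
    qed
    show "norm (B *v n) \<le> \<alpha>1 B" using norm_le_\<alpha>1[of B n] assms(1) by simp
  qed
qed

text \<open>
  For a singular \<open>B\<close>, the products of \<open>B\<close> and \<open>adjugate B\<close> vanish, so that the range of \<open>adjugate B\<close> is
  the kernel of \<open>B\<close>. This describes the backward Furstenberg directions as kernels.
\<close>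

lemma range_singular_adjugate:
  assumes B: "B \<noteq> 0" "B *v perp n = 0" and n: "norm n = 1"
  shows "range ((*v) (adjugate B)) = span {perp n}" "rank (adjugate B) = 1"
proof -
  have ker: "n \<bullet> v = 0" if "B *v v = 0" for v
    using singular_form(1)[OF n B(2,1), of v] singular_form(2)[OF n B(2,1)] that by simp
  have "perp n \<noteq> 0" using n by auto
  then have det: "det B = 0" using mult_adjugate(2)[of B "perp n"] B(2) by simp
  have sub: "adjugate B *v v \<in> span {perp n}" for v
    using ker[of "adjugate B *v v"] mult_adjugate(1)[of B v] det mem_span_perp[OF n] by simp
  have "adjugate B \<noteq> 0" using B(1) by (auto simp: vec_eq_iff forall_2)
  then obtain v where v: "adjugate B *v v \<noteq> 0" by (metis matrix_eq matrix_vector_mult_0)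
  obtain k where k: "adjugate B *v v = k *\<^sub>R perp n" using sub[of v] by (auto simp: span_singleton)
  then have "k \<noteq> 0" using v by auto
  have "span {perp n} \<subseteq> range ((*v) (adjugate B))"
  proof
    fix y assume "y \<in> span {perp n}"
    then obtain t where "y = t *\<^sub>R perp n" by (auto simp: span_singleton)
    then have "y = adjugate B *v ((t / k) *\<^sub>R v)" using k \<open>k \<noteq> 0\<close> by (simp add: matrix_vector_mult_scaleR)
    then show "y \<in> range ((*v) (adjugate B))" by blast
  qed
  then show r: "range ((*v) (adjugate B)) = span {perp n}" using sub by blast
  have "span {perp n} \<in> RP1" using \<open>perp n \<noteq> 0\<close> by (rule span_in_RP1)
  then show "rank (adjugate B) = 1" unfolding rank_dim_range r by (simp add: RP1_def)
qed

lemma adjugate_adjugate [simp]: "adjugate (adjugate M) = M"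
  by (simp add: vec_eq_iff forall_2)

lemma adjugate_scaleR: "adjugate (c *\<^sub>R M) = c *\<^sub>R adjugate M"
  by (simp add: vec_eq_iff forall_2)

lemma closed_adjugate_vimage: "closed S \<Longrightarrow> closed (adjugate -` S)"
proof (rule continuous_closed_vimage)
  have "adjugate = (\<lambda>M. \<chi> i j. adjugate M $ i $ j)" by simp
  moreover have "linear adjugate" by (rule linearI) (simp_all add: vec_eq_iff forall_2)
  ultimately show "continuous (at M) adjugate" for M
    by (simp add: linear_continuous_at linear_conv_bounded_linear)
qed

lemma normalize_close:
  fixes u n :: "'a::real_normed_vector"
  assumes n: "norm n = 1" and s: "s \<ge> 0" and u: "u \<noteq> 0"
  shows "norm (u /\<^sub>R norm u - n) \<le> 2 * norm (u - s *\<^sub>R n) / norm u"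
proof -
  have "u /\<^sub>R norm u - n = (1 / norm u) *\<^sub>R (u - s *\<^sub>R n) + ((s - norm u) / norm u) *\<^sub>R n"
    using u by (simp add: scaleR_diff_right scaleR_diff_left diff_divide_distrib) (simp add: divide_inverse mult.commute)
  then have "norm (u /\<^sub>R norm u - n) \<le> norm (u - s *\<^sub>R n) / norm u + \<bar>s - norm u\<bar> / norm u"
    using norm_triangle_ineq[of "(1 / norm u) *\<^sub>R (u - s *\<^sub>R n)" "((s - norm u) / norm u) *\<^sub>R n"] n by simp
  also have "\<bar>s - norm u\<bar> \<le> norm (u - s *\<^sub>R n)"
    using norm_triangle_ineq3[of u "s *\<^sub>R n"] n s by (simp add: abs_minus_commute)
  then have "\<bar>s - norm u\<bar> / norm u \<le> norm (u - s *\<^sub>R n) / norm u" by (rule divide_right_mono) simp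
  finally show ?thesis by simp
qed

context dominated_ifs
begin

definition word_cone :: "(real^2^2) set" where
  "word_cone = closure {c *\<^sub>R W w |c w. w \<in> words N}"

text \<open>
  A backward Furstenberg direction is the kernel of a rank one matrix \<open>B = e n\<^sup>T\<close> in \<open>word_cone\<close>. It is
  represented by the unit normals \<open>\<plusminus> n\<close>, since the projection along it is \<open>x \<mapsto> n \<bullet> x\<close>.
\<close>

definition normals :: "(real^2) set" where
  "normals = {n. norm n = 1 \<and> (\<exists>B\<in>word_cone. B \<noteq> 0 \<and> B *v perp n = 0)}"

lemma closed_word_cone: "closed word_cone" by (simp add: word_cone_def)

lemma word_cone_minimal:
  assumes "\<And>c w. w \<in> words N \<Longrightarrow> c *\<^sub>R W w \<in> S" "closed S"
  shows "word_cone \<subseteq> S"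
  unfolding word_cone_def using assms by (intro closure_minimal) auto

lemma W_in_word_cone: "w \<in> words N \<Longrightarrow> c *\<^sub>R W w \<in> word_cone"
  unfolding word_cone_def by (rule subsetD[OF closure_subset]) blast

lemma word_cone_scaleR:
  assumes "B \<in> word_cone"
  shows "k *\<^sub>R B \<in> word_cone"
proof -
  have "word_cone \<subseteq> (\<lambda>M. k *\<^sub>R M) -` word_cone"
  proof (rule word_cone_minimal)
    show "closed ((\<lambda>M. k *\<^sub>R M) -` word_cone)"
      by (intro continuous_closed_vimage[OF closed_word_cone] continuous_intros)
  qed (simp add: W_in_word_cone)
  then show ?thesis using assms by blast
qed

lemma continuous_matrix_mult [continuous_intros]:
  fixes f g :: "'a::topological_space \<Rightarrow> real^2^2"
  assumes "continuous_on S f" "continuous_on S g"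
  shows "continuous_on S (\<lambda>x. f x ** g x)"
  unfolding matrix_matrix_mult_def
  by (intro continuous_on_vec_lambda continuous_on_sum continuous_on_mult continuous_on_component assms)

lemma word_cone_mult_word:
  assumes "B \<in> word_cone" "w \<in> all_words"
  shows "B ** W w \<in> word_cone"
proof -
  have "closed ((\<lambda>M. M ** W w) -` word_cone)"
    by (rule closed_vimage[OF closed_word_cone]) (intro continuous_intros)
  moreover have "c *\<^sub>R W v ** W w \<in> word_cone" if "v \<in> words N" for c v
  proof -
    have "v @ w \<in> words N" using that assms(2) by (simp add: words_iff)
    then show ?thesis using W_in_word_cone[of "v @ w" c] by (simp add: scalar_matrix_assoc)
  qed
  ultimately have "word_cone \<subseteq> (\<lambda>M. M ** W w) -` word_cone" by (intro word_cone_minimal) auto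
  then show ?thesis using assms by blast
qed

text \<open>
  The inequality of \<open>almost_multiplicative\<close> is a closed condition in each factor.
\<close>

lemma word_cone_almost_multiplicative:
  obtains c where "0 < c" "\<forall>B\<in>word_cone. \<forall>w\<in>all_words. c * \<alpha>1 B * \<alpha>1 (W w) \<le> \<alpha>1 (B ** W w)"
    "\<forall>B\<in>word_cone. \<forall>B'\<in>word_cone. c * \<alpha>1 B * \<alpha>1 B' \<le> \<alpha>1 (B ** B')"
proof -
  obtain c where c: "0 < c" "\<forall>u\<in>all_words. \<forall>v\<in>all_words. c * \<alpha>1 (W u) * \<alpha>1 (W v) \<le> \<alpha>1 (W u ** W v)"
    by (rule almost_multiplicative)
  have closedL: "closed {M. c * \<alpha>1 M * \<alpha>1 K \<le> \<alpha>1 (M ** K)}"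
   and closedR: "closed {K. c * \<alpha>1 M * \<alpha>1 K \<le> \<alpha>1 (M ** K)}" for M K :: "real^2^2"
    by (intro closed_Collect_le continuous_intros)+
  have 1: "c * \<alpha>1 B * \<alpha>1 (W w) \<le> \<alpha>1 (B ** W w)" if "B \<in> word_cone" "w \<in> all_words" for B w
  proof -
    have "word_cone \<subseteq> {M. c * \<alpha>1 M * \<alpha>1 (W w) \<le> \<alpha>1 (M ** W w)}"
    proof (rule word_cone_minimal[OF _ closedL])
      fix k v assume "v \<in> words N"
      then have "\<bar>k\<bar> * (c * \<alpha>1 (W v) * \<alpha>1 (W w)) \<le> \<bar>k\<bar> * \<alpha>1 (W v ** W w)"
        using c(2) that(2) by (intro mult_left_mono) (auto simp: words_iff)
      then show "k *\<^sub>R W v \<in> {M. c * \<alpha>1 M * \<alpha>1 (W w) \<le> \<alpha>1 (M ** W w)}"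
        by (simp add: \<alpha>1_scaleR scalar_matrix_assoc[symmetric] mult_ac)
    qed
    then show ?thesis using that by blast
  qed
  have "c * \<alpha>1 B * \<alpha>1 B' \<le> \<alpha>1 (B ** B')" if "B \<in> word_cone" "B' \<in> word_cone" for B B'
  proof -
    have "word_cone \<subseteq> {M. c * \<alpha>1 B * \<alpha>1 M \<le> \<alpha>1 (B ** M)}"
    proof (rule word_cone_minimal[OF _ closedR])
      fix k v assume "v \<in> words N"
      then have "\<bar>k\<bar> * (c * \<alpha>1 B * \<alpha>1 (W v)) \<le> \<bar>k\<bar> * \<alpha>1 (B ** W v)"
        using 1 that(1) by (intro mult_left_mono) (auto simp: words_iff)
      then show "k *\<^sub>R W v \<in> {M. c * \<alpha>1 B * \<alpha>1 M \<le> \<alpha>1 (B ** M)}"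
        by (simp add: \<alpha>1_scaleR matrix_scalar_ac scalar_matrix_assoc[symmetric] mult_ac)
    qed
    then show ?thesis using that by blast
  qed
  then show ?thesis using that[of c] c 1 by blast
qed

text \<open>
  If \<open>B = e n\<^sup>T\<close>, then \<open>B A_w = e m\<^sup>T\<close> with \<open>m = A_w\<^sup>T n\<close>. Thus the set of normals is invariant under
  transposed words, and \<open>word_cone_almost_multiplicative\<close> says that these expand the normals as much as
  their norms permit.
\<close>

lemma normals_transpose:
  obtains c where "0 < c" "\<forall>n\<in>normals. \<forall>w\<in>all_words. c * \<alpha>1 (W w) \<le> norm (transpose (W w) *v n) \<and>
      (transpose (W w) *v n) /\<^sub>R norm (transpose (W w) *v n) \<in> normals"
proof -
  obtain c where c: "0 < c" "\<forall>B\<in>word_cone. \<forall>w\<in>all_words. c * \<alpha>1 B * \<alpha>1 (W w) \<le> \<alpha>1 (B ** W w)"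
    by (rule word_cone_almost_multiplicative)
  have "c * \<alpha>1 (W w) \<le> norm (transpose (W w) *v n) \<and>
      (transpose (W w) *v n) /\<^sub>R norm (transpose (W w) *v n) \<in> normals"
    if n: "n \<in> normals" and w: "w \<in> all_words" for n w
  proof -
    obtain B where B: "B \<in> word_cone" "B \<noteq> 0" "B *v perp n = 0" and n1: "norm n = 1" using n by (auto simp: normals_def)
    note sf = singular_form[OF n1 B(3,2)]
    define m where "m = transpose (W w) *v n"
    have mn: "m \<bullet> v = n \<bullet> (W w *v v)" for v
      unfolding m_def by (metis dot_lmul_matrix transpose_matrix_vector)
    have BW: "(B ** W w) *v v = (m \<bullet> v) *\<^sub>R (B *v n)" for v
      unfolding matrix_vector_mul_assoc[symmetric] sf(1)[of "W w *v v"] mn ..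
    have "c * \<alpha>1 B * \<alpha>1 (W w) \<le> \<alpha>1 (B ** W w)" using c(2) B(1) w by blast
    also have "\<dots> \<le> norm m * norm (B *v n)"
    proof (rule \<alpha>1_leI)
      fix v :: "real^2" assume "norm v = 1"
      then show "norm ((B ** W w) *v v) \<le> norm m * norm (B *v n)"
        unfolding BW using Cauchy_Schwarz_ineq2[of m v] by (simp add: mult_right_mono)
    qed
    finally have "(c * \<alpha>1 (W w)) * norm (B *v n) \<le> norm m * norm (B *v n)" using sf(3) by (simp add: mult_ac)
    then have ge: "c * \<alpha>1 (W w) \<le> norm m" using sf(2) by simp
    moreover have "c * \<alpha>1 (W w) > 0" using c(1) W_pos w by simp
    ultimately have m0: "m \<noteq> 0" by auto
    have "(B ** W w) *v perp (m /\<^sub>R norm m) = 0" by (simp add: BW perp_scaleR)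
    moreover have "(B ** W w) *v m \<noteq> 0" using m0 sf(2) by (simp add: BW)
    then have "B ** W w \<noteq> 0" by auto
    ultimately have "m /\<^sub>R norm m \<in> normals" using word_cone_mult_word[OF B(1) w] m0 by (auto simp: normals_def)
    then show ?thesis using ge by (simp add: m_def)
  qed
  then show ?thesis using that c(1) by blast
qed

lemma compact_normals: "compact normals"
proof -
  let ?S = "{p. norm (fst p) = 1 \<and> norm (snd p) = 1 \<and> snd p \<in> word_cone \<and> snd p *v perp (fst p) = (0::real^2)}"
  have "continuous_on UNIV perp"
    by (intro linear_continuous_on linear_conv_bounded_linear[THEN iffD1] linearI) (simp_all add: vec_eq_iff forall_2)
  then have cp: "continuous_on UNIV (\<lambda>p::(real^2) \<times> (real^2^2). snd p *v perp (fst p))"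
    unfolding matrix_vector_mult_def
    by (intro continuous_on_vec_lambda continuous_on_sum continuous_on_mult continuous_on_component
        continuous_on_snd continuous_on_id continuous_on_compose2[of UNIV perp _ fst] continuous_on_fst) auto
  have "closed (snd -` word_cone :: ((real^2) \<times> (real^2^2)) set)" by (rule closed_vimage_snd[OF closed_word_cone])
  then have "closed ({p. norm (fst p) = 1} \<inter> {p. norm (snd p) = 1} \<inter> snd -` word_cone \<inter> {p. snd p *v perp (fst p) = (0::real^2)})"
    by (intro closed_Int closed_Collect_eq continuous_intros cp \<open>closed (snd -` word_cone)\<close>)
  also have "({p. norm (fst p) = 1} \<inter> {p. norm (snd p) = 1} \<inter> snd -` word_cone \<inter> {p. snd p *v perp (fst p) = (0::real^2)}) = ?S" by auto
  finally have "closed ?S" .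
  moreover have "?S \<subseteq> sphere 0 1 \<times> sphere 0 1" by (auto simp: dist_norm)
  then have "bounded ?S" by (rule bounded_subset[rotated]) (intro bounded_Times bounded_sphere)
  ultimately have "compact (fst ` ?S)"
    by (intro compact_continuous_image continuous_on_fst continuous_on_id) (simp add: compact_eq_bounded_closed)
  moreover have "normals = fst ` ?S"
  proof (intro equalityI subsetI)
    fix n assume "n \<in> normals"
    then obtain B where B: "norm n = 1" "B \<in> word_cone" "B \<noteq> 0" "B *v perp n = 0" by (auto simp: normals_def)
    have "(n, (1 / norm B) *\<^sub>R B) \<in> ?S"
      using B word_cone_scaleR by (simp add: scaleR_matrix_vector_assoc[symmetric])
    then have "fst (n, (1 / norm B) *\<^sub>R B) \<in> fst ` ?S" by (rule imageI)
    then show "n \<in> fst ` ?S" by (simp only: fst_conv)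
  next
    fix n assume "n \<in> fst ` ?S"
    then obtain B where B: "norm n = 1" "norm B = 1" "B \<in> word_cone" "B *v perp n = 0" by auto
    then have "B \<noteq> 0" by auto
    then show "n \<in> normals" using B unfolding normals_def by blast
  qed
  ultimately show ?thesis by simp
qed

text \<open>
  Limits of normalised matrices \<open>A_w\<close> with \<open>\<alpha>2 / \<alpha>1 \<longlonglongrightarrow> 0\<close> are rank one matrices in \<open>word_cone\<close>; the
  claim follows by compactness.
\<close>

lemma near_normals:
  assumes \<eta>: "\<eta> > 0"
  obtains \<rho> where "\<rho> > 0" "\<forall>w f. w \<in> words N \<and> norm f = 1 \<and> norm (W w *v perp f) \<le> \<rho> * \<alpha>1 (W w) \<longrightarrow>
     (\<exists>n\<in>normals. norm (f - n) < \<eta>)"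
proof -
  have "\<exists>\<rho>>0. \<forall>w f. w \<in> words N \<and> norm f = 1 \<and> norm (W w *v perp f) \<le> \<rho> * \<alpha>1 (W w) \<longrightarrow>
     (\<exists>n\<in>normals. norm (f - n) < \<eta>)"
  proof (rule ccontr)
    assume "\<not> ?thesis"
    then have "\<forall>k. \<exists>w f. w \<in> words N \<and> norm f = 1 \<and> norm (W w *v perp f) \<le> (1 / real (Suc k)) * \<alpha>1 (W w) \<and>
       \<not> (\<exists>n\<in>normals. norm (f - n) < \<eta>)" by (metis zero_less_divide_1_iff of_nat_0_less_iff zero_less_Suc)
    then obtain w f where w: "\<And>k. w k \<in> words N" "\<And>k. norm (f k) = 1"
      "\<And>k. norm (W (w k) *v perp (f k)) \<le> (1 / real (Suc k)) * \<alpha>1 (W (w k))"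
      "\<And>k. \<not> (\<exists>n\<in>normals. norm (f k - n) < \<eta>)" by metis
    define B where "B k = (1 / norm (W (w k))) *\<^sub>R W (w k)" for k
    have Wn: "norm (W (w k)) > 0" for k
      using w(1)[of k] W_pos(1)[of "w k"] \<alpha>1_le_norm[of "W (w k)"] by (auto simp: words_iff)
    have B1: "norm (B k) = 1" for k using Wn[of k] by (simp add: B_def)
    have Bp: "norm (B k *v perp (f k)) \<le> 1 / real (Suc k)" for k
    proof -
      have "norm (B k *v perp (f k)) = norm (W (w k) *v perp (f k)) / norm (W (w k))"
        by (simp add: B_def scaleR_matrix_vector_assoc[symmetric])
      also have "\<dots> \<le> ((1 / real (Suc k)) * norm (W (w k))) / norm (W (w k))"
        using w(3)[of k] \<alpha>1_le_norm[of "W (w k)"]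
        by (intro divide_right_mono order.trans[OF w(3)] mult_left_mono) auto
      also have "\<dots> = 1 / real (Suc k)" using Wn[of k] by simp
      finally show ?thesis .
    qed
    have "compact (sphere (0::real^2) 1 \<times> sphere (0::real^2^2) 1)" by (intro compact_Times compact_sphere)
    moreover have "\<forall>k. (f k, B k) \<in> sphere 0 1 \<times> sphere 0 1" using w(2) B1 by simp
    ultimately obtain p s where ps: "p \<in> sphere 0 1 \<times> sphere 0 1" "strict_mono s" "((\<lambda>k. (f k, B k)) \<circ> s) \<longlonglongrightarrow> p"
      unfolding compact_eq_seq_compact_metric by (rule seq_compactE) auto
    obtain n C where p: "p = (n, C)" by (cases p)
    have lim: "(\<lambda>k. f (s k)) \<longlonglongrightarrow> n" "(\<lambda>k. B (s k)) \<longlonglongrightarrow> C"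
      using tendsto_fst[OF ps(3)] tendsto_snd[OF ps(3)] by (simp_all add: p comp_def)
    have Cc: "C \<in> word_cone"
      by (rule closed_sequentially[OF closed_word_cone _ lim(2)]) (use W_in_word_cone w(1) in \<open>simp add: B_def\<close>)
    have "(\<lambda>k. perp (f (s k))) \<longlonglongrightarrow> perp n"
      by (rule bounded_linear.tendsto[OF _ lim(1)], intro linear_conv_bounded_linear[THEN iffD1] linearI)
        (simp_all add: vec_eq_iff forall_2)
    then have "(\<lambda>k. B (s k) *v perp (f (s k))) \<longlonglongrightarrow> C *v perp n"
      unfolding matrix_vector_mult_def
      by (intro tendsto_vec_lambda tendsto_sum tendsto_mult tendsto_vec_nth lim(2))
    moreover have "(\<lambda>k. B (s k) *v perp (f (s k))) \<longlonglongrightarrow> 0"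
    proof (rule Lim_null_comparison)
      have "norm (B (s k) *v perp (f (s k))) \<le> 1 / real (Suc k)" for k
      proof -
        have "1 / real (Suc (s k)) \<le> 1 / real (Suc k)"
          using strict_mono_imp_increasing[OF ps(2), of k] by (intro divide_left_mono) auto
        then show ?thesis using Bp[of "s k"] by linarith
      qed
      then show "\<forall>\<^sub>F k in sequentially. norm (B (s k) *v perp (f (s k))) \<le> 1 / real (Suc k)" by simp
      show "(\<lambda>k. 1 / real (Suc k)) \<longlonglongrightarrow> 0" using LIMSEQ_inverse_real_of_nat by (simp add: inverse_eq_divide)
    qed
    ultimately have "C *v perp n = 0" using LIMSEQ_unique by blast
    moreover have "norm n = 1" "norm C = 1" using ps(1) p by auto
    moreover have "C \<noteq> 0" using \<open>norm C = 1\<close> by auto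
    ultimately have "n \<in> normals" using Cc unfolding normals_def by blast
    moreover have "(\<lambda>k. norm (f (s k) - n)) \<longlonglongrightarrow> 0" using lim(1) by (simp add: LIM_zero tendsto_norm_zero)
    then have "eventually (\<lambda>k. norm (f (s k) - n) < \<eta>) sequentially" using \<eta> by (rule order_tendstoD(2))
    then obtain k where "norm (f (s k) - n) < \<eta>" by (meson eventually_happens sequentially_bot)
    ultimately show False using w(4) by blast
  qed
  then show ?thesis using that by blast
qed

lemma eccentric_words:
  assumes "\<rho> > 0"
  obtains k where "\<forall>w\<in>all_words. k \<le> length w \<longrightarrow> \<alpha>2 (W w) \<le> \<rho> * \<alpha>1 (W w)"
proof -
  obtain C \<tau> where C: "C \<ge> 1" "0 < \<tau>" "\<tau> < 1"
    and d: "\<forall>w\<in>all_words. \<alpha>2 (W w) \<le> C * \<tau> ^ length w * \<alpha>1 (W w)" by (rule domination)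
  obtain k where k: "\<tau> ^ k < \<rho> / C" using real_arch_pow_inv[of "\<rho> / C" \<tau>] assms C by auto
  have "\<alpha>2 (W w) \<le> \<rho> * \<alpha>1 (W w)" if "w \<in> all_words" "k \<le> length w" for w
  proof -
    have "\<tau> ^ length w \<le> \<tau> ^ k" using C that by (intro power_decreasing) auto
    then have "\<tau> ^ length w \<le> \<rho> / C" using k by linarith
    then have "C * \<tau> ^ length w \<le> \<rho>" using C by (simp add: field_simps)
    then have "C * \<tau> ^ length w * \<alpha>1 (W w) \<le> \<rho> * \<alpha>1 (W w)" by (rule mult_right_mono) simp
    then show ?thesis using d that(1) by force
  qed
  then show ?thesis using that by blast
qed

lemma normals_nonempty: "normals \<noteq> {}"
proof -
  obtain \<rho> where \<rho>: "\<rho> > 0" "\<forall>w f. w \<in> words N \<and> norm f = 1 \<and> norm (W w *v perp f) \<le> \<rho> * \<alpha>1 (W w) \<longrightarrow>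
     (\<exists>n\<in>normals. norm (f - n) < 1)" by (rule near_normals[of 1]) auto
  obtain k where k: "\<forall>w\<in>all_words. k \<le> length w \<longrightarrow> \<alpha>2 (W w) \<le> \<rho> * \<alpha>1 (W w)" by (rule eccentric_words[OF \<rho>(1)])
  obtain w where w: "w \<in> all_words" "length w = Suc k" using ex_word_of_length X_nonempty by blast
  obtain f where f: "norm f = 1" "norm (W w *v perp f) = \<alpha>2 (W w)" using singular_value_decomposition by metis
  have "\<alpha>2 (W w) \<le> \<rho> * \<alpha>1 (W w)" using k w by simp
  moreover have "w \<in> words N" using w by (auto simp: words_iff)
  ultimately show ?thesis using \<rho>(2) f by fastforce
qed

lemma normals_uminus: "n \<in> normals \<Longrightarrow> - n \<in> normals"
proof -
  assume "n \<in> normals"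
  then obtain B where B: "norm n = 1" "B \<in> word_cone" "B \<noteq> 0" "B *v perp n = 0" by (auto simp: normals_def)
  have "B *v perp (- n) = 0"
    using matrix_vector_mult_scaleR[of B "-1" "perp n"] B(4) by (simp add: perp_minus)
  then show ?thesis using B unfolding normals_def by auto
qed

text \<open>
  If \<open>c A_w\<close> is close to \<open>B = e n0\<^sup>T\<close>, then its transpose sends every vector near the line of \<open>n0\<close>;
  by \<open>normals_transpose\<close> the image of a normal is not too short, so normalising it is harmless.
  The word does not depend on the normal.
\<close>

lemma transpose_words_dense:
  assumes n0: "n0 \<in> normals" and \<eta>: "\<eta> > 0"
  obtains w where "w \<in> words N" "\<forall>n\<in>normals. \<exists>m\<in>{n0, - n0}.
     norm ((transpose (W w) *v n) /\<^sub>R norm (transpose (W w) *v n) - m) < \<eta>"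
proof -
  obtain c where c: "0 < c" "\<forall>n\<in>normals. \<forall>w\<in>all_words. c * \<alpha>1 (W w) \<le> norm (transpose (W w) *v n) \<and>
      (transpose (W w) *v n) /\<^sub>R norm (transpose (W w) *v n) \<in> normals"
    by (rule normals_transpose)
  obtain B where B: "B \<in> word_cone" "B \<noteq> 0" "B *v perp n0 = 0" and n1: "norm n0 = 1" using n0 by (auto simp: normals_def)
  note sf = singular_form[OF n1 B(3,2)]
  define a where "a = \<alpha>1 B"
  have a: "a > 0" using B(2) \<alpha>1_eq_0_iff[of B] \<alpha>1_nonneg[of B] by (simp add: a_def less_le)
  define \<kappa> where "\<kappa> = min (a / 2) (\<eta> * (c * (a / 2)) / 4)"
  have \<kappa>: "\<kappa> > 0" using a c \<eta> by (simp add: \<kappa>_def)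
  obtain k w where w: "w \<in> words N" "dist (k *\<^sub>R W w) B < \<kappa>"
    using B(1) \<kappa> unfolding word_cone_def closure_approachable by blast
  then have wa: "w \<in> all_words" by (simp add: words_iff)
  have D: "\<alpha>1 (B - k *\<^sub>R W w) < \<kappa>"
    using w(2) \<alpha>1_le_norm[of "B - k *\<^sub>R W w"] by (simp add: dist_norm norm_minus_commute)
  have "a \<le> \<alpha>1 (k *\<^sub>R W w) + \<alpha>1 (B - k *\<^sub>R W w)"
  proof (unfold a_def, rule \<alpha>1_leI)
    fix v :: "real^2" assume v: "norm v = 1"
    have "B *v v = (k *\<^sub>R W w) *v v + (B - k *\<^sub>R W w) *v v"
      by (simp add: matrix_vector_mult_add_rdistrib[symmetric])
    then show "norm (B *v v) \<le> \<alpha>1 (k *\<^sub>R W w) + \<alpha>1 (B - k *\<^sub>R W w)"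
      using norm_le_\<alpha>1[of "k *\<^sub>R W w" v] norm_le_\<alpha>1[of "B - k *\<^sub>R W w" v] v
        norm_triangle_ineq[of "(k *\<^sub>R W w) *v v" "(B - k *\<^sub>R W w) *v v"] by simp
  qed
  then have ka: "\<bar>k\<bar> * \<alpha>1 (W w) \<ge> a / 2" using D by (simp add: \<alpha>1_scaleR \<kappa>_def)
  then have k0: "k \<noteq> 0" using a by auto
  have "\<exists>m\<in>{n0, - n0}. norm ((transpose (W w) *v n) /\<^sub>R norm (transpose (W w) *v n) - m) < \<eta>"
    if n: "n \<in> normals" for n
  proof -
    have nn: "norm n = 1" using n by (auto simp: normals_def)
    define m where "m = transpose (W w) *v n"
    have mn: "m \<bullet> v = n \<bullet> (W w *v v)" for v
      unfolding m_def by (metis dot_lmul_matrix transpose_matrix_vector)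
    define s where "s = n \<bullet> (B *v n0)"
    have "norm m \<ge> c * \<alpha>1 (W w)" using c(2) n wa by (simp add: m_def)
    then have "\<bar>k\<bar> * norm m \<ge> \<bar>k\<bar> * (c * \<alpha>1 (W w))" by (intro mult_left_mono) auto
    moreover have "c * (\<bar>k\<bar> * \<alpha>1 (W w)) \<ge> c * (a / 2)" using ka c(1) by (intro mult_left_mono) auto
    ultimately have km: "norm (k *\<^sub>R m) \<ge> c * (a / 2)" by (simp add: mult_ac)
    then have m0: "m \<noteq> 0" using mult_pos_pos[OF c(1), of "a / 2"] a by auto
    have err: "norm (k *\<^sub>R m - s *\<^sub>R n0) \<le> \<kappa>"
    proof -
      let ?v = "k *\<^sub>R m - s *\<^sub>R n0"
      have "?v \<bullet> ?v = n \<bullet> ((k *\<^sub>R W w) *v ?v) - n \<bullet> (B *v ?v)"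
        using mn[of ?v] arg_cong[OF sf(1)[of ?v], of "\<lambda>z. n \<bullet> z"]
        by (subst (1) inner_diff_left) (simp add: s_def scaleR_matrix_vector_assoc[symmetric] mult.commute)
      also have "\<dots> = - (n \<bullet> ((B - k *\<^sub>R W w) *v ?v))"
        by (simp add: matrix_vector_mult_diff_rdistrib inner_diff_right)
      also have "\<dots> \<le> norm n * norm ((B - k *\<^sub>R W w) *v ?v)"
        using Cauchy_Schwarz_ineq2[of n "(B - k *\<^sub>R W w) *v ?v"] by linarith
      also have "\<dots> \<le> \<kappa> * norm ?v"
        using norm_le_\<alpha>1[of "B - k *\<^sub>R W w" ?v] D nn mult_right_mono[of "\<alpha>1 (B - k *\<^sub>R W w)" \<kappa> "norm ?v"] by simp
      finally have "norm ?v * norm ?v \<le> \<kappa> * norm ?v" by (simp add: dot_square_norm power2_eq_square)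
      then show ?thesis using \<kappa> by (cases "norm ?v = 0") (simp_all only: mult_le_cancel_right, auto)
    qed
    define n' where "n' = (if s \<ge> 0 then n0 else - n0)"
    have "norm ((k *\<^sub>R m) /\<^sub>R norm (k *\<^sub>R m) - n') \<le> 2 * norm (k *\<^sub>R m - \<bar>s\<bar> *\<^sub>R n') / norm (k *\<^sub>R m)"
      using n1 k0 m0 by (intro normalize_close) (auto simp: n'_def)
    also have "\<bar>s\<bar> *\<^sub>R n' = s *\<^sub>R n0" by (auto simp: n'_def)
    also have "2 * norm (k *\<^sub>R m - s *\<^sub>R n0) / norm (k *\<^sub>R m) \<le> 2 * \<kappa> / (c * (a / 2))"
      using err km \<kappa> c a by (intro frac_le mult_left_mono) auto
    also have "\<dots> < \<eta>" using \<kappa> \<eta> c a by (simp add: \<kappa>_def min_def field_simps)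
    finally have close: "norm ((k *\<^sub>R m) /\<^sub>R norm (k *\<^sub>R m) - n') < \<eta>" .
    show ?thesis
    proof (cases "k > 0")
      case True
      then have "(k *\<^sub>R m) /\<^sub>R norm (k *\<^sub>R m) = m /\<^sub>R norm m" by simp
      then have "norm (m /\<^sub>R norm m - n') < \<eta>" using close by (simp only:)
      then show ?thesis unfolding m_def by (intro bexI[of _ n']) (auto simp: n'_def)
    next
      case False
      then have "(k *\<^sub>R m) /\<^sub>R norm (k *\<^sub>R m) = - (m /\<^sub>R norm m)" using k0 by simp
      then have "norm (- (m /\<^sub>R norm m) - n') < \<eta>" using close by (simp only:)
      then have "norm (m /\<^sub>R norm m - (- n')) < \<eta>" by (metis minus_diff_minus minus_minus norm_minus_cancel)
      then show ?thesis unfolding m_def by (intro bexI[of _ "- n'"]) (auto simp: n'_def)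
    qed
  qed
  then show ?thesis using that w(1) by blast
qed

text \<open>
  The adjugate is a linear involution that interchanges multiples of \<open>A_w\<close> and of its inverse, hence
  also the closures of the two cones.
\<close>

lemma backward_furstenberg_eq: "backward_furstenberg N A = (\<lambda>n. span {perp n}) ` normals"
proof -
  let ?S = "{c *\<^sub>R matrix_inv (W (rev w)) |c w. w \<in> words N}"
  have rw: "rev w \<in> words N \<longleftrightarrow> w \<in> words N" for w by (auto simp: words_def)
  have 1: "adjugate B \<in> closure ?S" if "B \<in> word_cone" for B
  proof -
    have "word_cone \<subseteq> adjugate -` closure ?S"
    proof (rule word_cone_minimal)
      fix c w assume w: "w \<in> words N"
      then have d: "det (W w) \<noteq> 0" using det_W words_iff by blast
      have "adjugate (c *\<^sub>R W w) = (c * det (W w)) *\<^sub>R matrix_inv (W (rev (rev w)))"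
        using d by (simp add: matrix_inv_eq_adjugate adjugate_scaleR)
      moreover have "rev w \<in> words N" using w rw by blast
      ultimately have "adjugate (c *\<^sub>R W w) \<in> ?S" by blast
      then have "adjugate (c *\<^sub>R W w) \<in> closure ?S" by (rule subsetD[OF closure_subset])
      then show "c *\<^sub>R W w \<in> adjugate -` closure ?S" by (rule vimageI2)
    qed (intro closed_adjugate_vimage closed_closure)
    then show ?thesis using that by blast
  qed
  have 2: "adjugate M \<in> word_cone" if "M \<in> closure ?S" for M
  proof -
    have "closure ?S \<subseteq> adjugate -` word_cone"
    proof (rule closure_minimal)
      show "?S \<subseteq> adjugate -` word_cone"
      proof
        fix M assume "M \<in> ?S"
        then obtain c w where w: "M = c *\<^sub>R matrix_inv (W (rev w))" "w \<in> words N" by blast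
        then have "det (W (rev w)) \<noteq> 0" using det_W words_iff rw by blast
        then have "adjugate M = (c / det (W (rev w))) *\<^sub>R W (rev w)"
          unfolding w(1) by (simp add: matrix_inv_eq_adjugate adjugate_scaleR)
        then show "M \<in> adjugate -` word_cone" using W_in_word_cone rw w(2) by simp
      qed
    qed (intro closed_adjugate_vimage closed_word_cone)
    then show ?thesis using that by blast
  qed
  show ?thesis
  proof (intro equalityI subsetI)
    fix V assume "V \<in> backward_furstenberg N A"
    then obtain M where V: "V = range ((*v) M)" and M: "rank M = 1" "M \<in> closure ?S"
      unfolding backward_furstenberg_def by blast
    have "V \<in> RP1" using M(1) unfolding V RP1_def rank_dim_range
      by (auto intro!: linear_subspace_image matrix_vector_mul_linear subspace_UNIV)
    then obtain p where p: "norm p = 1" "V = span {p}" by (rule RP1_unit)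
    have "rank M < CARD(2)" using M(1) by simp
    then have det: "det M = 0" by (simp only: det_eq_0_rank)
    have "p \<in> V" using p(2) by (simp add: span_base)
    then obtain q where q: "p = M *v q" using V by auto
    have "adjugate M *v perp (- perp p) = 0" using mult_adjugate(2)[of M q] det q by (simp add: perp_minus)
    moreover have "adjugate M \<noteq> 0"
    proof
      assume "adjugate M = 0"
      then have "M = 0" by (metis adjugate_adjugate adjugate_scaleR scaleR_zero_left)
      then show False using q p(1) by simp
    qed
    ultimately have "- perp p \<in> normals" using 2[OF M(2)] p(1) by (auto simp: normals_def)
    moreover have "V = span {perp (- perp p)}" using p(2) by (simp add: perp_minus)
    ultimately show "V \<in> (\<lambda>n. span {perp n}) ` normals" by (rule rev_image_eqI)
  next
    fix V assume "V \<in> (\<lambda>n. span {perp n}) ` normals"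
    then obtain n where n: "V = span {perp n}" "n \<in> normals" by blast
    then obtain B where B: "norm n = 1" "B \<in> word_cone" "B \<noteq> 0" "B *v perp n = 0" by (auto simp: normals_def)
    show "V \<in> backward_furstenberg N A"
      unfolding backward_furstenberg_def
    proof (intro CollectI exI[of _ "adjugate B"] conjI)
      show "V = range ((*v) (adjugate B))" "rank (adjugate B) = 1"
        using range_singular_adjugate[OF B(3,4,1)] n(1) by simp_all
      show "adjugate B \<in> closure ?S" by (rule 1[OF B(2)])
    qed
  qed
qed

text \<open>
  If the kernel of \<open>B\<close> were the range of \<open>M\<close>, then \<open>B M = 0\<close>, against almost multiplicativity on
  \<open>word_cone\<close>.
\<close>

lemma backward_not_forward:
  assumes "V \<in> backward_furstenberg N A"
  shows "V \<in> RP1 - forward_furstenberg N A"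
proof -
  obtain n where n: "V = span {perp n}" "n \<in> normals" using assms by (auto simp: backward_furstenberg_eq)
  then obtain B where B: "norm n = 1" "B \<in> word_cone" "B \<noteq> 0" "B *v perp n = 0" by (auto simp: normals_def)
  have "perp n \<noteq> 0" using B(1) by auto
  then have "V \<in> RP1" using n(1) span_in_RP1 by blast
  moreover have "V \<notin> forward_furstenberg N A"
  proof
    assume "V \<in> forward_furstenberg N A"
    then obtain M where M: "V = range ((*v) M)" "rank M = 1" "M \<in> word_cone"
      unfolding forward_furstenberg_def word_cone_def by blast
    have "(B ** M) *v v = 0" for v
    proof -
      have "M *v v \<in> span {perp n}" using M(1) n(1) by blast
      then obtain t where "M *v v = t *\<^sub>R perp n" by (auto simp: span_singleton)
      then show ?thesis using B(4) by (simp add: matrix_vector_mul_assoc[symmetric] matrix_vector_mult_scaleR)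
    qed
    then have "B ** M = 0" by (metis matrix_eq matrix_vector_mult_0)
    obtain c where c: "0 < c" "\<forall>B\<in>word_cone. \<forall>B'\<in>word_cone. c * \<alpha>1 B * \<alpha>1 B' \<le> \<alpha>1 (B ** B')"
      by (rule word_cone_almost_multiplicative)
    have "c * \<alpha>1 B * \<alpha>1 M \<le> \<alpha>1 (B ** M)" using c(2) B(2) M(3) by blast
    then have "c * \<alpha>1 B * \<alpha>1 M \<le> 0" "c > 0" using \<open>B ** M = 0\<close> \<alpha>1_eq_0_iff[of 0] c(1) by simp_all
    moreover have "\<alpha>1 B > 0" using B(3) \<alpha>1_eq_0_iff[of B] \<alpha>1_nonneg[of B] by (simp add: less_le)
    ultimately have "\<alpha>1 M = 0" using \<alpha>1_nonneg[of M] by (simp add: mult_le_0_iff)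
    then have "M = 0" by (simp add: \<alpha>1_eq_0_iff)
    then have "V \<subseteq> {0}" using M(1) by auto
    moreover have "perp n \<in> V" using n(1) by (simp add: span_base)
    ultimately show False using \<open>perp n \<noteq> 0\<close> by blast
  qed
  ultimately show ?thesis by blast
qed

end

section \<open>The upper bound\<close>

lemma sum_UN_le:
  fixes f :: "'b \<Rightarrow> real"
  assumes "finite I" "\<And>i. i \<in> I \<Longrightarrow> finite (P i)" "\<And>x. 0 \<le> f x"
  shows "sum f (\<Union>i\<in>I. P i) \<le> (\<Sum>i\<in>I. sum f (P i))"
  using assms(1,2)
proof (induction I)
  case (insert i I)
  have "sum f (P i \<union> (\<Union>i\<in>I. P i)) \<le> sum f (P i) + sum f (\<Union>i\<in>I. P i)"
    using insert.prems insert.hyps(1) assms(3) by (subst sum_Un) (auto intro!: sum_nonneg)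
  moreover have "sum f (\<Union>i\<in>I. P i) \<le> (\<Sum>i\<in>I. sum f (P i))" using insert by simp
  ultimately show ?case using insert.hyps by simp
qed simp

text \<open>
  The set has length \<open>2 R\<close> in the direction measured by \<open>h\<close> and is thin otherwise: cut it into pieces
  on which \<open>h\<close> varies by at most \<open>2 * r * R\<close>.
\<close>

lemma bin_cover:
  fixes S :: "'a::metric_space set"
  assumes R: "R > 0" and r: "0 < r" "r \<le> 1/8" and h: "\<And>p. p \<in> S \<Longrightarrow> \<bar>h p\<bar> \<le> R"
    and close: "\<And>p q. p \<in> S \<Longrightarrow> q \<in> S \<Longrightarrow> \<bar>h p - h q\<bar> \<le> 2 * r * R \<Longrightarrow> dist p q \<le> 4 * r * R"
  obtains Z where "finite Z" "Z \<subseteq> S" "real (card Z) \<le> 2 / r" "S \<subseteq> (\<Union>z\<in>Z. cball z (4 * r * R))"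
proof -
  define k where "k p = \<lfloor>h p / (2 * r * R)\<rfloor>" for p
  define J where "J = k ` S"
  define Z where "Z = (\<lambda>j. SOME p. p \<in> S \<and> k p = j) ` J"
  have sel: "(SOME q. q \<in> S \<and> k q = k p) \<in> S \<and> k (SOME q. q \<in> S \<and> k q = k p) = k p" if "p \<in> S" for p
    using someI[of "\<lambda>q. q \<in> S \<and> k q = k p" p] that by simp
  have Jsub: "J \<subseteq> {\<lfloor>- (1 / (2 * r))\<rfloor>..\<lfloor>1 / (2 * r)\<rfloor>}"
  proof
    fix j assume "j \<in> J"
    then obtain p where p: "p \<in> S" "j = k p" by (auto simp: J_def)
    have "\<bar>h p\<bar> / (2 * r * R) \<le> R / (2 * r * R)" using h[OF p(1)] R r by (intro divide_right_mono) auto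
    then have "\<bar>h p / (2 * r * R)\<bar> \<le> R / (2 * r * R)" using R r by simp
    also have "R / (2 * r * R) = 1 / (2 * r)" using R by simp
    finally have "- (1 / (2 * r)) \<le> h p / (2 * r * R)" "h p / (2 * r * R) \<le> 1 / (2 * r)"
      by (simp_all only: abs_le_iff minus_le_iff)
    then show "j \<in> {\<lfloor>- (1 / (2 * r))\<rfloor>..\<lfloor>1 / (2 * r)\<rfloor>}"
      unfolding p(2) k_def atLeastAtMost_iff by (intro conjI floor_mono)
  qed
  then have fJ: "finite J" by (rule finite_subset) simp
  have "card J \<le> card {\<lfloor>- (1 / (2 * r))\<rfloor>..\<lfloor>1 / (2 * r)\<rfloor>}" using Jsub by (intro card_mono) auto
  also have "\<dots> = nat (\<lfloor>1 / (2 * r)\<rfloor> - \<lfloor>- (1 / (2 * r))\<rfloor> + 1)" by simp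
  finally have "real (card J) \<le> real (nat (\<lfloor>1 / (2 * r)\<rfloor> - \<lfloor>- (1 / (2 * r))\<rfloor> + 1))" by simp
  also have "\<dots> \<le> 1 / (2 * r) + 1 / (2 * r) + 2"
  proof -
    have "1 / (2 * r) \<ge> 0" using r by simp
    then show ?thesis by linarith
  qed
  also have "\<dots> \<le> 2 / r" using r by (simp add: field_simps)
  finally have cJ: "real (card J) \<le> 2 / r" .
  show ?thesis
  proof (rule that[of Z])
    show "finite Z" using fJ by (simp add: Z_def)
    show "Z \<subseteq> S" using sel by (auto simp: Z_def J_def)
    have "card Z \<le> card J" unfolding Z_def using fJ by (rule card_image_le)
    then show "real (card Z) \<le> 2 / r" using cJ by linarith
    show "S \<subseteq> (\<Union>z\<in>Z. cball z (4 * r * R))"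
    proof
      fix p assume p: "p \<in> S"
      define q where "q = (SOME q. q \<in> S \<and> k q = k p)"
      have q: "q \<in> S" "k q = k p" using sel[OF p] by (auto simp: q_def)
      have "\<bar>h q / (2 * r * R) - h p / (2 * r * R)\<bar> \<le> 1" using q(2) unfolding k_def by linarith
      then have "\<bar>(h q - h p) / (2 * r * R)\<bar> \<le> 1" by (simp add: diff_divide_distrib)
      then have "\<bar>h q - h p\<bar> \<le> 2 * r * R" using r R by (simp add: divide_le_eq)
      then have "dist q p \<le> 4 * r * R" using close q p by blast
      moreover have "q \<in> Z" unfolding Z_def q_def J_def using p by blast
      ultimately show "p \<in> (\<Union>z\<in>Z. cball z (4 * r * R))" by auto
    qed
  qed
qed

context dominated_ifs
begin

lemma X_bounded: obtains M where "M > 0" "\<forall>z\<in>X. \<forall>x\<in>X. norm (z - x) \<le> M"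
proof -
  obtain B where B: "B > 0" "\<forall>z\<in>X. norm z \<le> B" using compact_imp_bounded[OF compact_X] by (auto simp: bounded_pos)
  have "\<forall>z\<in>X. \<forall>x\<in>X. norm (z - x) \<le> 2 * B"
  proof (intro ballI)
    fix z x assume "z \<in> X" "x \<in> X"
    then show "norm (z - x) \<le> 2 * B" using B(2)[rule_format, of z] B(2)[rule_format, of x] norm_triangle_ineq4[of z x] by linarith
  qed
  then show ?thesis using that[of "2 * B"] B(1) by simp
qed

text \<open>
  On the compact set \<open>X - O'\<close> the distance to the line of the slice is bounded below.
\<close>

lemma slice_cover_stable:
  assumes x: "x \<in> X" and n: "norm n = 1" and op: "open O'" and sub: "slice X (span {perp n}) x \<subseteq> O'"
  obtains \<eta> where "\<eta> > 0" "\<forall>x'\<in>X. \<forall>n'. norm (x' - x) < \<eta> \<and> norm (n' - n) < \<eta> \<longrightarrow>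
     {z \<in> X. \<bar>n' \<bullet> (z - x')\<bar> \<le> \<eta>} \<subseteq> O'"
proof -
  obtain M where M: "M > 0" "\<forall>z\<in>X. \<forall>x\<in>X. norm (z - x) \<le> M" by (rule X_bounded)
  obtain \<mu> where \<mu>: "\<mu> > 0" "\<forall>z\<in>X - O'. \<mu> \<le> \<bar>n \<bullet> (z - x)\<bar>"
  proof (cases "X - O' = {}")
    case False
    have "compact (X - O')" using compact_X op by (rule compact_diff)
    moreover have "continuous_on (X - O') (\<lambda>z. \<bar>n \<bullet> (z - x)\<bar>)" by (intro continuous_intros)
    ultimately have "\<exists>z0\<in>X - O'. \<forall>z\<in>X - O'. \<bar>n \<bullet> (z0 - x)\<bar> \<le> \<bar>n \<bullet> (z - x)\<bar>"
      using False by (intro continuous_attains_inf)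
    then obtain z0 where z0: "z0 \<in> X - O'" "\<forall>z\<in>X - O'. \<bar>n \<bullet> (z0 - x)\<bar> \<le> \<bar>n \<bullet> (z - x)\<bar>" by blast
    have "\<bar>n \<bullet> (z0 - x)\<bar> > 0" using z0(1) sub unfolding slice_perp[OF n] by auto
    then show ?thesis using that z0(2) by blast
  qed (use that[of 1] in auto)
  \<comment> \<open>Moving the line to a nearby one, and widening it, changes the distance by at most \<open>\<eta> * (M + 2)\<close>.\<close>
  define \<eta> where "\<eta> = \<mu> / (2 * (M + 2))"
  have \<eta>: "\<eta> > 0" using \<mu> M by (simp add: \<eta>_def)
  have "\<eta> * (M + 2) = \<mu> / 2" using M(1) unfolding \<eta>_def by (subst times_divide_eq_left) (simp add: divide_eq_eq)
  then have \<eta>\<mu>: "\<eta> * (M + 2) < \<mu>" using \<mu> by linarith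
  have "z \<in> O'" if x': "x' \<in> X" and c: "norm (x' - x) < \<eta>" "norm (n' - n) < \<eta>"
    and z: "z \<in> X" "\<bar>n' \<bullet> (z - x')\<bar> \<le> \<eta>" for x' n' z
  proof (rule ccontr)
    assume "z \<notin> O'"
    then have "\<mu> \<le> \<bar>n \<bullet> (z - x)\<bar>" using \<mu>(2) z(1) by blast
    also have "n \<bullet> (z - x) = n' \<bullet> (z - x') - (n' - n) \<bullet> (z - x') + n \<bullet> (x' - x)"
      by (simp add: inner_diff_left inner_diff_right)
    also have "\<bar>\<dots>\<bar> \<le> \<bar>n' \<bullet> (z - x')\<bar> + \<bar>(n' - n) \<bullet> (z - x')\<bar> + \<bar>n \<bullet> (x' - x)\<bar>" by linarith
    also have "\<dots> \<le> \<eta> + \<eta> * M + \<eta>"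
    proof (intro add_mono z(2))
      have "\<bar>(n' - n) \<bullet> (z - x')\<bar> \<le> norm (n' - n) * norm (z - x')" by (rule Cauchy_Schwarz_ineq2)
      also have "\<dots> \<le> \<eta> * M" using c(2) M z(1) x' \<eta> by (intro mult_mono) auto
      finally show "\<bar>(n' - n) \<bullet> (z - x')\<bar> \<le> \<eta> * M" .
      show "\<bar>n \<bullet> (x' - x)\<bar> \<le> \<eta>" using Cauchy_Schwarz_ineq2[of n "x' - x"] n c(1) by simp
    qed
    finally show False using \<eta>\<mu> by (simp add: algebra_simps)
  qed
  then show ?thesis using that[of \<eta>] \<eta> by blast
qed

lemma compact_slice:
  assumes "norm n = 1"
  shows "compact (slice X (span {perp n}) x)"
proof -
  have "slice X (span {perp n}) x = X \<inter> {z. n \<bullet> (z - x) = 0}" unfolding slice_perp[OF assms] by blast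
  moreover have "closed {z. n \<bullet> (z - x) = 0}" by (intro closed_Collect_eq continuous_intros)
  ultimately show ?thesis using compact_X by (simp add: compact_Int_closed)
qed

text \<open>
  The strip is the part of \<open>X\<close> near the line through \<open>x\<close> with normal \<open>n\<close>. The factor \<open>4\<close> is the one that
  \<open>bin_cover\<close> introduces when the cover is pushed forward by a map \<open>\<phi>_w\<close>.
\<close>

definition strip_cover :: "real \<Rightarrow> real \<Rightarrow> real \<Rightarrow> real \<Rightarrow> real^2 \<Rightarrow> real^2 \<Rightarrow> bool" where
  "strip_cover \<eta> r0 s \<epsilon> x n \<longleftrightarrow> (\<exists>F. finite F \<and> (\<forall>(c, r)\<in>F. r0 \<le> r \<and> r \<le> 1/8) \<and>
     {z \<in> X. \<bar>n \<bullet> (z - x)\<bar> \<le> \<eta>} \<subseteq> (\<Union>(c, r)\<in>F. ball c r) \<and> (\<Sum>(c, r)\<in>F. (4 * r) powr s) \<le> \<epsilon>)"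

text \<open>
  Finitely many of the covers of \<open>slice_cover_stable\<close> serve all strips, by compactness of the set of
  slices. The exponents may depend on the slice, but only finitely many occur, and their maximum is still
  below \<open>t\<close>; passing to it decreases the sums because the radii are small.
\<close>

lemma uniform_strip_covers:
  assumes small: "\<forall>x\<in>X. \<forall>n\<in>normals. hausdorff_dim (slice X (span {perp n}) x) < t" and \<epsilon>: "\<epsilon> > 0"
  obtains s \<eta> r0 where "s > 0" "ereal s < t" "\<eta> > 0" "r0 > 0"
    "\<forall>x\<in>X. \<forall>n'. (\<exists>n\<in>normals. norm (n' - n) < \<eta>) \<longrightarrow>
       strip_cover \<eta> r0 s \<epsilon> x n'"
proof -
  let ?good = "\<lambda>x n s \<eta> F. s > 0 \<and> ereal s < t \<and> \<eta> > 0 \<and> finite F \<and> (\<forall>(c, r)\<in>F. 0 < r \<and> r \<le> 1/8) \<and>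
     (\<Sum>(c, r)\<in>F. (4 * r) powr s) \<le> \<epsilon> \<and>
     (\<forall>x'\<in>X. \<forall>n'. norm (x' - x) < \<eta> \<and> norm (n' - n) < \<eta> \<longrightarrow>
        {z \<in> X. \<bar>n' \<bullet> (z - x')\<bar> \<le> \<eta>} \<subseteq> (\<Union>(c, r)\<in>F. ball c r))"
  have loc: "\<exists>s \<eta> F. ?good x n s \<eta> F" if x: "x \<in> X" and n: "n \<in> normals" for x n
  proof -
    have n1: "norm n = 1" using n by (simp add: normals_def)
    have hd: "hausdorff_dim (slice X (span {perp n}) x) < t" using small x n by blast
    obtain s where s: "s > 0" "ereal s < t" and cov: "\<forall>\<epsilon>>0. \<exists>F. finite F \<and> (\<forall>(c, r)\<in>F. 0 < r \<and> r \<le> \<epsilon>) \<and>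
       slice X (span {perp n}) x \<subseteq> (\<Union>(c, r)\<in>F. ball c r) \<and> (\<Sum>(c, r)\<in>F. r powr s) \<le> \<epsilon>"
      by (rule compact_cover_of_hausdorff_dim[OF compact_slice[OF n1] hd])
    \<comment> \<open>The factor \<open>4\<close> in the sum comes from \<open>bin_cover\<close>; it costs \<open>4 powr s\<close>.\<close>
    define e where "e = min (1/8) (\<epsilon> / 4 powr s)"
    have e: "e > 0" using \<epsilon> by (simp add: e_def)
    obtain F where F: "finite F" "\<forall>(c, r)\<in>F. 0 < r \<and> r \<le> e"
      "slice X (span {perp n}) x \<subseteq> (\<Union>(c, r)\<in>F. ball c r)" "(\<Sum>(c, r)\<in>F. r powr s) \<le> e"
      using cov[rule_format, OF e] by auto
    have "open (\<Union>(c, r)\<in>F. ball c r)" by (intro open_UN ballI) auto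
    then obtain \<eta> where \<eta>: "\<eta> > 0" "\<forall>x'\<in>X. \<forall>n'. norm (x' - x) < \<eta> \<and> norm (n' - n) < \<eta> \<longrightarrow>
     {z \<in> X. \<bar>n' \<bullet> (z - x')\<bar> \<le> \<eta>} \<subseteq> (\<Union>(c, r)\<in>F. ball c r)"
      by (rule slice_cover_stable[OF x n1 _ F(3)])
    have sum4: "(\<Sum>(c, r)\<in>F. (4 * r) powr s) = (\<Sum>(c, r)\<in>F. 4 powr s * r powr s)"
      using F(2) by (intro sum.cong) (auto simp: powr_mult)
    also have "\<dots> = 4 powr s * (\<Sum>(c, r)\<in>F. r powr s)" by (simp add: sum_distrib_left case_prod_unfold)
    also have "\<dots> \<le> 4 powr s * (\<epsilon> / 4 powr s)" using F(4) by (intro mult_left_mono) (auto simp: e_def)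
    finally have "(\<Sum>(c, r)\<in>F. (4 * r) powr s) \<le> \<epsilon>" by simp
    moreover have "\<forall>(c, r)\<in>F. 0 < r \<and> r \<le> 1/8" using F(2) by (auto simp: e_def)
    ultimately show ?thesis
      by (intro exI[of _ s] exI[of _ \<eta>] exI[of _ F] conjI s \<eta> F(1))
  qed
  have "\<forall>p\<in>X \<times> normals. \<exists>q. ?good (fst p) (snd p) (fst q) (fst (snd q)) (snd (snd q))"
  proof
    fix p assume "p \<in> X \<times> normals"
    then have "\<exists>s \<eta> F. ?good (fst p) (snd p) s \<eta> F" by (intro loc) auto
    then obtain s \<eta> F where "?good (fst p) (snd p) s \<eta> F" by (elim exE)
    then show "\<exists>q. ?good (fst p) (snd p) (fst q) (fst (snd q)) (snd (snd q))"
      by (intro exI[of _ "(s, \<eta>, F)"]) (unfold fst_conv snd_conv)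
  qed
  from bchoice[OF this] obtain h
    where h: "\<forall>p\<in>X \<times> normals. ?good (fst p) (snd p) (fst (h p)) (fst (snd (h p))) (snd (snd (h p)))"
    by (elim exE)
  define s \<eta> F where "s p = fst (h p)" and "\<eta> p = fst (snd (h p))" and "F p = snd (snd (h p))" for p
  have g: "?good (fst p) (snd p) (s p) (\<eta> p) (F p)" if "p \<in> X \<times> normals" for p
    using h that unfolding s_def \<eta>_def F_def by (rule bspec)
  let ?O = "\<lambda>p. ball (fst p) (\<eta> p / 2) \<times> ball (snd p) (\<eta> p / 2)"
  have c1: "compact (X \<times> normals)" by (intro compact_Times compact_X compact_normals)
  have c2: "X \<times> normals \<subseteq> (\<Union>p\<in>X \<times> normals. ?O p)"
  proof
    fix p assume p: "p \<in> X \<times> normals"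
    then have "\<eta> p > 0" using g by blast
    then have "p \<in> ?O p" by (cases p) auto
    then show "p \<in> (\<Union>p\<in>X \<times> normals. ?O p)" using p by blast
  qed
  have c3: "open (?O p)" for p by (intro open_Times open_ball)
  obtain Q where Q: "Q \<subseteq> X \<times> normals" "finite Q" "X \<times> normals \<subseteq> (\<Union>p\<in>Q. ?O p)"
    by (rule compactE_image[OF c1 c3 c2])
  have gQ: "?good (fst p) (snd p) (s p) (\<eta> p) (F p)" if "p \<in> Q" for p
    using g[OF subsetD[OF Q(1) that]] .
  have Q0: "Q \<noteq> {}" using Q(3) X_nonempty normals_nonempty by auto
  define s1 where "s1 = Max (s ` Q)"
  define \<eta>1 where "\<eta>1 = Min ((\<lambda>p. \<eta> p / 2) ` Q)"
  define r1 where "r1 = Min (insert (1/8) (snd ` (\<Union>p\<in>Q. F p)))"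
  have s1: "s1 \<in> s ` Q" "\<And>p. p \<in> Q \<Longrightarrow> s p \<le> s1" unfolding s1_def using Q(2) Q0 by auto
  have "\<forall>x\<in>(\<lambda>p. \<eta> p / 2) ` Q. x > 0" using gQ by simp
  then have "\<eta>1 > 0" unfolding \<eta>1_def using Q(2) Q0 by (subst Min_gr_iff) auto
  moreover have "\<And>p. p \<in> Q \<Longrightarrow> \<eta>1 \<le> \<eta> p / 2" unfolding \<eta>1_def using Q(2) by (intro Min_le) auto
  ultimately have \<eta>1: "\<eta>1 > 0" "\<And>p. p \<in> Q \<Longrightarrow> \<eta>1 \<le> \<eta> p / 2" .
  have fin: "finite (snd ` (\<Union>p\<in>Q. F p))" using Q(2) gQ by auto
  have r1: "r1 > 0" unfolding r1_def using fin gQ by (subst Min_gr_iff) force+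
  have r1': "r1 \<le> r" if "p \<in> Q" "(c, r) \<in> F p" for p c r
    unfolding r1_def using fin that by (intro Min_le) force+
  show ?thesis
  proof (rule that[of s1 \<eta>1 r1])
    show "s1 > 0" "ereal s1 < t" using s1(1) gQ by auto
    show "\<forall>x\<in>X. \<forall>n'. (\<exists>n\<in>normals. norm (n' - n) < \<eta>1) \<longrightarrow>
       strip_cover \<eta>1 r1 s1 \<epsilon> x n'"
    proof (intro ballI allI impI)
      fix x n' assume x: "x \<in> X" and "\<exists>n\<in>normals. norm (n' - n) < \<eta>1"
      then obtain n where n: "n \<in> normals" "norm (n' - n) < \<eta>1" by blast
      obtain p where p: "p \<in> Q" "(x, n) \<in> ?O p" using Q(3) x n(1) by blast
      note gp = gQ[OF p(1)]
      have "norm (x - fst p) < \<eta> p" "norm (n - snd p) < \<eta> p / 2"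
        using p(2) gp by (auto simp: dist_norm norm_minus_commute)
      moreover have "norm (n' - snd p) \<le> norm (n' - n) + norm (n - snd p)"
        using norm_triangle_ineq[of "n' - n" "n - snd p"] by simp
      ultimately have "norm (x - fst p) < \<eta> p \<and> norm (n' - snd p) < \<eta> p" using n(2) \<eta>1(2)[OF p(1)] by linarith
      then have "{z \<in> X. \<bar>n' \<bullet> (z - x)\<bar> \<le> \<eta> p} \<subseteq> (\<Union>(c, r)\<in>F p. ball c r)" using gp x by blast
      moreover have "\<eta>1 \<le> \<eta> p" using \<eta>1(2)[OF p(1)] gp by linarith
      ultimately have "{z \<in> X. \<bar>n' \<bullet> (z - x)\<bar> \<le> \<eta>1} \<subseteq> (\<Union>(c, r)\<in>F p. ball c r)" by force
      moreover have "(\<Sum>(c, r)\<in>F p. (4 * r) powr s1) \<le> (\<Sum>(c, r)\<in>F p. (4 * r) powr s p)"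
        using gp s1(2)[OF p(1)] by (intro sum_mono) (auto intro!: powr_mono')
      then have "(\<Sum>(c, r)\<in>F p. (4 * r) powr s1) \<le> \<epsilon>" using gp by linarith
      moreover have "\<forall>(c, r)\<in>F p. r1 \<le> r \<and> r \<le> 1/8" using gp r1'[OF p(1)] by auto
      ultimately show "strip_cover \<eta>1 r1 s1 \<epsilon> x n'"
        using gp unfolding strip_cover_def by blast
    qed
  qed (use \<eta>1 r1 in auto)
qed

lemma small_\<alpha>2_long_words:
  obtains R0 where "0 < R0" "R0 \<le> 1" "\<forall>w\<in>all_words. \<alpha>2 (W w) < R0 \<longrightarrow> k \<le> length w"
proof -
  obtain L where L: "L \<ge> 1" "\<forall>i\<in>{1..N}. 1 / L \<le> \<alpha>2 (A i)" by (rule letter_bound)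
  have ge: "1 / L ^ length w \<le> \<alpha>2 (W w)" if "w \<in> all_words" for w
    using that
  proof (induction w)
    case (Cons i w)
    have "1 / L ^ length (i # w) = (1 / L) * (1 / L ^ length w)" by simp
    also have "\<dots> \<le> \<alpha>2 (A i) * \<alpha>2 (W w)" using Cons L by (intro mult_mono) auto
    also have "\<dots> \<le> \<alpha>2 (W (i # w))" by (simp add: \<alpha>2_mult_ge)
    finally show ?case .
  qed simp
  have "k \<le> length w" if "w \<in> all_words" "\<alpha>2 (W w) < 1 / L ^ k" for w
  proof (rule ccontr)
    assume "\<not> k \<le> length w"
    then have "L ^ length w \<le> L ^ k" using L(1) by (intro power_increasing) auto
    then have "1 / L ^ k \<le> 1 / L ^ length w" using L(1) by (intro divide_left_mono) auto
    then show False using ge[OF that(1)] that(2) by linarith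
  qed
  then show ?thesis using that[of "1 / L ^ k"] L(1) by auto
qed

lemma small_\<alpha>2_eccentric:
  assumes "\<rho> > 0"
  obtains R0 where "0 < R0" "R0 \<le> 1" "\<forall>w\<in>all_words. \<alpha>2 (W w) < R0 \<longrightarrow> \<alpha>2 (W w) \<le> \<rho> * \<alpha>1 (W w)"
proof -
  obtain k where k: "\<forall>w\<in>all_words. k \<le> length w \<longrightarrow> \<alpha>2 (W w) \<le> \<rho> * \<alpha>1 (W w)" using eccentric_words[OF assms] by blast
  obtain R0 where "0 < R0" "R0 \<le> 1" "\<forall>w\<in>all_words. \<alpha>2 (W w) < R0 \<longrightarrow> k \<le> length w" by (rule small_\<alpha>2_long_words)
  then show ?thesis using that[of R0] k by blast
qed

lemma butlast_\<alpha>: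
  assumes L: "L \<ge> 1" "\<forall>i\<in>{1..N}. 1 / L \<le> \<alpha>2 (A i)" and w: "w \<in> words N"
  shows "\<alpha>2 (W (butlast w)) \<le> L * \<alpha>2 (W w)" "\<alpha>1 (W (butlast w)) \<le> L * \<alpha>1 (W w)"
proof -
  let ?v = "butlast w" and ?i = "last w"
  have "w \<noteq> []" "set w \<subseteq> {1..N}" using w by (auto simp: words_def)
  then have w': "w = ?v @ [?i]" by simp
  have w'': "?i \<in> {1..N}" using \<open>set w \<subseteq> {1..N}\<close> last_in_set[OF \<open>w \<noteq> []\<close>] by (rule subsetD)
  have W: "W w = W ?v ** A ?i" by (subst w') simp
  have i: "1 / L \<le> \<alpha>2 (A ?i)" using L(2) w'' by blast
  have "\<alpha>2 (W ?v) * (1 / L) \<le> \<alpha>2 (W ?v) * \<alpha>2 (A ?i)" using i by (rule mult_left_mono) simp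
  also have "\<dots> \<le> \<alpha>2 (W w)" unfolding W by (rule \<alpha>2_mult_ge)
  finally show "\<alpha>2 (W ?v) \<le> L * \<alpha>2 (W w)" using L(1) by (simp add: field_simps)
  have "\<alpha>1 (W ?v) * (1 / L) \<le> \<alpha>1 (W ?v) * \<alpha>2 (A ?i)" using i by (rule mult_left_mono) simp
  also have "\<dots> \<le> \<alpha>1 (W w)" unfolding W by (rule \<alpha>1_mult_ge)
  finally show "\<alpha>1 (W ?v) \<le> L * \<alpha>1 (W w)" using L(1) by (simp add: field_simps)
qed

end

lemma norm_le_orthonormal:
  assumes "norm e = 1" "e' = perp e \<or> e' = - perp e"
  shows "norm v \<le> \<bar>e \<bullet> v\<bar> + \<bar>e' \<bullet> v\<bar>"
proof -
  have "\<bar>e' \<bullet> v\<bar> = \<bar>perp e \<bullet> v\<bar>" using assms(2) by auto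
  moreover have "(norm v)\<^sup>2 \<le> (\<bar>e \<bullet> v\<bar> + \<bar>perp e \<bullet> v\<bar>)\<^sup>2"
    unfolding perp_decomp(2)[OF assms(1), of v] by (simp add: power2_sum)
  ultimately show ?thesis by (intro power2_le_imp_le[of "norm v"]) auto
qed

locale wbnc_ifs = dominated_ifs +
  assumes wbnc: "weak_bounded_neighborhood N A b X"
begin

lemma neighborhood_count:
  obtains K where "K > 0" "\<forall>x\<in>X. \<forall>r>0. finite (neighborhood_maps N A b X x r) \<and>
     real (card (neighborhood_maps N A b X x r)) \<le> K"
proof -
  obtain K :: nat where K: "\<forall>x\<in>X. \<forall>r>0. finite (neighborhood_maps N A b X x r) \<and>
     card (neighborhood_maps N A b X x r) \<le> K" using wbnc unfolding weak_bounded_neighborhood_def by blast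
  show ?thesis
  proof (rule that[of "real K + 1"]; (intro ballI allI impI conjI)?)
    fix x and r :: real assume "x \<in> X" "r > 0"
    then have "finite (neighborhood_maps N A b X x r)" "card (neighborhood_maps N A b X x r) \<le> K" using K by auto
    then show "finite (neighborhood_maps N A b X x r)" "real (card (neighborhood_maps N A b X x r)) \<le> real K + 1"
      by linarith+
  qed simp
qed

lemma neighborhood_maps_cover:
  assumes "y \<in> X" "0 < R" "R < 1" "z \<in> X" "dist y z \<le> R"
  shows "\<exists>g\<in>neighborhood_maps N A b X y R. z \<in> g ` X"
proof -
  obtain k where k: "\<forall>w\<in>all_words. length w = k \<longrightarrow> \<alpha>1 (W w) \<le> R" using small_words[OF assms(2)] by blast
  have "\<alpha>2 (W w) \<le> R" if "w \<in> all_words" "length w = k" for w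
    using k that \<alpha>2_le_\<alpha>1[of "W w"] by force
  then obtain w where w: "w \<in> words N" "z \<in> \<phi> w ` X" "\<alpha>2 (W w) \<le> R" "R < \<alpha>2 (W (butlast w))"
    using stopping_word[of z R "\<lambda>w. \<alpha>2 (W w)" k] assms by auto
  have "\<phi> w ` X \<inter> cball y R \<noteq> {}" using w(2) assms(5) by auto
  then have "\<phi> w \<in> neighborhood_maps N A b X y R" unfolding neighborhood_maps_def using w by blast
  then show ?thesis using w(2) by blast
qed

text \<open>
  Each of the at most \<open>K\<close> cylinders that meet \<open>cball y R\<close> is pulled back to a strip, covered by
  \<open>uniform_strip_covers\<close> and pushed forward again; \<open>bin_cover\<close> cuts the image of a ball of radius \<open>r\<close>
  into \<open>2 / r\<close> pieces of relative radius \<open>4 * r\<close>.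
\<close>

lemma assouad_dim_le_slice:
  obtains x n where "x \<in> X" "n \<in> normals" "assouad_dim X \<le> 1 + hausdorff_dim (slice X (span {perp n}) x)"
proof -
  have "\<exists>x\<in>X. \<exists>n\<in>normals. assouad_dim X \<le> 1 + hausdorff_dim (slice X (span {perp n}) x)"
  proof (rule ccontr)
    assume "\<not> ?thesis"
    then have "\<forall>x\<in>X. \<forall>n\<in>normals. 1 + hausdorff_dim (slice X (span {perp n}) x) < assouad_dim X" by (simp add: not_le)
    then have small: "\<forall>x\<in>X. \<forall>n\<in>normals. hausdorff_dim (slice X (span {perp n}) x) < assouad_dim X - 1"
      by (simp add: ereal_less_minus add.commute)
    obtain K where K: "K > 0" "\<forall>x\<in>X. \<forall>r>0. finite (neighborhood_maps N A b X x r) \<and>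
       real (card (neighborhood_maps N A b X x r)) \<le> K" by (rule neighborhood_count)
    \<comment> \<open>Here \<open>8\<close> arises as \<open>(2 / r) * (4 * r) powr (1 + s) = 8 * (4 * r) powr s\<close>.\<close>
    have "1 / (8 * K) > 0" using K(1) by simp
    then obtain s \<eta> r0 where s: "s > 0" "ereal s < assouad_dim X - 1" and \<eta>: "\<eta> > 0" and r0: "r0 > 0" and
      cov: "\<forall>x\<in>X. \<forall>n'. (\<exists>n\<in>normals. norm (n' - n) < \<eta>) \<longrightarrow>
       strip_cover \<eta> r0 s (1 / (8 * K)) x n'"
      by (rule uniform_strip_covers[OF small])
    obtain L where L: "L \<ge> 1" "\<forall>i\<in>{1..N}. 1 / L \<le> \<alpha>2 (A i)" by (rule letter_bound)
    obtain \<rho> where \<rho>: "\<rho> > 0" "\<forall>w f. w \<in> words N \<and> norm f = 1 \<and> norm (W w *v perp f) \<le> \<rho> * \<alpha>1 (W w) \<longrightarrow>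
       (\<exists>n\<in>normals. norm (f - n) < \<eta>)" by (rule near_normals[OF \<eta>])
    \<comment> \<open>With this eccentricity the pulled back ball lies in a strip of half width \<open>\<eta>\<close>, in almost the right direction.\<close>
    have "min \<rho> (\<eta> / (2 * L)) > 0" using \<rho> \<eta> L by simp
    then obtain R0 where R0: "0 < R0" "R0 \<le> 1"
      "\<forall>w\<in>all_words. \<alpha>2 (W w) < R0 \<longrightarrow> \<alpha>2 (W w) \<le> min \<rho> (\<eta> / (2 * L)) * \<alpha>1 (W w)"
      by (rule small_\<alpha>2_eccentric)
    define m where "m = min (4 * r0) 1"
    have m: "0 < m" "m \<le> 1" "m \<le> 4 * r0" using r0 by (auto simp: m_def)
    have piece: "relative_cover X m (1 + s) R (1 / K) (g ` X \<inter> cball y R)"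
      if y: "y \<in> X" and R: "0 < R" "R < R0" and g: "g \<in> neighborhood_maps N A b X y R" for y R g
    proof -
      obtain w where w: "w \<in> words N" "g = \<phi> w" "\<alpha>2 (W w) \<le> R" "R < \<alpha>2 (W (butlast w))" "\<phi> w ` X \<inter> cball y R \<noteq> {}"
        using g unfolding neighborhood_maps_def by blast
      have wa: "w \<in> all_words" using w(1) by (simp add: words_iff)
      have ecc: "\<alpha>2 (W w) \<le> min \<rho> (\<eta> / (2 * L)) * \<alpha>1 (W w)" using R0(3) wa w(3) R(2) by force
      have a1: "\<alpha>1 (W w) > 0" using W_pos wa by blast
      obtain f e e' where f: "norm f = 1" "norm e = 1" "e' = perp e \<or> e' = - perp e"
        "\<forall>v. e \<bullet> (W w *v v) = \<alpha>1 (W w) * (f \<bullet> v)" "\<forall>v. e' \<bullet> (W w *v v) = \<alpha>2 (W w) * (perp f \<bullet> v)"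
        "norm (W w *v perp f) = \<alpha>2 (W w)" using singular_value_decomposition by metis
      have "\<alpha>2 (W w) \<le> \<rho> * \<alpha>1 (W w)"
        using ecc mult_right_mono[of "min \<rho> (\<eta> / (2 * L))" \<rho> "\<alpha>1 (W w)"] by simp
      then have near: "\<exists>n\<in>normals. norm (f - n) < \<eta>" using \<rho>(2)[rule_format, of w f] w(1) f(1,6) by simp
      have strip: "2 * R \<le> \<eta> * \<alpha>1 (W w)"
      proof -
        have "\<alpha>2 (W w) \<le> (\<eta> / (2 * L)) * \<alpha>1 (W w)"
          using ecc mult_right_mono[of "min \<rho> (\<eta> / (2 * L))" "\<eta> / (2 * L)" "\<alpha>1 (W w)"] by simp
        then have "2 * (L * \<alpha>2 (W w)) \<le> \<eta> * \<alpha>1 (W w)" using L(1) by (simp add: field_simps)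
        moreover have "R \<le> L * \<alpha>2 (W w)" using w(4) butlast_\<alpha>(1)[OF L w(1)] by linarith
        ultimately show ?thesis by linarith
      qed
      obtain x where x: "x \<in> X" "dist y (\<phi> w x) \<le> R" using w(5) by auto
      obtain F where F: "finite F" "\<forall>(c, r)\<in>F. r0 \<le> r \<and> r \<le> 1/8"
        "{z \<in> X. \<bar>f \<bullet> (z - x)\<bar> \<le> \<eta>} \<subseteq> (\<Union>(c, r)\<in>F. ball c r)" "(\<Sum>(c, r)\<in>F. (4 * r) powr s) \<le> 1 / (8 * K)"
        using cov[rule_format, OF x(1) near] unfolding strip_cover_def by blast
      define S where "S = (\<lambda>(c, r). \<phi> w ` (X \<inter> ball c r) \<inter> cball y R)"
      have "\<exists>Z. finite Z \<and> Z \<subseteq> S (c, r) \<and> real (card Z) \<le> 2 / r \<and> S (c, r) \<subseteq> (\<Union>z\<in>Z. cball z (4 * r * R))"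
        if cr: "(c, r) \<in> F" for c r
      proof -
        have r: "0 < r" "r \<le> 1/8" using F(2) cr r0 by auto
        have bnd: "\<bar>e \<bullet> (p - y)\<bar> \<le> R" if "p \<in> S (c, r)" for p
          using that f(2) Cauchy_Schwarz_ineq2[of e "p - y"] by (auto simp: S_def dist_norm norm_minus_commute)
        have clo: "dist p q \<le> 4 * r * R"
          if pq: "p \<in> S (c, r)" "q \<in> S (c, r)" and h: "\<bar>e \<bullet> (p - y) - e \<bullet> (q - y)\<bar> \<le> 2 * r * R" for p q
        proof -
          obtain z z' where z: "p = \<phi> w z" "q = \<phi> w z'" "z \<in> ball c r" "z' \<in> ball c r" using pq by (auto simp: S_def)
          have "norm (z - z') \<le> 2 * r"
            using z(3,4) dist_triangle3[of z z' c] by (simp add: dist_norm)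
          then have "\<bar>perp f \<bullet> (z - z')\<bar> \<le> 2 * r" using Cauchy_Schwarz_ineq2[of "perp f" "z - z'"] f(1) by simp
          then have "\<alpha>2 (W w) * \<bar>perp f \<bullet> (z - z')\<bar> \<le> R * (2 * r)" using w(3) R(1) by (intro mult_mono) auto
          then have "\<bar>e' \<bullet> (p - q)\<bar> \<le> 2 * r * R" unfolding z(1,2) word_map_diff using f(5) by (simp add: abs_mult mult_ac)
          moreover have "\<bar>e \<bullet> (p - q)\<bar> \<le> 2 * r * R" using h by (simp add: inner_diff_right)
          ultimately show ?thesis using norm_le_orthonormal[OF f(2,3), of "p - q"] by (simp add: dist_norm)
        qed
        show ?thesis by (rule bin_cover[OF R(1) r bnd clo]) (assumption | blast)+
      qed
      then have "\<forall>p\<in>F. \<exists>Z. finite Z \<and> Z \<subseteq> S p \<and> real (card Z) \<le> 2 / snd p \<and> S p \<subseteq> (\<Union>z\<in>Z. cball z (4 * snd p * R))"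
        by (intro ballI) (simp only: split_paired_all snd_conv)
      from bchoice[OF this] obtain Z where Z': "\<forall>p\<in>F. finite (Z p) \<and> Z p \<subseteq> S p \<and>
          real (card (Z p)) \<le> 2 / snd p \<and> S p \<subseteq> (\<Union>z\<in>Z p. cball z (4 * snd p * R))" by (elim exE)
      have Z: "finite (Z (c, r)) \<and> Z (c, r) \<subseteq> S (c, r) \<and>
          real (card (Z (c, r))) \<le> 2 / r \<and> S (c, r) \<subseteq> (\<Union>z\<in>Z (c, r). cball z (4 * r * R))"
        if "(c, r) \<in> F" for c r using bspec[OF Z' that] by (simp only: snd_conv)
      define P where "P = (\<Union>p\<in>F. Z p \<times> {4 * snd p})"
      have "finite P" unfolding P_def using F(1) Z by (intro finite_UN_I) auto
      moreover have "P \<subseteq> X \<times> {m..1/2}"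
      proof
        fix p assume "p \<in> P"
        then obtain c r z where cr: "(c, r) \<in> F" "z \<in> Z (c, r)" "p = (z, 4 * r)" by (auto simp: P_def)
        have "z \<in> S (c, r)" using Z cr by blast
        then have "z \<in> X" using \<phi>_mem[OF wa] by (auto simp: S_def)
        then show "p \<in> X \<times> {m..1/2}" using cr F(2) m(3) by force
      qed
      moreover have "g ` X \<inter> cball y R \<subseteq> (\<Union>(z, \<rho>)\<in>P. cball z (\<rho> * R))"
      proof
        fix p assume p: "p \<in> g ` X \<inter> cball y R"
        then obtain z where z: "z \<in> X" "p = \<phi> w z" using w(2) by auto
        have "dist (\<phi> w z) (\<phi> w x) \<le> 2 * R" using p z(2) x(2) dist_triangle3[of "\<phi> w z" "\<phi> w x" y] by simp
        then have "norm (W w *v (z - x)) \<le> 2 * R" by (simp add: dist_norm word_map_diff)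
        then have "\<bar>e \<bullet> (W w *v (z - x))\<bar> \<le> 2 * R" using Cauchy_Schwarz_ineq2[of e "W w *v (z - x)"] f(2) by simp
        then have "\<alpha>1 (W w) * \<bar>f \<bullet> (z - x)\<bar> \<le> \<eta> * \<alpha>1 (W w)" using strip f(4) by (simp add: abs_mult)
        then have "\<bar>f \<bullet> (z - x)\<bar> \<le> \<eta>" using a1 by (simp add: mult.commute)
        then obtain c r where cr: "(c, r) \<in> F" "z \<in> ball c r" using F(3) z(1) by blast
        then have "p \<in> S (c, r)" using z p by (auto simp: S_def)
        then obtain q where q: "q \<in> Z (c, r)" "p \<in> cball q (4 * r * R)" using Z[OF cr(1)] by blast
        have "(q, 4 * r) \<in> P" using cr(1) q(1) by (force simp: P_def)
        then show "p \<in> (\<Union>(z, \<rho>)\<in>P. cball z (\<rho> * R))" using q(2) by blast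
      qed
      moreover have "(\<Sum>(z, \<rho>)\<in>P. \<rho> powr (1 + s)) \<le> 1 / K"
      proof -
        have "(\<Sum>(z, \<rho>)\<in>P. \<rho> powr (1 + s)) \<le> (\<Sum>p\<in>F. \<Sum>(z, \<rho>)\<in>Z p \<times> {4 * snd p}. \<rho> powr (1 + s))"
          unfolding P_def using F(1) Z by (intro sum_UN_le) auto
        also have "\<dots> \<le> (\<Sum>(c, r)\<in>F. 8 * (4 * r) powr s)"
        proof (rule sum_mono)
          fix p assume p: "p \<in> F"
          obtain c r where pc: "p = (c, r)" by (cases p)
          have r: "r > 0" using F(2) p pc r0 by auto
          have "(\<Sum>(z, \<rho>)\<in>Z p \<times> {4 * snd p}. \<rho> powr (1 + s)) = real (card (Z p)) * (4 * r) powr (1 + s)"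
            by (simp add: sum.cartesian_product[symmetric] pc)
          also have "\<dots> \<le> (2 / r) * (4 * r) powr (1 + s)" using Z p pc by (intro mult_right_mono) auto
          also have "\<dots> = 8 * (4 * r) powr s" using r by (simp add: powr_add)
          finally show "(\<Sum>(z, \<rho>)\<in>Z p \<times> {4 * snd p}. \<rho> powr (1 + s)) \<le> (case p of (c, r) \<Rightarrow> 8 * (4 * r) powr s)"
            by (simp add: pc)
        qed
        also have "\<dots> = 8 * (\<Sum>(c, r)\<in>F. (4 * r) powr s)" by (simp add: sum_distrib_left case_prod_unfold)
        also have "\<dots> \<le> 8 * (1 / (8 * K))" using F(4) by (intro mult_left_mono) auto
        finally show ?thesis by simp
      qed
      ultimately show ?thesis unfolding relative_cover_def by blast
    qed
    have "assouad_dim X \<le> ereal (1 + s)"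
    proof (rule assouad_dim_leI[OF compact_imp_bounded[OF compact_X] _ R0(1) m(1,2)])
      show "1 + s > 0" using s by simp
      fix y R assume y: "y \<in> X" and R: "0 < R" "R < R0"
      let ?G = "neighborhood_maps N A b X y R"
      have G: "finite ?G" "real (card ?G) \<le> K" using K(2) y R by auto
      obtain P where P: "\<And>g. g \<in> ?G \<Longrightarrow> finite (P g) \<and> P g \<subseteq> X \<times> {m..1/2} \<and>
          g ` X \<inter> cball y R \<subseteq> (\<Union>(z, \<rho>)\<in>P g. cball z (\<rho> * R)) \<and> (\<Sum>(z, \<rho>)\<in>P g. \<rho> powr (1 + s)) \<le> 1 / K"
        using piece[OF y R] unfolding relative_cover_def by metis
      let ?P = "\<Union>g\<in>?G. P g"
      have "(\<Sum>(z, \<rho>)\<in>?P. \<rho> powr (1 + s)) \<le> (\<Sum>g\<in>?G. \<Sum>(z, \<rho>)\<in>P g. \<rho> powr (1 + s))"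
        using G(1) P by (intro sum_UN_le) auto
      also have "\<dots> \<le> (\<Sum>g\<in>?G. 1 / K)" using P by (intro sum_mono) blast
      also have "\<dots> = real (card ?G) * (1 / K)" by simp
      also have "\<dots> \<le> K * (1 / K)" using G(2) K(1) by (intro mult_right_mono) auto
      finally have "(\<Sum>(z, \<rho>)\<in>?P. \<rho> powr (1 + s)) \<le> 1" using K(1) by simp
      moreover have "X \<inter> cball y R \<subseteq> (\<Union>(z, \<rho>)\<in>?P. cball z (\<rho> * R))"
      proof
        fix p assume p: "p \<in> X \<inter> cball y R"
        then obtain g where g: "g \<in> ?G" "p \<in> g ` X" using neighborhood_maps_cover[OF y R(1), of p] R R0(2) by auto
        then have "p \<in> (\<Union>(z, \<rho>)\<in>P g. cball z (\<rho> * R))" using P p by blast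
        then show "p \<in> (\<Union>(z, \<rho>)\<in>?P. cball z (\<rho> * R))" using g(1) by blast
      qed
      moreover have "finite ?P" using G(1) P by (intro finite_UN_I) auto
      moreover have "?P \<subseteq> X \<times> {m..1/2}" using P by blast
      ultimately show "relative_cover X m (1 + s) R 1 (X \<inter> cball y R)"
        unfolding relative_cover_def by blast
    qed
    moreover have "ereal (1 + s) < assouad_dim X"
      using s(2) by (simp add: ereal_less_minus add.commute one_ereal_def)
    ultimately show False by simp
  qed
  then show ?thesis using that by blast
qed

end

section \<open>Projections\<close>

context dominated_ifs
begin

text \<open>
  The directions \<open>n\<close> in which, at some scale, the projection of \<open>X\<close> is covered by very few intervals.
\<close>

definition thin_normals :: "real \<Rightarrow> nat \<Rightarrow> (real^2) set" where
  "thin_normals t m = {n \<in> normals. \<exists>\<delta> F. 0 < \<delta> \<and> finite F \<and> real (card F) * real m < \<delta> powr (- t) \<and>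
     (\<forall>x\<in>X. \<exists>q\<in>F. \<bar>n \<bullet> x - q\<bar> < \<delta>)}"

lemma thin_normalsI:
  assumes "n \<in> normals" "0 < \<delta>" "finite F" "real (card F) * real m < \<delta> powr (- t)"
    "\<And>x. x \<in> X \<Longrightarrow> \<exists>q\<in>F. \<bar>n \<bullet> x - q\<bar> < \<delta>"
  shows "n \<in> thin_normals t m"
  using assms unfolding thin_normals_def by blast

lemma thin_normalsE:
  assumes "n \<in> thin_normals t m"
  obtains \<delta> F where "n \<in> normals" "0 < \<delta>" "finite F" "F \<noteq> {}" "real (card F) * real m < \<delta> powr (- t)"
    "\<forall>x\<in>X. \<exists>q\<in>F. \<bar>n \<bullet> x - q\<bar> < \<delta>"
proof -
  obtain \<delta> F where n: "n \<in> normals" "0 < \<delta>" "finite F" "real (card F) * real m < \<delta> powr (- t)"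
    "\<forall>x\<in>X. \<exists>q\<in>F. \<bar>n \<bullet> x - q\<bar> < \<delta>" using assms unfolding thin_normals_def by blast
  moreover have "F \<noteq> {}" using n(5) X_nonempty by auto
  ultimately show ?thesis using that by blast
qed

lemma thin_normals_uminus:
  assumes "n \<in> thin_normals t m"
  shows "- n \<in> thin_normals t m"
proof -
  obtain \<delta> F where n: "n \<in> normals" "0 < \<delta>" "finite F" "F \<noteq> {}" "real (card F) * real m < \<delta> powr (- t)"
    "\<forall>x\<in>X. \<exists>q\<in>F. \<bar>n \<bullet> x - q\<bar> < \<delta>" using assms by (rule thin_normalsE)
  show ?thesis
  proof (rule thin_normalsI[OF normals_uminus[OF n(1)] n(2), of "uminus ` F"])
    show "real (card (uminus ` F)) * real m < \<delta> powr (- t)" using n(5) by (simp add: card_image)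
    fix x assume "x \<in> X"
    then obtain q where "q \<in> F" "\<bar>n \<bullet> x - q\<bar> < \<delta>" using n(6) by blast
    then show "\<exists>q\<in>uminus ` F. \<bar>- n \<bullet> x - q\<bar> < \<delta>" by (intro bexI[of _ "- q"]) auto
  qed (use n in auto)
qed

text \<open>
  The cardinality bound is strict, so it allows slightly longer intervals, which stay a cover for nearby \<open>n\<close>.
\<close>

lemma openin_thin_normals:
  assumes t: "t > 0" and m: "m > 0"
  shows "openin (top_of_set normals) (thin_normals t m)"
  unfolding openin_euclidean_subtopology_iff
proof (intro conjI ballI)
  show "thin_normals t m \<subseteq> normals" by (auto simp: thin_normals_def)
  fix n assume "n \<in> thin_normals t m"
  then obtain \<delta> F where n: "n \<in> normals" "0 < \<delta>" "finite F" "F \<noteq> {}" "real (card F) * real m < \<delta> powr (- t)"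
    "\<forall>x\<in>X. \<exists>q\<in>F. \<bar>n \<bullet> x - q\<bar> < \<delta>" by (rule thin_normalsE)
  define k where "k = real (card F) * real m"
  have k: "k > 0" using n(3,4) m by (simp add: k_def card_gt_0_iff)
  have "\<delta> < k powr (- (1 / t))"
  proof -
    have "(\<delta> powr (- t)) powr (- (1 / t)) < k powr (- (1 / t))"
      using n(5) k t unfolding k_def[symmetric] by (intro powr_less_mono2_neg) auto
    then show ?thesis using n(2) t by (simp add: powr_powr)
  qed
  then obtain \<delta>' where \<delta>': "\<delta> < \<delta>'" "\<delta>' < k powr (- (1 / t))" using dense by blast
  have "(k powr (- (1 / t))) powr (- t) < \<delta>' powr (- t)"
    using \<delta>' n(2) t by (intro powr_less_mono2_neg) auto
  then have k': "k < \<delta>' powr (- t)" using k t by (simp add: powr_powr)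
  obtain M where M: "M > 0" "\<forall>z\<in>X. norm z \<le> M" using compact_imp_bounded[OF compact_X] by (auto simp: bounded_pos)
  show "\<exists>e>0. \<forall>n'\<in>normals. dist n' n < e \<longrightarrow> n' \<in> thin_normals t m"
  proof (intro exI[of _ "(\<delta>' - \<delta>) / M"] conjI ballI impI)
    show "(\<delta>' - \<delta>) / M > 0" using \<delta>' M by simp
    fix n' assume n': "n' \<in> normals" "dist n' n < (\<delta>' - \<delta>) / M"
    show "n' \<in> thin_normals t m"
    proof (rule thin_normalsI[OF n'(1) _ n(3)])
      show "0 < \<delta>'" using \<delta>' n(2) by simp
      show "real (card F) * real m < \<delta>' powr (- t)" using k' by (simp add: k_def)
      fix x assume x: "x \<in> X"
      then obtain q where q: "q \<in> F" "\<bar>n \<bullet> x - q\<bar> < \<delta>" using n(6) by blast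
      have "\<bar>(n' - n) \<bullet> x\<bar> \<le> norm (n' - n) * norm x" by (rule Cauchy_Schwarz_ineq2)
      also have "\<dots> \<le> (\<delta>' - \<delta>) / M * M" using n'(2) M x \<delta>' by (intro mult_mono) (auto simp: dist_norm)
      finally have "\<bar>(n' - n) \<bullet> x\<bar> \<le> \<delta>' - \<delta>" using M by simp
      moreover have "n' \<bullet> x - q = (n' - n) \<bullet> x + (n \<bullet> x - q)" by (simp add: inner_diff_left)
      ultimately have "\<bar>n' \<bullet> x - q\<bar> < \<delta>'" using q(2) by linarith
      then show "\<exists>q\<in>F. \<bar>n' \<bullet> x - q\<bar> < \<delta>'" using q(1) by blast
    qed
  qed
qed

lemma inner_\<phi>: "n \<bullet> \<phi> w x = (transpose (W w) *v n) \<bullet> x + n \<bullet> \<phi> w 0"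
proof -
  have "\<phi> w x = W w *v x + \<phi> w 0" using word_map_diff[of A b w x 0] by (simp add: algebra_simps)
  moreover have "n \<bullet> (W w *v x) = (transpose (W w) *v n) \<bullet> x"
    by (metis dot_lmul_matrix transpose_matrix_vector)
  ultimately show ?thesis by (simp add: inner_add_right)
qed

text \<open>
  The projection of \<open>\<phi>_w(X)\<close> in the direction \<open>n\<close> is a similar copy of the projection of \<open>X\<close> in the
  direction of \<open>A_w\<^sup>T n\<close>. So a thin normal \<open>n\<close> makes \<open>A_w\<^sup>T n\<close> thin, up to a constant that depends only
  on \<open>w\<close>, and by \<open>transpose_words_dense\<close> this direction can be brought near any given one.
\<close>

lemma thin_normals_dense:
  assumes t: "t > 0" and ne: "\<forall>m>0. thin_normals t m \<noteq> {}" and m: "m > 0"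
  shows "normals \<subseteq> closure (thin_normals t m)"
proof
  fix n0 assume n0: "n0 \<in> normals"
  show "n0 \<in> closure (thin_normals t m)"
    unfolding closure_approachable
  proof (intro allI impI)
    fix e :: real assume "e > 0"
    then obtain w where w: "w \<in> words N" "\<forall>n\<in>normals. \<exists>m\<in>{n0, - n0}.
       norm ((transpose (W w) *v n) /\<^sub>R norm (transpose (W w) *v n) - m) < e"
      by (rule transpose_words_dense[OF n0])
    have wa: "w \<in> all_words" using w(1) by (simp add: words_iff)
    obtain c where c: "0 < c" "\<forall>n\<in>normals. \<forall>w\<in>all_words. c * \<alpha>1 (W w) \<le> norm (transpose (W w) *v n) \<and>
      (transpose (W w) *v n) /\<^sub>R norm (transpose (W w) *v n) \<in> normals" by (rule normals_transpose)
    define a where "a = c * \<alpha>1 (W w)"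
    have a: "a > 0" using c(1) W_pos(1)[OF wa] by (simp add: a_def)
    obtain m' :: nat where "real m / a powr t < real m'" using reals_Archimedean2 by blast
    then have m': "real m < real m' * a powr t" using a by (simp add: divide_less_eq)
    then have "m' > 0" by (cases m') auto
    then obtain n where "n \<in> thin_normals t m'" using ne by blast
    then obtain \<delta> F where n: "n \<in> normals" "0 < \<delta>" "finite F" "F \<noteq> {}" "real (card F) * real m' < \<delta> powr (- t)"
      "\<forall>x\<in>X. \<exists>q\<in>F. \<bar>n \<bullet> x - q\<bar> < \<delta>" by (rule thin_normalsE)
    define p where "p = transpose (W w) *v n"
    have p: "a \<le> norm p" "p /\<^sub>R norm p \<in> normals" using c(2) n(1) wa by (auto simp: p_def a_def)
    have pp: "norm p > 0" using p(1) a by linarith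
    have thin: "p /\<^sub>R norm p \<in> thin_normals t m"
    proof (rule thin_normalsI[OF p(2), of "\<delta> / norm p" "(\<lambda>q. (q - n \<bullet> \<phi> w 0) / norm p) ` F"])
      have "real (card ((\<lambda>q. (q - n \<bullet> \<phi> w 0) / norm p) ` F)) * real m \<le> real (card F) * (real m' * a powr t)"
        using m' n(3) by (intro mult_mono) (auto intro: card_image_le)
      also have "\<dots> = (real (card F) * real m') * a powr t" by simp
      also have "\<dots> < \<delta> powr (- t) * a powr t" using n(5) a by (intro mult_strict_right_mono) auto
      also have "\<dots> \<le> \<delta> powr (- t) * norm p powr t" using p(1) a t by (intro mult_left_mono powr_mono2) auto
      also have "\<dots> = (\<delta> / norm p) powr (- t)" using n(2) pp by (simp add: powr_divide powr_minus_divide)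
      finally show "real (card ((\<lambda>q. (q - n \<bullet> \<phi> w 0) / norm p) ` F)) * real m < (\<delta> / norm p) powr (- t)" .
      fix x assume "x \<in> X"
      then obtain q where q: "q \<in> F" "\<bar>n \<bullet> \<phi> w x - q\<bar> < \<delta>" using n(6) \<phi>_mem[OF wa] by blast
      have "(p /\<^sub>R norm p) \<bullet> x - (q - n \<bullet> \<phi> w 0) / norm p = (n \<bullet> \<phi> w x - q) / norm p"
        unfolding inner_\<phi>[of n w x] p_def[symmetric] by (simp add: divide_inverse algebra_simps)
      then have "\<bar>(p /\<^sub>R norm p) \<bullet> x - (q - n \<bullet> \<phi> w 0) / norm p\<bar> < \<delta> / norm p"
        using q(2) pp by (simp add: divide_strict_right_mono)
      then show "\<exists>q\<in>(\<lambda>q. (q - n \<bullet> \<phi> w 0) / norm p) ` F. \<bar>(p /\<^sub>R norm p) \<bullet> x - q\<bar> < \<delta> / norm p"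
        using q(1) by blast
    qed (use n pp in auto)
    obtain k where k: "k \<in> {n0, - n0}" "norm (p /\<^sub>R norm p - k) < e" using w(2) n(1) unfolding p_def by blast
    show "\<exists>y\<in>thin_normals t m. dist y n0 < e"
    proof (cases "k = n0")
      case True
      then show ?thesis using thin k(2) by (intro bexI[of _ "p /\<^sub>R norm p"]) (auto simp: dist_norm)
    next
      case False
      then have "k = - n0" using k(1) by auto
      then have "norm (- (p /\<^sub>R norm p) - n0) < e" using k(2) by (metis minus_diff_minus minus_minus norm_minus_cancel)
      then show ?thesis using thin_normals_uminus[OF thin] by (intro bexI[of _ "- (p /\<^sub>R norm p)"]) (auto simp: dist_norm)
    qed
  qed
qed

text \<open>
  Otherwise all sets \<open>thin_normals t m\<close> would be nonempty, hence open and dense. By Baire's theorem they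
  would have a common element, for which the projection has \<open>t\<close>-dimensional Hausdorff measure \<open>0\<close>,
  although its dimension is \<open>1\<close>.
\<close>

lemma uniform_projection_count:
  assumes proj: "\<forall>V\<in>backward_furstenberg N A. hausdorff_dim (orth_proj (V\<^sup>\<bottom>) ` X) = 1"
    and t: "0 < t" "t < 1"
  obtains c where "c > 0" "\<forall>n\<in>normals. \<forall>\<delta>>0. \<forall>F. finite F \<and> (\<forall>x\<in>X. \<exists>q\<in>F. \<bar>n \<bullet> x - q\<bar> < \<delta>) \<longrightarrow>
     c * \<delta> powr (- t) \<le> real (card F)"
proof -
  have "\<exists>m>0. thin_normals t m = {}"
  proof (rule ccontr)
    assume "\<not> ?thesis"
    then have ne: "\<forall>m>0. thin_normals t m \<noteq> {}" by blast
    have "normals \<subseteq> closure (\<Inter> (thin_normals t ` {0<..}))"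
      using openin_thin_normals[OF t(1)] thin_normals_dense[OF t(1) ne]
      by (intro Baire compact_imp_closed compact_normals) auto
    then have "\<Inter> (thin_normals t ` {0<..}) \<noteq> {}" using normals_nonempty by auto
    then obtain n where n: "\<And>m. m > 0 \<Longrightarrow> n \<in> thin_normals t m" by auto
    have nN: "n \<in> normals" using n[of 1] by (simp add: thin_normals_def)
    then have n1: "norm n = 1" by (simp add: normals_def)
    let ?E = "orth_proj ((span {perp n})\<^sup>\<bottom>) ` X"
    have "hausdorff_measure t ?E = 0"
    proof (rule hausdorff_measure_zeroI[OF t(1)])
      fix \<epsilon> :: real assume \<epsilon>: "\<epsilon> > 0"
      obtain m :: nat where "max (1 / \<epsilon>) (\<epsilon> powr (- t)) < real m" using reals_Archimedean2 by blast
      then have m: "1 / \<epsilon> < real m" "\<epsilon> powr (- t) < real m" by auto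
      have mp: "real m > 0" using m(1) \<epsilon> by (meson order.strict_trans zero_less_divide_1_iff)
      then have "n \<in> thin_normals t m" using n by simp
      then obtain \<delta> F where F: "0 < \<delta>" "finite F" "F \<noteq> {}" "real (card F) * real m < \<delta> powr (- t)"
        "\<forall>x\<in>X. \<exists>q\<in>F. \<bar>n \<bullet> x - q\<bar> < \<delta>" by (rule thin_normalsE)
      have c1: "1 \<le> real (card F)" using F(2,3) by (simp add: Suc_leI card_gt_0_iff)
      have "1 * real m \<le> real (card F) * real m" using c1 by (intro mult_right_mono) auto
      then have "\<epsilon> powr (- t) < \<delta> powr (- t)" using F(4) m(2) by linarith
      then have \<delta>\<epsilon>: "\<delta> \<le> \<epsilon>" using \<epsilon> t(1) powr_mono2'[of "- t" \<epsilon> \<delta>] by (meson less_imp_le not_less neg_le_0_iff_le)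
      have "real (card F) * \<delta> powr t * real m < \<delta> powr (- t) * \<delta> powr t"
        using mult_strict_right_mono[OF F(4), of "\<delta> powr t"] F(1) by (simp add: mult_ac)
      also have "\<dots> = 1" using F(1) by (simp add: powr_add[symmetric])
      finally have "real (card F) * \<delta> powr t < 1 / real m" using mp by (simp add: field_simps)
      also have "1 / real m \<le> \<epsilon>" using m(1) \<epsilon> mp by (simp add: field_simps)
      finally have le: "real (card F) * \<delta> powr t \<le> \<epsilon>" by simp
      let ?F = "(\<lambda>q. q *\<^sub>R n) ` F"
      have "real (card ?F) * \<delta> powr t \<le> real (card F) * \<delta> powr t"
        using F(2) by (intro mult_right_mono) (auto intro: card_image_le)
      then have "real (card ?F) * \<delta> powr t \<le> \<epsilon>" using le by linarith
      moreover have "?E \<subseteq> (\<Union>c\<in>?F. cball c \<delta>)"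
      proof
        fix y assume "y \<in> ?E"
        then obtain x where x: "x \<in> X" "y = (n \<bullet> x) *\<^sub>R n" using orth_proj_perp[OF n1] by auto
        then obtain q where q: "q \<in> F" "\<bar>n \<bullet> x - q\<bar> < \<delta>" using F(5) by blast
        have "dist (q *\<^sub>R n) y = \<bar>n \<bullet> x - q\<bar>"
          using n1 unfolding x(2) by (simp add: dist_norm scaleR_diff_left[symmetric] abs_minus_commute)
        then have "y \<in> cball (q *\<^sub>R n) \<delta>" using q(2) by simp
        then show "y \<in> (\<Union>c\<in>?F. cball c \<delta>)" using q(1) by blast
      qed
      ultimately show "\<exists>F r. finite F \<and> 0 < r \<and> r \<le> \<epsilon> \<and> ?E \<subseteq> (\<Union>c\<in>F. cball c r) \<and> real (card F) * r powr t \<le> \<epsilon>"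
        using F(1,2) \<delta>\<epsilon> by (intro exI[of _ ?F] exI[of _ \<delta>]) auto
    qed
    then have "hausdorff_dim ?E \<le> ereal t" by (rule hausdorff_dim_leI[OF t(1)])
    moreover have "hausdorff_dim ?E = 1" using proj nN by (simp add: backward_furstenberg_eq)
    ultimately show False using t(2) by simp
  qed
  then obtain m where m: "m > 0" "thin_normals t m = {}" by blast
  have "1 / real m * \<delta> powr (- t) \<le> real (card F)"
    if "n \<in> normals" "\<delta> > 0" "finite F" "\<forall>x\<in>X. \<exists>q\<in>F. \<bar>n \<bullet> x - q\<bar> < \<delta>" for n \<delta> F
  proof (rule ccontr)
    assume "\<not> ?thesis"
    then have "real (card F) * real m < \<delta> powr (- t)" using m(1) by (simp add: field_simps)
    then have "n \<in> thin_normals t m" using that by (intro thin_normalsI) auto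
    then show False using m(2) by simp
  qed
  then show ?thesis using that[of "1 / real m"] m(1) by auto
qed

text \<open>
  It suffices to project the cylinder to the line of any fixed normal: the projection is a copy of a
  projection of \<open>X\<close> along another backward direction, scaled by a factor comparable to \<open>\<alpha>1 (A_w)\<close>.
\<close>

lemma cylinder_cover_count:
  assumes proj: "\<forall>V\<in>backward_furstenberg N A. hausdorff_dim (orth_proj (V\<^sup>\<bottom>) ` X) = 1"
    and t: "0 < t" "t < 1"
  obtains c where "c > 0" "\<forall>w\<in>all_words. \<forall>r>0. \<forall>F. finite F \<and> \<phi> w ` X \<subseteq> (\<Union>q\<in>F. cball q r) \<longrightarrow>
     c * (\<alpha>1 (W w) / r) powr t \<le> real (card F)"
proof -
  obtain c where c: "c > 0" "\<forall>n\<in>normals. \<forall>\<delta>>0. \<forall>F. finite F \<and> (\<forall>x\<in>X. \<exists>q\<in>F. \<bar>n \<bullet> x - q\<bar> < \<delta>) \<longrightarrow>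
     c * \<delta> powr (- t) \<le> real (card F)" by (rule uniform_projection_count[OF proj t])
  obtain d where d: "0 < d" "\<forall>n\<in>normals. \<forall>w\<in>all_words. d * \<alpha>1 (W w) \<le> norm (transpose (W w) *v n) \<and>
      (transpose (W w) *v n) /\<^sub>R norm (transpose (W w) *v n) \<in> normals" by (rule normals_transpose)
  obtain n where n: "n \<in> normals" using normals_nonempty by blast
  then have n1: "norm n = 1" by (simp add: normals_def)
  have "c * (d / 2) powr t * (\<alpha>1 (W w) / r) powr t \<le> real (card F)"
    if w: "w \<in> all_words" and r: "r > 0" and F: "finite F" "\<phi> w ` X \<subseteq> (\<Union>q\<in>F. cball q r)" for w r F
  proof -
    define p where "p = transpose (W w) *v n"
    have p: "d * \<alpha>1 (W w) \<le> norm p" "p /\<^sub>R norm p \<in> normals" using d(2) n w by (auto simp: p_def)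
    have pos: "0 < d * \<alpha>1 (W w)" using d(1) W_pos(1)[OF w] by simp
    then have pp: "norm p > 0" using p(1) by linarith
    let ?g = "\<lambda>q. (n \<bullet> q - n \<bullet> \<phi> w 0) / norm p"
    have "\<exists>s\<in>?g ` F. \<bar>(p /\<^sub>R norm p) \<bullet> x - s\<bar> < 2 * r / norm p" if x: "x \<in> X" for x
    proof -
      obtain q where q: "q \<in> F" "dist q (\<phi> w x) \<le> r" using F(2) x by auto
      have "\<bar>n \<bullet> (\<phi> w x - q)\<bar> \<le> r"
        using Cauchy_Schwarz_ineq2[of n "\<phi> w x - q"] n1 q(2) by (simp add: dist_norm norm_minus_commute)
      moreover have "(p /\<^sub>R norm p) \<bullet> x - ?g q = (n \<bullet> (\<phi> w x - q)) / norm p"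
        unfolding inner_diff_right inner_\<phi>[of n w x] p_def[symmetric] by (simp add: divide_inverse algebra_simps)
      ultimately have "\<bar>(p /\<^sub>R norm p) \<bullet> x - ?g q\<bar> \<le> r / norm p" using pp by (simp add: divide_right_mono)
      also have "\<dots> < 2 * r / norm p" using r pp by (simp add: divide_strict_right_mono)
      finally show ?thesis using q(1) by blast
    qed
    moreover have "2 * r / norm p > 0" "finite (?g ` F)" using r pp F(1) by auto
    ultimately have "c * (2 * r / norm p) powr (- t) \<le> real (card (?g ` F))" using c(2) p(2) by blast
    also have "\<dots> \<le> real (card F)" using F(1) by (simp add: card_image_le)
    finally have 1: "c * (2 * r / norm p) powr (- t) \<le> real (card F)" .
    have "(d / 2) powr t * (\<alpha>1 (W w) / r) powr t = (d * \<alpha>1 (W w) / (2 * r)) powr t"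
      using d(1) r W_pos(1)[OF w] by (subst powr_mult[symmetric]) auto
    also have "\<dots> \<le> (norm p / (2 * r)) powr t"
      using p(1) pos r t by (intro powr_mono2 divide_right_mono) auto
    also have "\<dots> = (2 * r / norm p) powr (- t)" using r pp by (simp add: powr_divide powr_minus_divide powr_mult)
    finally have "c * ((d / 2) powr t * (\<alpha>1 (W w) / r) powr t) \<le> c * (2 * r / norm p) powr (- t)"
      using c(1) by (intro mult_left_mono) auto
    then show ?thesis using 1 by (simp only: mult.assoc)
  qed
  then show ?thesis using that[of "c * (d / 2) powr t"] c(1) d(1) by auto
qed

end

section \<open>The lower bound\<close>

lemma pigeonhole_cover:
  fixes K :: real
  assumes "finite G" "real (card G) \<le> K" "finite Z" "\<And>z. z \<in> Z \<Longrightarrow> \<exists>g\<in>G. P g z" "Z \<noteq> {}"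
  shows "\<exists>g\<in>G. real (card Z) \<le> K * real (card {z\<in>Z. P g z})"
proof (rule ccontr)
  assume "\<not> ?thesis"
  then have lt: "K * real (card {z\<in>Z. P g z}) < real (card Z)" if "g \<in> G" for g using that by (meson not_le)
  have G: "G \<noteq> {}" using assms(4,5) by blast
  have K: "K > 0" using assms(1,2) G by (meson card_gt_0_iff of_nat_0_less_iff order.strict_trans2)
  have "Z \<subseteq> (\<Union>g\<in>G. {z\<in>Z. P g z})" using assms(4) by blast
  then have "card Z \<le> card (\<Union>g\<in>G. {z\<in>Z. P g z})" using assms(1,3) by (intro card_mono) auto
  also have "\<dots> \<le> (\<Sum>g\<in>G. card {z\<in>Z. P g z})" using assms(1) by (rule card_UN_le)
  finally have "K * real (card Z) \<le> (\<Sum>g\<in>G. K * real (card {z\<in>Z. P g z}))"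
    using K by (simp add: sum_distrib_left[symmetric] of_nat_sum[symmetric] del: of_nat_sum)
  also have "\<dots> < (\<Sum>g\<in>G. real (card Z))" using assms(1) G lt by (intro sum_strict_mono)
  also have "\<dots> = real (card G) * real (card Z)" by simp
  also have "\<dots> \<le> K * real (card Z)" using assms(2) by (rule mult_right_mono) simp
  finally show False by simp
qed

context dominated_ifs
begin

text \<open>
  \<open>adjugate B\<close> kills \<open>v\<close> only if \<open>B\<close> is singular with range spanned by \<open>v\<close>. For \<open>B\<close> in \<open>word_cone\<close> this is
  excluded as \<open>V\<close> is not a forward direction, and compactness gives a uniform bound.
\<close>

lemma transversal_expansion:
  assumes V: "V \<in> RP1" "V \<notin> forward_furstenberg N A" and v: "norm v = 1" "V = span {v}"
  obtains c where "c > 0" "\<forall>w\<in>words N. c * \<alpha>1 (W w) \<le> norm (adjugate (W w) *v v)"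
proof -
  define K where "K = {B \<in> word_cone. norm B = 1}"
  have K: "compact K"
  proof -
    have "K = word_cone \<inter> sphere 0 1" by (auto simp: K_def)
    then show ?thesis using closed_word_cone by (simp add: closed_Int_compact)
  qed
  have inK: "(1 / norm (W w)) *\<^sub>R W w \<in> K" if "w \<in> words N" for w
  proof -
    have "W w \<noteq> 0" using det_W[of w] that by (auto simp: words_iff det_2)
    then show ?thesis using W_in_word_cone[OF that] by (simp add: K_def)
  qed
  have "[1] \<in> words N" using N_pos by (auto simp: words_def)
  then have K0: "K \<noteq> {}" using inK by blast
  have "continuous_on K (\<lambda>B. norm (adjugate B *v v))"
    unfolding matrix_vector_mult_def
  proof (intro continuous_intros continuous_on_vec_lambda)
    have "linear adjugate" by (rule linearI) (simp_all add: vec_eq_iff forall_2)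
    then show "continuous_on K adjugate" by (simp add: linear_continuous_on linear_conv_bounded_linear)
  qed
  then obtain B where B: "B \<in> K" "\<forall>C\<in>K. norm (adjugate B *v v) \<le> norm (adjugate C *v v)"
    using continuous_attains_inf[OF K K0] by blast
  define c where "c = norm (adjugate B *v v)"
  have "c \<noteq> 0"
  proof
    assume "c = 0"
    then have "adjugate B *v perp (- perp v) = 0" by (simp add: c_def perp_minus)
    moreover have "adjugate B \<noteq> 0"
    proof
      assume "adjugate B = 0"
      then have "B = 0" by (metis adjugate_adjugate adjugate_scaleR scaleR_zero_left)
      then show False using B(1) by (simp add: K_def)
    qed
    moreover have "norm (- perp v) = 1" using v(1) by simp
    ultimately have "range ((*v) B) = span {v}" "rank B = 1"
      using range_singular_adjugate[of "adjugate B" "- perp v"] by (simp_all add: perp_minus)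
    then show False using V(2) B(1) v(2) unfolding forward_furstenberg_def K_def word_cone_def by blast
  qed
  then have c: "c > 0" by (simp add: c_def)
  have "c * \<alpha>1 (W w) \<le> norm (adjugate (W w) *v v)" if w: "w \<in> words N" for w
  proof -
    have "W w \<noteq> 0" using det_W[of w] w by (auto simp: words_iff det_2)
    then have nW: "norm (W w) > 0" by simp
    have "c \<le> norm (adjugate ((1 / norm (W w)) *\<^sub>R W w) *v v)" using B(2) inK[OF w] by (simp add: c_def)
    also have "\<dots> = norm (adjugate (W w) *v v) / norm (W w)"
      by (simp add: adjugate_scaleR scaleR_matrix_vector_assoc[symmetric])
    finally have "c * norm (W w) \<le> norm (adjugate (W w) *v v)" using nW by (simp add: field_simps)
    moreover have "c * \<alpha>1 (W w) \<le> c * norm (W w)" using c \<alpha>1_le_norm by (intro mult_left_mono) auto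
    ultimately show ?thesis by linarith
  qed
  then show ?thesis using that c by blast
qed

text \<open>
  Lengthening a word to the left by one letter changes \<open>\<alpha>2 / \<alpha>1\<close> at most by the factor \<open>L\<close>; take the
  shortest suffix for which it is at most \<open>\<delta>\<close>.
\<close>

lemma suffix_of_eccentricity:
  assumes L: "L \<ge> 1" "\<forall>i\<in>{1..N}. 1 / L \<le> \<alpha>2 (A i)" and \<delta>: "0 < \<delta>" "\<delta> < 1"
  shows "w \<in> all_words \<Longrightarrow> \<alpha>2 (W w) \<le> \<delta> * \<alpha>1 (W w) \<Longrightarrow>
    \<exists>u v. w = u @ v \<and> \<alpha>2 (W v) \<le> \<delta> * \<alpha>1 (W v) \<and> \<delta> * \<alpha>1 (W v) \<le> L * \<alpha>2 (W v)"
proof (induction w)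
  case Nil
  then show ?case using \<delta> by simp
next
  case (Cons i w)
  show ?case
  proof (cases "\<alpha>2 (W w) \<le> \<delta> * \<alpha>1 (W w)")
    case True
    then obtain u v where "w = u @ v" "\<alpha>2 (W v) \<le> \<delta> * \<alpha>1 (W v)" "\<delta> * \<alpha>1 (W v) \<le> L * \<alpha>2 (W v)" using Cons by auto
    then show ?thesis by (intro exI[of _ "i # u"] exI[of _ v]) simp
  next
    case False
    have i: "i \<in> {1..N}" using Cons by simp
    have "\<alpha>1 (A i) \<le> 1" using \<alpha>1_W_le_1[of "[i]"] i by simp
    then have "\<alpha>1 (A i) * \<alpha>1 (W w) \<le> 1 * \<alpha>1 (W w)" by (intro mult_right_mono) auto
    then have "\<alpha>1 (W (i # w)) \<le> \<alpha>1 (W w)" using \<alpha>1_mult_le[of "A i" "W w"] by simp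
    then have "\<delta> * \<alpha>1 (W (i # w)) \<le> \<delta> * \<alpha>1 (W w)" using \<delta> by (intro mult_left_mono) auto
    also have "\<dots> \<le> \<alpha>2 (W w)" using False by simp
    also have "\<dots> \<le> L * \<alpha>2 (W (i # w))"
    proof -
      have "(1 / L) * \<alpha>2 (W w) \<le> \<alpha>2 (A i) * \<alpha>2 (W w)" using L(2) i by (intro mult_right_mono) auto
      also have "\<dots> \<le> \<alpha>2 (W (i # w))" by (simp add: \<alpha>2_mult_ge)
      finally show ?thesis using L(1) by (simp add: field_simps)
    qed
    finally show ?thesis using Cons.prems(2) by (intro exI[of _ "[]"] exI[of _ "i # w"]) simp
  qed
qed

end

context wbnc_ifs
begin

text \<open>
  What remains of a small piece of a slice after blowing it up: a finite collinear subset \<open>S\<close> of \<open>X\<close>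
  with about \<open>\<epsilon> powr (- s)\<close> points of distance about \<open>\<epsilon>\<close> or more, together with a word \<open>j\<close> whose map
  contracts the direction \<open>u\<close> of their line almost as much as possible and has \<open>\<alpha>2 / \<alpha>1\<close> about \<open>\<delta>\<close>.
\<close>

definition microset :: "real \<Rightarrow> real \<Rightarrow> real \<Rightarrow> real \<Rightarrow> real \<Rightarrow> nat list \<Rightarrow> real^2 \<Rightarrow> (real^2) set \<Rightarrow> bool" where
  "microset c B s \<epsilon> \<delta> j u S \<longleftrightarrow> j \<in> all_words \<and> norm u = 1 \<and> norm (W j *v u) \<le> B * \<alpha>2 (W j) \<and>
     \<alpha>2 (W j) \<le> \<delta> * \<alpha>1 (W j) \<and> \<delta> * \<alpha>1 (W j) \<le> B * \<alpha>2 (W j) \<and>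
     S \<subseteq> X \<and> finite S \<and> S \<noteq> {} \<and> c * \<epsilon> powr (- s) \<le> real (card S) \<and>
     (\<forall>x\<in>S. \<forall>y\<in>S. x - y \<in> span {u}) \<and> (\<forall>x\<in>S. \<forall>y\<in>S. x \<noteq> y \<longrightarrow> c * \<epsilon> < norm (x - y))"

definition crowded_ball :: "real \<Rightarrow> real \<Rightarrow> real \<Rightarrow> bool" where
  "crowded_ball B \<delta> n \<longleftrightarrow> (\<exists>p\<in>X. \<exists>\<rho>>0. \<forall>F. finite F \<and>
     X \<inter> cball p (B * \<rho>) \<subseteq> (\<Union>q\<in>F. cball q (\<delta> * \<rho>)) \<longrightarrow> n \<le> real (card F))"

text \<open>
  Separated points in a small ball of the slice are pulled back by the map \<open>\<phi>_w\<close> of a cylinder that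
  contains a positive proportion of them. Since \<open>w\<close> is much longer than needed, it has a suffix \<open>j\<close> of
  prescribed eccentricity \<open>\<alpha>2 / \<alpha>1\<close> about \<open>\<delta>\<close>. As \<open>A_w\<close> contracts the line of the points, of direction \<open>u\<close>, like
  \<open>\<alpha>2 (A_w)\<close>, which is at most a constant times \<open>\<alpha>2 (A_i) \<alpha>2 (A_j)\<close> for \<open>w = i @ j\<close>, and \<open>A_i\<close> contracts
  nothing by more than \<open>\<alpha>2 (A_i)\<close>, also \<open>A_j\<close> contracts this line like \<open>\<alpha>2 (A_j)\<close>.
\<close>

lemma slice_microset:
  assumes V: "V \<in> RP1" "V \<notin> forward_furstenberg N A" and x0: "x0 \<in> X"
    and s: "ereal s < assouad_dim (slice X V x0)"
  obtains c B where "c > 0" "B > 0"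
    "\<forall>\<epsilon> \<delta>. 0 < \<epsilon> \<and> \<epsilon> \<le> 1/2 \<and> 0 < \<delta> \<and> \<delta> < 1 \<longrightarrow>
      (\<exists>j u S. microset c B s \<epsilon> \<delta> j u S)"
proof -
  obtain v where v: "norm v = 1" "V = span {v}" using RP1_unit[OF V(1)] by blast
  obtain c where c: "c > 0" "\<forall>w\<in>words N. c * \<alpha>1 (W w) \<le> norm (adjugate (W w) *v v)"
    by (rule transversal_expansion[OF V v])
  obtain K where K: "K > 0" "\<forall>x\<in>X. \<forall>r>0. finite (neighborhood_maps N A b X x r) \<and>
       real (card (neighborhood_maps N A b X x r)) \<le> K" by (rule neighborhood_count)
  obtain L where L: "L \<ge> 1" "\<forall>i\<in>{1..N}. 1 / L \<le> \<alpha>2 (A i)" by (rule letter_bound)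
  obtain C2 where C2: "0 < C2" "\<forall>u\<in>all_words. \<forall>v\<in>all_words. \<alpha>2 (W u ** W v) \<le> C2 * \<alpha>2 (W u) * \<alpha>2 (W v)"
    by (rule \<alpha>2_submultiplicative)
  define B where "B = max L (C2 / c)"
  define d where "d = min c (1 / K)"
  let ?S = "slice X V x0"
  have Sdiff: "\<exists>l. x - y = l *\<^sub>R v" if "x \<in> ?S" "y \<in> ?S" for x y
  proof -
    have "x \<in> (\<lambda>v. v + x0) ` V" "y \<in> (\<lambda>v. v + x0) ` V" using that by (simp_all add: slice_def)
    then obtain p q where "p \<in> V" "q \<in> V" "x = p + x0" "y = q + x0" by (elim imageE)
    then obtain a b' where "p = a *\<^sub>R v" "q = b' *\<^sub>R v" unfolding v(2) by (auto simp: span_singleton)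
    then show ?thesis using \<open>x = p + x0\<close> \<open>y = q + x0\<close> by (intro exI[of _ "a - b'"]) (simp add: scaleR_diff_left)
  qed
  have "0 \<in> V" unfolding v(2) by (rule span_zero)
  then have S0: "?S \<noteq> {}" using x0 unfolding slice_def by force
  have Sb: "bounded ?S" using compact_imp_bounded[OF compact_X] by (rule bounded_subset) (auto simp: slice_def)
  have "\<exists>j u S. microset d B s \<epsilon> \<delta> j u S"
    if \<epsilon>: "0 < \<epsilon>" "\<epsilon> \<le> 1/2" and \<delta>: "0 < \<delta>" "\<delta> < 1" for \<epsilon> \<delta>
  proof -
    obtain R0 where R0: "0 < R0" "R0 \<le> 1" "\<forall>w\<in>all_words. \<alpha>2 (W w) < R0 \<longrightarrow> \<alpha>2 (W w) \<le> \<delta> * \<alpha>1 (W w)"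
      by (rule small_\<alpha>2_eccentric[OF \<delta>(1)])
    obtain y R Z where Z: "y \<in> ?S" "0 < R" "R < R0" "finite Z" "Z \<subseteq> ?S \<inter> cball y R"
      "\<forall>z\<in>Z. \<forall>w\<in>Z. z \<noteq> w \<longrightarrow> \<epsilon> * R < dist z w" "\<epsilon> powr (- s) \<le> real (card Z)"
      by (rule separated_set_of_assouad_dim[OF Sb S0 s \<epsilon> R0(1)])
    have yX: "y \<in> X" and ZX: "Z \<subseteq> X" using Z(1,5) by (auto simp: slice_def)
    have "0 < \<epsilon> powr (- s)" using \<epsilon> by simp
    then have "0 < real (card Z)" using Z(7) by linarith
    then have Z0: "Z \<noteq> {}" by auto
    let ?G = "neighborhood_maps N A b X y R"
    have "\<exists>g\<in>?G. z \<in> g ` X" if z: "z \<in> Z" for z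
    proof (rule neighborhood_maps_cover[OF yX Z(2)])
      show "R < 1" using Z(3) R0(2) by linarith
      have "z \<in> cball y R" using subsetD[OF Z(5) z] by blast
      then show "z \<in> X" "dist y z \<le> R" using z ZX by auto
    qed
    moreover have "finite ?G" "real (card ?G) \<le> K" using K(2) yX Z(2) by auto
    ultimately obtain g where g: "g \<in> ?G" "real (card Z) \<le> K * real (card {z\<in>Z. z \<in> g ` X})"
      using pigeonhole_cover[of ?G K Z "\<lambda>g z. z \<in> g ` X"] Z(4) Z0 by blast
    obtain w where w: "w \<in> words N" "g = \<phi> w" "\<alpha>2 (W w) \<le> R"
      using g(1) unfolding neighborhood_maps_def by blast
    have wa: "w \<in> all_words" using w(1) by (simp add: words_iff)
    define S where "S = {x \<in> X. \<phi> w x \<in> Z}"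
    have diff: "det (W w) *\<^sub>R (x - x') = adjugate (W w) *v (\<phi> w x - \<phi> w x')" for x x'
      unfolding word_map_diff mult_adjugate(2) ..
    have det: "det (W w) \<noteq> 0" using det_W[OF wa] .
    have inj: "inj_on (\<phi> w) S"
    proof (rule inj_onI)
      fix x x' assume "\<phi> w x = \<phi> w x'"
      then show "x = x'" using diff[of x x'] det by simp
    qed
    have img: "\<phi> w ` S = {z\<in>Z. z \<in> g ` X}" unfolding S_def w(2) by auto
    have fS: "finite S" using inj img Z(4) by (metis (no_types, lifting) finite_Collect_conjI finite_image_iff finite_subset mem_Collect_eq subsetI)
    have "real (card S) = real (card {z\<in>Z. z \<in> g ` X})" using card_image[OF inj] img by simp
    then have "real (card Z) \<le> K * real (card S)" using g(2) by simp
    then have "\<epsilon> powr (- s) / K \<le> real (card S)" using Z(7) K(1) by (simp add: field_simps)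
    moreover have "d * \<epsilon> powr (- s) \<le> (1 / K) * \<epsilon> powr (- s)" by (intro mult_right_mono) (auto simp: d_def)
    ultimately have cS: "d * \<epsilon> powr (- s) \<le> real (card S)" by simp
    moreover have dp: "d > 0" using c(1) K(1) by (simp add: d_def)
    moreover have "\<epsilon> powr (- s) > 0" using \<epsilon> by simp
    ultimately have "0 < real (card S)" by (meson mult_pos_pos order.strict_trans2)
    then have Sne: "S \<noteq> {}" by auto
    define a where "a = norm (adjugate (W w) *v v)"
    have ca: "c * \<alpha>1 (W w) \<le> a" using c(2) w(1) by (simp add: a_def)
    have a1: "\<alpha>1 (W w) > 0" "\<alpha>2 (W w) > 0" using W_pos wa by auto
    then have ap: "a > 0" using ca c(1) by (meson mult_pos_pos order.strict_trans2)
    define u where "u = (adjugate (W w) *v v) /\<^sub>R a"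
    have u: "norm u = 1" using ap by (simp add: u_def a_def)
    have coll: "\<exists>l. \<phi> w x - \<phi> w x' = l *\<^sub>R v \<and> x - x' = (l * a / det (W w)) *\<^sub>R u" if xx: "x \<in> S" "x' \<in> S" for x x'
    proof -
      have "\<phi> w x \<in> ?S" "\<phi> w x' \<in> ?S" using xx Z(5) by (auto simp: S_def)
      then obtain l where l: "\<phi> w x - \<phi> w x' = l *\<^sub>R v" using Sdiff by blast
      have "det (W w) *\<^sub>R (x - x') = l *\<^sub>R (adjugate (W w) *v v)" unfolding diff l matrix_vector_mult_scaleR ..
      also have "\<dots> = (l * a) *\<^sub>R u" using ap by (simp add: u_def)
      finally have "(1 / det (W w)) *\<^sub>R (det (W w) *\<^sub>R (x - x')) = (1 / det (W w)) *\<^sub>R ((l * a) *\<^sub>R u)" by simp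
      then have "x - x' = (l * a / det (W w)) *\<^sub>R u" using det by simp
      then show ?thesis using l by blast
    qed
    have sep: "d * \<epsilon> < norm (x - x')" if xx: "x \<in> S" "x' \<in> S" "x \<noteq> x'" for x x'
    proof -
      obtain l where l: "\<phi> w x - \<phi> w x' = l *\<^sub>R v" "x - x' = (l * a / det (W w)) *\<^sub>R u" using coll xx by blast
      have "\<phi> w x \<noteq> \<phi> w x'" using inj xx by (auto dest: inj_onD)
      then have "\<epsilon> * R < dist (\<phi> w x) (\<phi> w x')" using Z(6) xx by (auto simp: S_def)
      also have "\<dots> = \<bar>l\<bar>" using l(1) v(1) by (simp add: dist_norm)
      finally have lR: "\<epsilon> * R < \<bar>l\<bar>" .
      have "\<epsilon> * \<alpha>2 (W w) \<le> \<epsilon> * R" using w(3) \<epsilon> by (intro mult_left_mono) auto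
      then have l2: "\<epsilon> * \<alpha>2 (W w) < \<bar>l\<bar>" using lR by linarith
      have "d * \<epsilon> \<le> c * \<epsilon>" using \<epsilon> by (intro mult_right_mono) (auto simp: d_def)
      also have "c * \<epsilon> = (c * \<alpha>1 (W w)) * (\<epsilon> * \<alpha>2 (W w)) / (\<alpha>1 (W w) * \<alpha>2 (W w))" using a1 by simp
      also have "\<dots> < a * \<bar>l\<bar> / (\<alpha>1 (W w) * \<alpha>2 (W w))"
        using a1 ca l2 \<epsilon> ap by (intro divide_strict_right_mono mult_le_less_imp_less) (auto simp: c(1))
      also have "\<dots> = norm (x - x')" unfolding l(2) \<alpha>1_mult_\<alpha>2 using u ap by (simp add: abs_mult)
      finally show ?thesis .
    qed
    have "\<alpha>2 (W w) \<le> \<delta> * \<alpha>1 (W w)" using R0(3) wa w(3) Z(3) by force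
    then obtain i j where ij: "w = i @ j" "\<alpha>2 (W j) \<le> \<delta> * \<alpha>1 (W j)" "\<delta> * \<alpha>1 (W j) \<le> L * \<alpha>2 (W j)"
      using suffix_of_eccentricity[OF L \<delta> wa] by blast
    have ija: "i \<in> all_words" "j \<in> all_words" using wa ij(1) by auto
    have Wu: "norm (W w *v u) \<le> \<alpha>2 (W w) / c"
    proof -
      have "norm (W w *v u) = \<bar>det (W w)\<bar> / a"
        using v(1) ap unfolding u_def matrix_vector_mult_scaleR mult_adjugate(1) by (simp add: divide_inverse abs_mult)
      also have "\<dots> \<le> (\<alpha>1 (W w) * \<alpha>2 (W w)) / (c * \<alpha>1 (W w))"
        unfolding \<alpha>1_mult_\<alpha>2[symmetric] using ca c(1) a1 ap by (intro divide_left_mono mult_pos_pos) auto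
      finally show ?thesis using a1 by simp
    qed
    have "\<alpha>2 (W i) * norm (W j *v u) \<le> norm (W i *v (W j *v u))" by (rule \<alpha>2_le_norm)
    also have "\<dots> = norm (W w *v u)" unfolding ij(1) by (simp add: matrix_vector_mul_assoc)
    also have "\<dots> \<le> (C2 * \<alpha>2 (W i) * \<alpha>2 (W j)) / c"
    proof -
      have "\<alpha>2 (W w) \<le> C2 * \<alpha>2 (W i) * \<alpha>2 (W j)" unfolding ij(1) using C2(2) ija by simp
      then show ?thesis using Wu c(1) by (meson divide_right_mono less_imp_le order.trans)
    qed
    finally have "\<alpha>2 (W i) * norm (W j *v u) \<le> \<alpha>2 (W i) * (C2 / c * \<alpha>2 (W j))" by (simp add: mult_ac)
    then have "norm (W j *v u) \<le> C2 / c * \<alpha>2 (W j)"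
      using W_pos(2)[OF ija(1)] by (rule mult_left_le_imp_le)
    also have "\<dots> \<le> B * \<alpha>2 (W j)" by (intro mult_right_mono) (auto simp: B_def)
    finally have Wju: "norm (W j *v u) \<le> B * \<alpha>2 (W j)" .
    have "L * \<alpha>2 (W j) \<le> B * \<alpha>2 (W j)" by (intro mult_right_mono) (auto simp: B_def)
    then have "\<delta> * \<alpha>1 (W j) \<le> B * \<alpha>2 (W j)" using ij(3) by linarith
    moreover have "\<forall>x\<in>S. \<forall>y\<in>S. x - y \<in> span {u}"
    proof (intro ballI)
      fix x x' assume "x \<in> S" "x' \<in> S"
      then obtain l where "x - x' = (l * a / det (W w)) *\<^sub>R u" using coll by blast
      then show "x - x' \<in> span {u}" by (simp add: span_mul span_base)
    qed
    moreover have "\<forall>x\<in>S. \<forall>y\<in>S. x \<noteq> y \<longrightarrow> d * \<epsilon> < norm (x - y)" using sep by blast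
    moreover have "S \<subseteq> X" by (auto simp: S_def)
    ultimately show ?thesis unfolding microset_def
      by (intro exI[of _ j] exI[of _ u] exI[of _ S] conjI ija u Wju ij(2) fS Sne cS)
  qed
  moreover have "d > 0" "B > 0" using c(1) K(1) L(1) by (auto simp: d_def B_def)
  ultimately show ?thesis by (intro that[of d B]) simp_all
qed

text \<open>
  With \<open>S\<close>, \<open>j\<close> and \<open>u\<close> from \<open>slice_microset\<close> for \<open>\<epsilon> = k * \<delta>\<close>, surround every point of \<open>S\<close> by a
  cylinder of size about \<open>\<delta>\<close>. Under \<open>\<phi>_j\<close> these cylinders have length about \<open>\<rho> = \<alpha>2 (A_j)\<close>, and
  \<open>cylinder_cover_count\<close> bounds the number of balls of radius \<open>\<delta> * \<rho>\<close> that each of them needs. No such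
  ball meets two of them: measured along the short axis of \<open>\<phi>_j\<close>, which is transversal to \<open>u\<close>, they are
  too far apart.
\<close>

lemma many_balls:
  assumes V: "V \<in> RP1" "V \<notin> forward_furstenberg N A" and x0: "x0 \<in> X"
    and s: "ereal s < assouad_dim (slice X V x0)"
    and proj: "\<forall>V\<in>backward_furstenberg N A. hausdorff_dim (orth_proj (V\<^sup>\<bottom>) ` X) = 1"
    and t: "0 < t" "t < 1"
  obtains c B \<delta>0 where "c > 0" "B \<ge> 1" "\<delta>0 > 0" "\<delta>0 < 1"
    "\<forall>\<delta>. 0 < \<delta> \<and> \<delta> < \<delta>0 \<longrightarrow> crowded_ball B \<delta> (c * \<delta> powr (- (s + t)))"
proof -
  obtain d B where d: "d > 0" and B: "B > 0" and micro:
    "\<forall>\<epsilon> \<delta>. 0 < \<epsilon> \<and> \<epsilon> \<le> 1/2 \<and> 0 < \<delta> \<and> \<delta> < 1 \<longrightarrow>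
      (\<exists>j u S. microset d B s \<epsilon> \<delta> j u S)"
    by (rule slice_microset[OF V x0 s])
  obtain c where c: "c > 0" "\<forall>w\<in>all_words. \<forall>r>0. \<forall>F. finite F \<and> \<phi> w ` X \<subseteq> (\<Union>q\<in>F. cball q r) \<longrightarrow>
     c * (\<alpha>1 (W w) / r) powr t \<le> real (card F)" by (rule cylinder_cover_count[OF proj t])
  obtain c1 where c1: "0 < c1" "\<forall>u\<in>all_words. \<forall>v\<in>all_words. c1 * \<alpha>1 (W u) * \<alpha>1 (W v) \<le> \<alpha>1 (W u ** W v)"
    by (rule almost_multiplicative)
  obtain L where L: "L \<ge> 1" "\<forall>i\<in>{1..N}. 1 / L \<le> \<alpha>2 (A i)" by (rule letter_bound)
  obtain M where M: "M > 0" "\<forall>z\<in>X. \<forall>x\<in>X. norm (z - x) \<le> M" by (rule X_bounded)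
  \<comment> \<open>A ball that meets two images forces their points within \<open>4 * (1 + M) * \<delta>\<close>, against separation \<open>d * (k * \<delta>)\<close>.\<close>
  define k where "k = 4 * (1 + M) / d"
  have k: "k > 0" using M d by (simp add: k_def)
  define B' where "B' = max 1 (2 * (B * M))"
  \<comment> \<open>The bound \<open>1 / (2 * B)\<close> makes the short axis transversal to \<open>u\<close>.\<close>
  define \<delta>0 where "\<delta>0 = min (1/2) (min (1 / (2 * k)) (1 / (2 * B)))"
  define c' where "c' = (d * k powr (- s)) * (c * (c1 / L) powr t)"
  have c': "c' > 0" using d k c c1 L by (simp add: c'_def)
  have "crowded_ball B' \<delta> (c' * \<delta> powr (- (s + t)))" if \<delta>: "0 < \<delta>" "\<delta> < \<delta>0" for \<delta>
  proof -
    have \<delta>': "\<delta> < 1" "k * \<delta> \<le> 1/2" "B * \<delta> \<le> 1/2" using \<delta> k B by (auto simp: \<delta>0_def field_simps)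
    have k\<delta>: "0 < k * \<delta>" using k \<delta> by simp
    obtain j u S where j: "j \<in> all_words" and u: "norm u = 1" "norm (W j *v u) \<le> B * \<alpha>2 (W j)"
      and jd: "\<alpha>2 (W j) \<le> \<delta> * \<alpha>1 (W j)" "\<delta> * \<alpha>1 (W j) \<le> B * \<alpha>2 (W j)"
      and S: "S \<subseteq> X" "finite S" "S \<noteq> {}" "d * (k * \<delta>) powr (- s) \<le> real (card S)"
      and coll: "\<forall>x\<in>S. \<forall>y\<in>S. x - y \<in> span {u}" and sep: "\<forall>x\<in>S. \<forall>y\<in>S. x \<noteq> y \<longrightarrow> d * (k * \<delta>) < norm (x - y)"
      using micro[rule_format, of "k * \<delta>" \<delta>] k\<delta> \<delta>' \<delta>(1) unfolding microset_def by blast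
    define \<rho> where "\<rho> = \<alpha>2 (W j)"
    have a1: "\<alpha>1 (W j) > 0" and \<rho>: "\<rho> > 0" using W_pos j by (auto simp: \<rho>_def)
    obtain f e e' where f: "norm f = 1" "norm e = 1" "e' = perp e \<or> e' = - perp e"
        "\<forall>v. e \<bullet> (W j *v v) = \<alpha>1 (W j) * (f \<bullet> v)" "\<forall>v. e' \<bullet> (W j *v v) = \<rho> * (perp f \<bullet> v)"
      unfolding \<rho>_def using singular_value_decomposition by metis
    have e'1: "norm e' = 1" using f(2,3) by auto
    have fu: "1/2 \<le> \<bar>perp f \<bullet> u\<bar>"
    proof -
      have "\<alpha>1 (W j) * \<bar>f \<bullet> u\<bar> = \<bar>e \<bullet> (W j *v u)\<bar>" using f(4) a1 by (simp add: abs_mult)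
      also have "\<dots> \<le> norm (W j *v u)" using Cauchy_Schwarz_ineq2[of e "W j *v u"] f(2) by simp
      also have "\<dots> \<le> B * (\<delta> * \<alpha>1 (W j))" using u(2) jd(1) B mult_left_mono[OF jd(1), of B] by linarith
      finally have "\<alpha>1 (W j) * \<bar>f \<bullet> u\<bar> \<le> \<alpha>1 (W j) * (B * \<delta>)" by (simp add: mult_ac)
      then have "\<bar>f \<bullet> u\<bar> \<le> B * \<delta>" using a1 by simp
      then have "\<bar>f \<bullet> u\<bar> \<le> 1/2" using \<delta>'(3) by linarith
      then have "(f \<bullet> u)\<^sup>2 \<le> (1/2)\<^sup>2" by (metis power2_abs power_mono abs_ge_zero)
      then have "(1/2)\<^sup>2 \<le> \<bar>perp f \<bullet> u\<bar>\<^sup>2" using perp_decomp(2)[OF f(1), of u] u(1) by (simp add: power2_eq_square)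
      then show ?thesis by (rule power2_le_imp_le) simp
    qed
    obtain m where m: "\<forall>w\<in>all_words. length w = m \<longrightarrow> \<alpha>1 (W w) \<le> \<delta>" using small_words[OF \<delta>(1)] by blast
    have "\<forall>x\<in>S. \<exists>l. l \<in> words N \<and> x \<in> \<phi> l ` X \<and> \<alpha>1 (W l) \<le> \<delta> \<and> \<delta> < \<alpha>1 (W (butlast l))"
    proof
      fix x assume "x \<in> S"
      then show "\<exists>l. l \<in> words N \<and> x \<in> \<phi> l ` X \<and> \<alpha>1 (W l) \<le> \<delta> \<and> \<delta> < \<alpha>1 (W (butlast l))"
        using stopping_word[of x \<delta> "\<lambda>w. \<alpha>1 (W w)" m] m \<delta>'(1) S(1) by (metis \<alpha>1_mat1(1) subsetD word_matrix_simps(1))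
    qed
    from bchoice[OF this] obtain l where l: "\<forall>x\<in>S. l x \<in> words N \<and> x \<in> \<phi> (l x) ` X \<and> \<alpha>1 (W (l x)) \<le> \<delta> \<and> \<delta> < \<alpha>1 (W (butlast (l x)))"
      by (elim exE)
    have la: "l x \<in> all_words" if "x \<in> S" for x using l that by (simp add: words_iff)
    have lge: "\<delta> \<le> L * \<alpha>1 (W (l x))" if "x \<in> S" for x
      using l that butlast_\<alpha>(2)[OF L, of "l x"] by fastforce
    have cyl: "norm (z - x) \<le> \<delta> * M" if "x \<in> S" "z \<in> \<phi> (l x) ` X" for x z
    proof -
      have "x \<in> \<phi> (l x) ` X" using l that(1) by blast
      with that(2) obtain y y' where y: "y \<in> X" "y' \<in> X" "z = \<phi> (l x) y" "x = \<phi> (l x) y'"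
        by (elim imageE)
      have "norm (z - x) = norm (W (l x) *v (y - y'))" using y(3,4) by (metis word_map_diff)
      also have "\<dots> \<le> \<alpha>1 (W (l x)) * norm (y - y')" by (rule norm_le_\<alpha>1)
      also have "\<dots> \<le> \<delta> * M" using l that(1) M y \<delta>(1) by (intro mult_mono) auto
      finally show ?thesis .
    qed
    have lX: "\<phi> (l x) ` X \<subseteq> X" if "x \<in> S" for x using \<phi>_mem[OF la[OF that]] by blast
    obtain x1 where x1: "x1 \<in> S" using S(3) by blast
    define T where "T x = \<phi> (j @ l x) ` X" for x
    have TX: "T x \<subseteq> X \<inter> cball (\<phi> j x1) (B' * \<rho>)" if x: "x \<in> S" for x
    proof
      fix p assume "p \<in> T x"
      then obtain z where z: "z \<in> \<phi> (l x) ` X" "p = \<phi> j z" by (auto simp: T_def)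
      have zX: "z \<in> X" using z(1) lX[OF x] by blast
      have "norm (\<phi> j z - \<phi> j x) \<le> \<alpha>1 (W j) * norm (z - x)" unfolding word_map_diff by (rule norm_le_\<alpha>1)
      also have "\<dots> \<le> \<alpha>1 (W j) * (\<delta> * M)" using cyl[OF x z(1)] by (intro mult_left_mono) auto
      also have "\<dots> = (\<delta> * \<alpha>1 (W j)) * M" by simp
      also have "\<dots> \<le> B * \<rho> * M" using jd(2) M(1) by (intro mult_right_mono) (auto simp: \<rho>_def)
      finally have 1: "norm (\<phi> j z - \<phi> j x) \<le> B * \<rho> * M" .
      obtain \<kappa> where \<kappa>: "x - x1 = \<kappa> *\<^sub>R u" using coll x x1 by (auto simp: span_singleton)
      have "\<bar>\<kappa>\<bar> \<le> M" using M(2) x x1 S(1) \<kappa> u(1) by (metis norm_scaleR mult.right_neutral subsetD)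
      then have "\<bar>\<kappa>\<bar> * norm (W j *v u) \<le> M * (B * \<rho>)" using u(2) M(1) by (intro mult_mono) (auto simp: \<rho>_def)
      then have "norm (\<phi> j x - \<phi> j x1) \<le> M * (B * \<rho>)" unfolding word_map_diff \<kappa> matrix_vector_mult_scaleR by simp
      then have "norm (\<phi> j z - \<phi> j x1) \<le> 2 * (B * M) * \<rho>"
        using 1 norm_triangle_ineq[of "\<phi> j z - \<phi> j x" "\<phi> j x - \<phi> j x1"] by (simp add: mult_ac)
      also have "\<dots> \<le> B' * \<rho>" using \<rho> by (intro mult_right_mono) (auto simp: B'_def)
      finally have "dist (\<phi> j x1) p \<le> B' * \<rho>" using z(2) by (simp add: dist_norm norm_minus_commute)
      then show "p \<in> X \<inter> cball (\<phi> j x1) (B' * \<rho>)" using \<phi>_mem[OF j zX] z(2) by simp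
    qed
    have disj: "x = x'" if xx: "x \<in> S" "x' \<in> S" and p: "p \<in> T x" "p' \<in> T x'" and q: "dist q p \<le> \<delta> * \<rho>" "dist q p' \<le> \<delta> * \<rho>"
      for x x' p p' q
    proof (rule ccontr)
      assume ne: "x \<noteq> x'"
      obtain z z' where z: "z \<in> \<phi> (l x) ` X" "p = \<phi> j z" "z' \<in> \<phi> (l x') ` X" "p' = \<phi> j z'" using p by (auto simp: T_def)
      obtain \<kappa> where \<kappa>: "x - x' = \<kappa> *\<^sub>R u" using coll xx by (auto simp: span_singleton)
      have "d * (k * \<delta>) < \<bar>\<kappa>\<bar>" using sep xx ne \<kappa> u(1) by (metis norm_scaleR mult.right_neutral)
      then have big: "4 * (1 + M) * \<delta> < \<bar>\<kappa>\<bar>" using d by (simp add: k_def)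
      have pf: "\<bar>perp f \<bullet> h\<bar> \<le> norm h" for h using Cauchy_Schwarz_ineq2[of "perp f" h] f(1) by simp
      have "norm (p - p') \<le> 2 * (\<delta> * \<rho>)" using q dist_triangle3[of p p' q] by (simp add: dist_norm)
      then have "\<bar>e' \<bullet> (p - p')\<bar> \<le> 2 * (\<delta> * \<rho>)" using Cauchy_Schwarz_ineq2[of e' "p - p'"] e'1 by simp
      then have "\<rho> * \<bar>perp f \<bullet> (z - z')\<bar> \<le> \<rho> * (2 * \<delta>)"
        unfolding z word_map_diff using f(5) \<rho> by (simp add: abs_mult mult_ac)
      then have 1: "\<bar>perp f \<bullet> (z - z')\<bar> \<le> 2 * \<delta>" using \<rho> by simp
      have "\<kappa> * (perp f \<bullet> u) = perp f \<bullet> (z - z') - perp f \<bullet> (z - x) + perp f \<bullet> (z' - x')"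
        using arg_cong[OF \<kappa>, of "\<lambda>h. perp f \<bullet> h"] by (simp add: inner_diff_right)
      then have "\<bar>\<kappa> * (perp f \<bullet> u)\<bar> \<le> 2 * \<delta> + \<delta> * M + \<delta> * M"
        using 1 pf[of "z - x"] pf[of "z' - x'"] cyl[OF xx(1) z(1)] cyl[OF xx(2) z(3)] by linarith
      moreover have "\<bar>\<kappa>\<bar> * (1/2) \<le> \<bar>\<kappa> * (perp f \<bullet> u)\<bar>" unfolding abs_mult using fu by (intro mult_left_mono) auto
      ultimately have "\<bar>\<kappa>\<bar> \<le> 4 * (1 + M) * \<delta>" by (simp add: algebra_simps)
      then show False using big by simp
    qed
    have "c' * \<delta> powr (- (s + t)) \<le> real (card F)"
      if F: "finite F" "X \<inter> cball (\<phi> j x1) (B' * \<rho>) \<subseteq> (\<Union>q\<in>F. cball q (\<delta> * \<rho>))" for F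
    proof -
      define G where "G x = {q\<in>F. cball q (\<delta> * \<rho>) \<inter> T x \<noteq> {}}" for x
      have Gc: "c * ((c1 / L) / \<delta>) powr t \<le> real (card (G x))" if x: "x \<in> S" for x
      proof -
        have "\<phi> (j @ l x) ` X \<subseteq> (\<Union>q\<in>G x. cball q (\<delta> * \<rho>))"
        proof
          fix p assume p: "p \<in> \<phi> (j @ l x) ` X"
          then have "p \<in> T x" by (simp add: T_def)
          moreover obtain q where "q \<in> F" "p \<in> cball q (\<delta> * \<rho>)" using TX[OF x] F(2) calculation by blast
          ultimately show "p \<in> (\<Union>q\<in>G x. cball q (\<delta> * \<rho>))" unfolding G_def by blast
        qed
        moreover have "finite (G x)" "\<delta> * \<rho> > 0" "j @ l x \<in> all_words" using F(1) \<delta> \<rho> j la[OF x] by (auto simp: G_def)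
        ultimately have cnt: "c * (\<alpha>1 (W (j @ l x)) / (\<delta> * \<rho>)) powr t \<le> real (card (G x))" using c(2) by blast
        have "c1 * (\<rho> / \<delta>) * (\<delta> / L) \<le> c1 * \<alpha>1 (W j) * \<alpha>1 (W (l x))"
        proof (rule mult_mono)
          show "c1 * (\<rho> / \<delta>) \<le> c1 * \<alpha>1 (W j)"
            using jd(1) \<delta>(1) c1(1) by (intro mult_left_mono) (auto simp: \<rho>_def divide_le_eq mult.commute)
          show "\<delta> / L \<le> \<alpha>1 (W (l x))" using lge[OF x] L(1) by (simp add: divide_le_eq mult.commute)
        qed (use c1 \<delta> L in auto)
        also have "\<dots> \<le> \<alpha>1 (W (j @ l x))" using c1(2) j la[OF x] by simp
        finally have "c1 * \<rho> / L \<le> \<alpha>1 (W (j @ l x))" using \<delta>(1) by simp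
        then have "(c1 * \<rho> / L) / (\<delta> * \<rho>) \<le> \<alpha>1 (W (j @ l x)) / (\<delta> * \<rho>)" using \<delta>(1) \<rho> by (intro divide_right_mono) auto
        then have "(c1 / L) / \<delta> \<le> \<alpha>1 (W (j @ l x)) / (\<delta> * \<rho>)" using \<rho> by (simp add: field_simps)
        then have "((c1 / L) / \<delta>) powr t \<le> (\<alpha>1 (W (j @ l x)) / (\<delta> * \<rho>)) powr t"
          using c1 L \<delta> t by (intro powr_mono2) auto
        then show ?thesis using cnt mult_left_mono[of _ _ c] c(1) by (meson less_imp_le order.trans)
      qed
      have "c' * \<delta> powr (- (s + t)) = (d * (k * \<delta>) powr (- s)) * (c * ((c1 / L) / \<delta>) powr t)"
      proof -
        have "(k * \<delta>) powr (- s) = k powr (- s) * \<delta> powr (- s)" using k \<delta> by (simp add: powr_mult)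
        moreover have "((c1 / L) / \<delta>) powr t = (c1 / L) powr t * \<delta> powr (- t)"
          using c1(1) L(1) \<delta>(1) by (subst powr_divide) (simp_all add: powr_minus_divide)
        moreover have "\<delta> powr (- (s + t)) = \<delta> powr (- s) * \<delta> powr (- t)" by (simp add: powr_add[symmetric])
        ultimately show ?thesis by (simp add: c'_def)
      qed
      also have "\<dots> \<le> real (card S) * (c * ((c1 / L) / \<delta>) powr t)"
        using S(4) c(1) by (intro mult_right_mono) auto
      also have "\<dots> = (\<Sum>x\<in>S. c * ((c1 / L) / \<delta>) powr t)" by simp
      also have "\<dots> \<le> (\<Sum>x\<in>S. real (card (G x)))" using Gc by (rule sum_mono)
      also have "\<dots> = real (card (\<Union>x\<in>S. G x))"
      proof -
        have "G x \<inter> G x' = {}" if "x \<in> S" "x' \<in> S" "x \<noteq> x'" for x x'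
          using disj[OF that(1,2)] that(3) unfolding G_def by fastforce
        then have "card (\<Union>x\<in>S. G x) = (\<Sum>x\<in>S. card (G x))" using S(2) F(1)
          by (intro card_UN_disjoint) (auto simp: G_def)
        then show ?thesis by simp
      qed
      also have "\<dots> \<le> real (card F)" using F(1) by (intro of_nat_mono card_mono) (auto simp: G_def)
      finally show ?thesis .
    qed
    moreover have "\<phi> j x1 \<in> X" using \<phi>_mem[OF j] x1 S(1) by blast
    ultimately show ?thesis using \<rho> unfolding crowded_ball_def
      by (intro bexI[of _ "\<phi> j x1"] exI[of _ \<rho>]) simp_all
  qed
  moreover have "\<delta>0 > 0" "\<delta>0 < 1" "B' \<ge> 1" using k B by (auto simp: \<delta>0_def B'_def)
  ultimately show ?thesis using c' by (intro that[of c' B' \<delta>0]) simp_all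
qed

text \<open>
  The number of balls in \<open>many_balls\<close> exceeds every bound \<open>const * \<delta> powr (- q)\<close> with \<open>q < s + t\<close>.
\<close>

lemma assouad_dim_ge_slice_aux:
  assumes V: "V \<in> RP1" "V \<notin> forward_furstenberg N A" and x0: "x0 \<in> X"
    and s: "ereal s < assouad_dim (slice X V x0)"
    and proj: "\<forall>V\<in>backward_furstenberg N A. hausdorff_dim (orth_proj (V\<^sup>\<bottom>) ` X) = 1"
    and t: "0 < t" "t < 1"
  shows "ereal (s + t) \<le> assouad_dim X"
proof (rule ccontr)
  assume "\<not> ?thesis"
  then have "assouad_dim X < ereal (s + t)" by simp
  then obtain q C where q: "q < s + t" "C > 0" "q > 0" and
    cov: "\<forall>x\<in>X. \<forall>r R. 0 < r \<and> r < R \<longrightarrow> (\<exists>F. finite F \<and> X \<inter> cball x R \<subseteq> (\<Union>c\<in>F. cball c r) \<and> real (card F) \<le> C * (R / r) powr q)"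
    unfolding assouad_dim_def Inf_less_iff covering_number_le_iff by auto
  obtain c B \<delta>0 where c: "c > 0" and B: "B \<ge> 1" and \<delta>0: "\<delta>0 > 0" "\<delta>0 < 1" and many:
    "\<forall>\<delta>. 0 < \<delta> \<and> \<delta> < \<delta>0 \<longrightarrow> crowded_ball B \<delta> (c * \<delta> powr (- (s + t)))" by (rule many_balls[OF V x0 s proj t])
  define h where "h = s + t - q"
  define K where "K = C * B powr q"
  have h: "h > 0" using q by (simp add: h_def)
  have K: "K > 0" using q B by (simp add: K_def)
  define \<delta> where "\<delta> = min (\<delta>0 / 2) ((c / (2 * K)) powr (1 / h))"
  have \<delta>: "0 < \<delta>" "\<delta> < \<delta>0" "\<delta> \<le> (c / (2 * K)) powr (1 / h)" using \<delta>0 c K by (auto simp: \<delta>_def)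
  obtain p \<rho> where p: "p \<in> X" "\<rho> > 0" "\<forall>F. finite F \<and> X \<inter> cball p (B * \<rho>) \<subseteq> (\<Union>q\<in>F. cball q (\<delta> * \<rho>)) \<longrightarrow>
        c * \<delta> powr (- (s + t)) \<le> real (card F)" using many[rule_format, OF conjI[OF \<delta>(1,2)]] unfolding crowded_ball_def by blast
  have "\<delta> * \<rho> < B * \<rho>" "0 < \<delta> * \<rho>" using \<delta> \<delta>0 B p(2) by auto
  then obtain F where F: "finite F" "X \<inter> cball p (B * \<rho>) \<subseteq> (\<Union>c\<in>F. cball c (\<delta> * \<rho>))"
    "real (card F) \<le> C * (B * \<rho> / (\<delta> * \<rho>)) powr q" using cov[rule_format, OF p(1), of "\<delta> * \<rho>" "B * \<rho>"] by auto
  have "c * \<delta> powr (- (s + t)) \<le> real (card F)" using p(3) F by blast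
  also have "\<dots> \<le> C * (B * \<rho> / (\<delta> * \<rho>)) powr q" by (rule F(3))
  also have "\<dots> = K * \<delta> powr (- q)" using p(2) B \<delta>(1) by (simp add: K_def powr_divide powr_minus_divide)
  finally have "c * \<delta> powr (- (s + t)) * \<delta> powr (s + t) \<le> K * \<delta> powr (- q) * \<delta> powr (s + t)"
    by (rule mult_right_mono) simp
  then have "c \<le> K * \<delta> powr h"
    using \<delta>(1) by (simp add: mult.assoc powr_add[symmetric] h_def)
  also have "\<dots> \<le> K * ((c / (2 * K)) powr (1 / h)) powr h"
    using \<delta> h K by (intro mult_left_mono powr_mono2) auto
  also have "\<dots> = c / 2" using h c K by (simp add: powr_powr)
  finally show False using c by simp
qed

lemma assouad_dim_ge_slice:
  assumes V: "V \<in> RP1 - forward_furstenberg N A" and x0: "x0 \<in> X"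
    and proj: "\<forall>V\<in>backward_furstenberg N A. hausdorff_dim (orth_proj (V\<^sup>\<bottom>) ` X) = 1"
  shows "1 + assouad_dim (slice X V x0) \<le> assouad_dim X"
proof (cases "assouad_dim X")
  case (real r)
  show ?thesis
  proof (rule ccontr)
    assume "\<not> ?thesis"
    then have "ereal r < 1 + assouad_dim (slice X V x0)" using real by simp
    then have "ereal (r - 1) < assouad_dim (slice X V x0)"
      by (cases "assouad_dim (slice X V x0)") (auto simp: one_ereal_def)
    then obtain s where s: "ereal (r - 1) < ereal s" "ereal s < assouad_dim (slice X V x0)"
      using ereal_dense2 by blast
    define t where "t = max (1/2) ((r - s + 1) / 2)"
    have "(r - s + 1) / 2 \<le> t" by (simp add: t_def)
    moreover have "r - 1 < s" using s(1) by simp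
    ultimately have "r < s + t" by argo
    moreover have "0 < t" "t < 1" using \<open>r - 1 < s\<close> by (auto simp: t_def)
    ultimately have t: "0 < t" "t < 1" "r < s + t" by blast+
    have "ereal (s + t) \<le> assouad_dim X" using assouad_dim_ge_slice_aux[OF _ _ x0 s(2) proj t(1,2)] V by blast
    then show False using real t(3) by simp
  qed
qed (use assouad_dim_nonneg[of X] in auto)

end

section \<open>The Assouad dimension as a maximum over slices\<close>

theorem theorem4p1:
  fixes N :: nat and A :: "nat \<Rightarrow> real^2^2" and b :: "nat \<Rightarrow> real^2" and X :: "(real^2) set"
  assumes "self_affine_set N A b X"
    and "dominated N A"
    and "weak_bounded_neighborhood N A b X"
    and "hausdorff_dim X \<ge> 1"
    and "\<forall>V\<in>backward_furstenberg N A. hausdorff_dim (orth_proj (V\<^sup>\<bottom>) ` X) = 1"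
  shows "\<exists>m1 m2.
      is_maximum {hausdorff_dim (slice X V x) |x V. x \<in> X \<and> V \<in> backward_furstenberg N A} m1 \<and>
      is_maximum {assouad_dim (slice X V x) |x V. x \<in> X \<and> V \<in> RP1 - forward_furstenberg N A} m2 \<and>
      assouad_dim X = 1 + m1 \<and>
      assouad_dim X = 1 + m2"
proof -
  interpret wbnc_ifs N A b X
    using assms(1,2,3) by unfold_locales
  obtain x n where x: "x \<in> X" and n: "n \<in> normals"
    and upper: "assouad_dim X \<le> 1 + hausdorff_dim (slice X (span {perp n}) x)"
    by (rule assouad_dim_le_slice)
  \<comment> \<open>This one slice attains both maxima.\<close>
  define V where "V = span {perp n}"
  have V: "V \<in> backward_furstenberg N A" using n by (simp add: V_def backward_furstenberg_eq)
  have lower: "1 + assouad_dim (slice X V' y) \<le> assouad_dim X" if "y \<in> X" "V' \<in> RP1 - forward_furstenberg N A" for y V'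
    using assouad_dim_ge_slice[OF that(2,1) assms(5)] .
  have HA: "hausdorff_dim (slice X V' y) \<le> assouad_dim (slice X V' y)" for V' y
    using compact_imp_bounded[OF compact_X]
    by (intro hausdorff_dim_le_assouad_dim) (auto simp: slice_def intro: bounded_subset)
  let ?h = "hausdorff_dim (slice X V x)" and ?a = "assouad_dim (slice X V x)"
  have cancel: "p \<le> q" if "1 + p \<le> 1 + q" for p q :: ereal
    using that by (cases p; cases q) (auto simp: one_ereal_def)
  have "1 + ?a \<le> assouad_dim X" using lower x backward_not_forward[OF V] by blast
  moreover have "assouad_dim X \<le> 1 + ?h" using upper by (simp add: V_def)
  moreover have "1 + ?h \<le> 1 + ?a" using HA by (intro add_left_mono)
  ultimately have eq: "assouad_dim X = 1 + ?h" "assouad_dim X = 1 + ?a" by auto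
  have max2: "assouad_dim (slice X V' y) \<le> ?a" if "y \<in> X" "V' \<in> RP1 - forward_furstenberg N A" for y V'
    by (rule cancel) (use lower[OF that] eq(2) in simp)
  have max1: "hausdorff_dim (slice X V' y) \<le> ?h" if "y \<in> X" "V' \<in> backward_furstenberg N A" for y V'
  proof -
    have "1 + assouad_dim (slice X V' y) \<le> 1 + ?h" using lower[OF that(1) backward_not_forward[OF that(2)]] eq(1) by simp
    then show ?thesis using cancel HA order.trans by blast
  qed
  show ?thesis
  proof (intro exI conjI)
    show "is_maximum {hausdorff_dim (slice X V x) |x V. x \<in> X \<and> V \<in> backward_furstenberg N A} ?h"
      unfolding is_maximum_def using x V max1 by blast
    show "is_maximum {assouad_dim (slice X V x) |x V. x \<in> X \<and> V \<in> RP1 - forward_furstenberg N A} ?a"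
      unfolding is_maximum_def using x backward_not_forward[OF V] max2 by blast
  qed (fact eq)+
qed

end
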